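(* Let $R\subset\mathbb R^N$ be a root system with multiplicity function $k\ge0$, and let $(X_t^\lambda)_{t\ge0}$ be a Dunkl process on $\mathbb R^N$ of type $R$ with multiplicity $k$ and drift $\lambda\in\mathbb R^N$ such that the starting distribution $P_{X_0^\lambda}$ has first moments. Then $(X_t^\lambda-t\lambda)_{t\ge0}$ is a martingale with respect to the canonical filtration of $(X_t^\lambda)_{t\ge0}$. In particular, for $P_{X_0^\lambda}=\delta_0$, $E(X_t^\lambda)=t\lambda$.
   Context: $\mathbb R^N$ carries the usual scalar product $\langle\cdot,\cdot\rangle$ (extended bilinearly to $\mathbb C^N$) and norm $\|\cdot\|$. A root system $R\subset\mathbb R^N\setminus\{0\}$ is a finite set with $\sigma_\alpha(R)=R$ for all $\alpha\in R$, where $\sigma_\alpha$ is the orthogonal reflection in the hyperplane $\alpha^\perp$; $W$ is the finite group generated by the $\sigma_\alpha$; $R_+\subset R$ is a fixed positive subsystem; $k:R\to[0,\infty)$ is a $W$-invariant multiplicity function; $\gamma=\sum_{\alpha\in R_+}k(\alpha)$. Dunkl operators: $T_\xi(k)f(x)=\partial_\xi f(x)+\sum_{\alpha\in R_+}k(\alpha)\langle\alpha,\xi\rangle\frac{f(x)-f(\sigma_\alpha x)}{\langle\alpha,x\rangle}$. For $w\in\mathbb C^N$ the Dunkl kernel $E_k(\cdot,w)$ is the unique holomorphic $f$ on $\mathbb C^N$ with $T_\xi(k)f=\langle\xi,w\rangle f$ for all $\xi\in\mathbb C^N$ and $f(0)=1$. Let $w_k(x)=\prod_{\alpha\in R_+}|\langle\alpha,x\rangle|^{2k(\alpha)}$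 and $c_k>0$ with $c_k\int_{\mathbb R^N}e^{-\|y\|^2/2}w_k(y)\,dy=1$. A Dunkl process with drift $\lambda\in\mathbb R^N$ is a time-homogeneous Feller process on $\mathbb R^N$ with RCLL paths and transition kernels $$K_t^{\lambda,k,Dunkl}(x,A)=\frac{c_k\,e^{-\|\lambda\|^2t/2}}{t^{\gamma+N/2}}\int_Ae^{-(\|x\|^2+\|y\|^2)/(2t)}\,\frac{E_k(\frac x{\sqrt t},\frac y{\sqrt t})E_k(y,\lambda)}{E_k(x,\lambda)}\,w_k(y)\,dy\quad(t>0).$$ An $\mathbb R^N$-valued process is a martingale if all its components are. *)

theory Defs
  imports "HOL-Probability.Probability"
begin

section \<open>Root systems\<close>

definition reflection :: "'a::real_inner \<Rightarrow> 'a \<Rightarrow> 'a" where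
  "reflection \<alpha> x = x - (2 * (\<alpha> \<bullet> x) / (\<alpha> \<bullet> \<alpha>)) *\<^sub>R \<alpha>"

text \<open>Neither reducedness nor that the roots span the space is required.\<close>

definition root_system :: "'a::real_inner set \<Rightarrow> bool" where
  "root_system R \<longleftrightarrow> finite R \<and> 0 \<notin> R \<and> (\<forall>\<alpha>\<in>R. reflection \<alpha> ` R = R)"

text \<open>The group generated by the reflections; closure under inverses is automatic, since
  reflections are involutions.\<close>

inductive_set reflection_group :: "'a::real_inner set \<Rightarrow> ('a \<Rightarrow> 'a) set" for R where
  "id \<in> reflection_group R"
| "g \<in> reflection_group R \<Longrightarrow> \<alpha> \<in> R \<Longrightarrow> reflection \<alpha> \<circ> g \<in> reflection_group R"

definition positive_subsystem :: "'a::real_inner set \<Rightarrow> 'a set \<Rightarrow> bool" where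
  "positive_subsystem R Rp \<longleftrightarrow>
     (\<exists>v. (\<forall>\<alpha>\<in>R. \<alpha> \<bullet> v \<noteq> 0) \<and> Rp = {\<alpha>\<in>R. \<alpha> \<bullet> v > 0})"

definition multiplicity_function :: "'a::real_inner set \<Rightarrow> ('a \<Rightarrow> real) \<Rightarrow> bool" where
  "multiplicity_function R k \<longleftrightarrow>
     (\<forall>\<alpha>\<in>R. 0 \<le> k \<alpha>) \<and> (\<forall>g\<in>reflection_group R. \<forall>\<alpha>\<in>R. k (g \<alpha>) = k \<alpha>)"


section \<open>Dunkl operators and the Dunkl kernel\<close>

definition cvec :: "real^'n \<Rightarrow> complex^'n" where
  "cvec x = (\<chi> i. complex_of_real (x $ i))"

text \<open>The bilinear (not sesquilinear) extension of the scalar product.\<close>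

definition cdot :: "complex^'n \<Rightarrow> complex^'n \<Rightarrow> complex" where
  "cdot z w = (\<Sum>i\<in>UNIV. z $ i * w $ i)"

definition creflection :: "real^'n \<Rightarrow> complex^'n \<Rightarrow> complex^'n" where
  "creflection \<alpha> z = z - (2 * cdot (cvec \<alpha>) z / complex_of_real (\<alpha> \<bullet> \<alpha>)) *s cvec \<alpha>"

definition entire :: "(complex^'n \<Rightarrow> complex) \<Rightarrow> bool" where
  "entire f \<longleftrightarrow>
     (\<forall>z. \<exists>f'. (f has_derivative f') (at z) \<and> (\<forall>c v. f' (c *s v) = c * f' v))"

text \<open>For entire \<open>f\<close> the quotient below has removable singularities on the hyperplane
  orthogonal to \<open>\<alpha>\<close>, where it takes the value of its continuous extension.\<close>

definition dunkl_quotient ::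
  "real^'n \<Rightarrow> (complex^'n \<Rightarrow> complex) \<Rightarrow> complex^'n \<Rightarrow> complex" where
  "dunkl_quotient \<alpha> f z =
     (let q = (\<lambda>y. (f y - f (creflection \<alpha> y)) / cdot (cvec \<alpha>) y) in
      if cdot (cvec \<alpha>) z \<noteq> 0 then q z
      else Lim (at z within {y. cdot (cvec \<alpha>) y \<noteq> 0}) q)"

definition dunkl_operator ::
  "(real^'n) set \<Rightarrow> (real^'n \<Rightarrow> real) \<Rightarrow> complex^'n \<Rightarrow>
     (complex^'n \<Rightarrow> complex) \<Rightarrow> complex^'n \<Rightarrow> complex" where
  "dunkl_operator Rp k \<xi> f z =
     deriv (\<lambda>s. f (z + s *s \<xi>)) 0
     + (\<Sum>\<alpha>\<in>Rp. complex_of_real (k \<alpha>) * cdot (cvec \<alpha>) \<xi> * dunkl_quotient \<alpha> f z)"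

text \<open>The function \<open>z \<mapsto> E\<^sub>k(z, w)\<close> is \<open>dunkl_kernel Rp k w\<close>.\<close>

definition dunkl_kernel ::
  "(real^'n) set \<Rightarrow> (real^'n \<Rightarrow> real) \<Rightarrow> complex^'n \<Rightarrow> complex^'n \<Rightarrow> complex" where
  "dunkl_kernel Rp k w =
     (THE f. entire f \<and> (\<forall>\<xi> z. dunkl_operator Rp k \<xi> f z = cdot \<xi> w * f z) \<and> f 0 = 1)"

text \<open>\<open>E\<^sub>k(x, y)\<close> for real \<open>x\<close>, \<open>y\<close>, where it is real.\<close>

definition dunkl_E ::
  "(real^'n) set \<Rightarrow> (real^'n \<Rightarrow> real) \<Rightarrow> real^'n \<Rightarrow> real^'n \<Rightarrow> real" where
  "dunkl_E Rp k x y = Re (dunkl_kernel Rp k (cvec y) (cvec x))"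


section \<open>Dunkl processes with drift\<close>

text \<open>In Isabelle \<open>0 powr 0 = 0\<close>; the case distinction restores the convention \<open>0\<^sup>0 = 1\<close>.\<close>

definition dunkl_weight :: "(real^'n) set \<Rightarrow> (real^'n \<Rightarrow> real) \<Rightarrow> real^'n \<Rightarrow> real" where
  "dunkl_weight Rp k x =
     (\<Prod>\<alpha>\<in>Rp. if k \<alpha> = 0 then 1 else \<bar>\<alpha> \<bullet> x\<bar> powr (2 * k \<alpha>))"

definition dunkl_const :: "(real^'n) set \<Rightarrow> (real^'n \<Rightarrow> real) \<Rightarrow> real" where
  "dunkl_const Rp k =
     1 / (\<integral>y. exp (- (norm y)\<^sup>2 / 2) * dunkl_weight Rp k y \<partial>lborel)"

definition dunkl_density ::
  "(real^'n) set \<Rightarrow> (real^'n \<Rightarrow> real) \<Rightarrow> real^'n \<Rightarrow> real \<Rightarrow> real^'n \<Rightarrow> real^'n \<Rightarrow> real" where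
  "dunkl_density Rp k lam t x y =
     dunkl_const Rp k * exp (- (norm lam)\<^sup>2 * t / 2)
       / t powr ((\<Sum>\<alpha>\<in>Rp. k \<alpha>) + real CARD('n) / 2)
     * (exp (- ((norm x)\<^sup>2 + (norm y)\<^sup>2) / (2 * t))
        * (dunkl_E Rp k (x /\<^sub>R sqrt t) (y /\<^sub>R sqrt t) * dunkl_E Rp k y lam / dunkl_E Rp k x lam)
        * dunkl_weight Rp k y)"

text \<open>Only meaningful for \<open>t > 0\<close>.\<close>

definition dunkl_transition ::
  "(real^'n) set \<Rightarrow> (real^'n \<Rightarrow> real) \<Rightarrow> real^'n \<Rightarrow> real \<Rightarrow> real^'n \<Rightarrow> (real^'n) measure" where
  "dunkl_transition Rp k lam t x = density lborel (\<lambda>y. ennreal (dunkl_density Rp k lam t x y))"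

definition C0_function :: "('a::real_normed_vector \<Rightarrow> real) \<Rightarrow> bool" where
  "C0_function f \<longleftrightarrow> continuous_on UNIV f \<and> (f \<longlongrightarrow> 0) at_infinity"

text \<open>The kernels \<open>\<kappa> t\<close> are used for \<open>t > 0\<close> only; at time \<open>0\<close> the semigroup is the identity.\<close>

definition feller_semigroup :: "(real \<Rightarrow> 'a::euclidean_space \<Rightarrow> 'a measure) \<Rightarrow> bool" where
  "feller_semigroup \<kappa> \<longleftrightarrow>
     (\<forall>t>0. \<kappa> t \<in> borel \<rightarrow>\<^sub>M prob_algebra borel) \<and>
     (\<forall>s>0. \<forall>t>0. \<forall>x. \<kappa> (s + t) x = \<kappa> s x \<bind> \<kappa> t) \<and>
     (\<forall>f. C0_function f \<longrightarrow>
        (\<forall>t>0. C0_function (\<lambda>x. \<integral>y. f y \<partial>\<kappa> t x)) \<and>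
        uniform_limit UNIV (\<lambda>t x. \<integral>y. f y \<partial>\<kappa> t x) f (at_right 0))"

text \<open>Processes are indexed by \<open>real\<close>; only the times \<open>t \<ge> 0\<close> are relevant.\<close>

definition canonical_filtration ::
  "'w measure \<Rightarrow> (real \<Rightarrow> 'w \<Rightarrow> 'a::topological_space) \<Rightarrow> real \<Rightarrow> 'w measure" where
  "canonical_filtration M X t =
     sigma (space M) {X s -` A \<inter> space M | s A. 0 \<le> s \<and> s \<le> t \<and> A \<in> sets borel}"

definition rcll :: "(real \<Rightarrow> 'a::topological_space) \<Rightarrow> bool" where
  "rcll p \<longleftrightarrow>
     (\<forall>t\<ge>0. continuous (at_right t) p) \<and> (\<forall>t>0. \<exists>l. (p \<longlongrightarrow> l) (at_left t))"

definition feller_process ::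
  "(real \<Rightarrow> 'a::euclidean_space \<Rightarrow> 'a measure) \<Rightarrow> 'w measure \<Rightarrow> (real \<Rightarrow> 'w \<Rightarrow> 'a) \<Rightarrow> bool" where
  "feller_process \<kappa> M X \<longleftrightarrow>
     feller_semigroup \<kappa> \<and> prob_space M \<and> (\<forall>t\<ge>0. X t \<in> borel_measurable M) \<and>
     (\<forall>s\<ge>0. \<forall>t>s. \<forall>A\<in>sets borel. AE \<omega> in M.
        real_cond_exp M (canonical_filtration M X s) (\<lambda>\<omega>. indicator A (X t \<omega>)) \<omega>
          = measure (\<kappa> (t - s) (X s \<omega>)) A)"

definition dunkl_process ::
  "(real^'n) set \<Rightarrow> (real^'n \<Rightarrow> real) \<Rightarrow> real^'n \<Rightarrow> 'w measure \<Rightarrow> (real \<Rightarrow> 'w \<Rightarrow> real^'n) \<Rightarrow> bool" where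
  "dunkl_process Rp k lam M X \<longleftrightarrow>
     feller_process (dunkl_transition Rp k lam) M X \<and> (\<forall>\<omega>\<in>space M. rcll (\<lambda>t. X t \<omega>))"


section \<open>Martingales\<close>

definition real_martingale ::
  "'w measure \<Rightarrow> (real \<Rightarrow> 'w measure) \<Rightarrow> (real \<Rightarrow> 'w \<Rightarrow> real) \<Rightarrow> bool" where
  "real_martingale M F Y \<longleftrightarrow>
     (\<forall>t\<ge>0. subalgebra M (F t)) \<and> (\<forall>s\<ge>0. \<forall>t\<ge>s. sets (F s) \<subseteq> sets (F t)) \<and>
     (\<forall>t\<ge>0. Y t \<in> borel_measurable (F t) \<and> integrable M (Y t)) \<and>
     (\<forall>s\<ge>0. \<forall>t\<ge>s. AE \<omega> in M. real_cond_exp M (F s) (Y t) \<omega> = Y s \<omega>)"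

definition vector_martingale ::
  "'w measure \<Rightarrow> (real \<Rightarrow> 'w measure) \<Rightarrow> (real \<Rightarrow> 'w \<Rightarrow> real^'n) \<Rightarrow> bool" where
  "vector_martingale M F Y \<longleftrightarrow> (\<forall>i. real_martingale M F (\<lambda>t \<omega>. Y t \<omega> $ i))"

end

theory Submission
  imports Defs "HOL-Complex_Analysis.Cauchy_Integral_Formula"
begin

text \<open>The total mass of the transition kernel being one says
  \<open>\<integral> E\<^sub>k(x/\<surd>t, y/\<surd>t) H(y) dy = C exp(\<parallel>x\<parallel>\<^sup>2/2t) E\<^sub>k(x, \<lambda>)\<close>, where \<open>H\<close> does not depend on
  \<open>x\<close>. Applying \<open>T\<^sub>\<xi>\<close> in \<open>x\<close> to both sides produces a factor \<open>\<langle>y, \<xi>\<rangle>/t\<close> under the integral and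
  \<open>\<langle>x, \<xi>\<rangle>/t + \<langle>\<lambda>, \<xi>\<rangle>\<close> on the right, so that the kernel has mean \<open>x + t\<lambda>\<close>. Applying \<open>T\<^sub>\<xi>\<close> twice gives the
  second moments, in which only the ratios \<open>E\<^sub>k(\<sigma>\<^sub>\<alpha> x, \<lambda>)/E\<^sub>k(x, \<lambda>)\<close> have to be bounded; this makes
  the first absolute moment grow at most linearly in \<open>x\<close>, and the martingale property follows from the
  Markov property.

  The Dunkl kernel is constructed as \<open>\<Sum>\<^sub>n f\<^sub>n\<close> with homogeneous polynomials \<open>f\<^sub>n\<close> satisfying
  \<open>(n + \<gamma> - S) f\<^sub>n = \<langle>\<cdot>, w\<rangle> f\<^sub>n\<^sub>-\<^sub>1\<close>, \<open>S f = \<Sum>\<^sub>\<alpha> k(\<alpha>) f \<circ> \<sigma>\<^sub>\<alpha>\<close>, which is the Dunkl equation in the radial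
  direction. As \<open>S\<close> is positive with \<open>S 1 = \<gamma>\<close>, a maximum principle on \<open>W\<close>-orbits yields the
  remaining Dunkl equations, uniqueness, positivity, and the bound on the ratios.\<close>

section \<open>Complex vectors and reflections\<close>

text \<open>The normalising integral of \<open>dunkl_const\<close> is never evaluated: the Feller
  hypothesis already contains that every kernel is a probability measure, and this fixes the
  constant and the Gaussian identity together. The mean of a kernel says nothing about how its
  absolute moment grows with the starting point, so integrability of later X_t has to come from
  second moments. In the first moment no reflected value survives, because the Gaussian factor is
  W-invariant and E_k is an eigenfunction. In the second one T_\<xi> also hits the linear factor <x
  + t\<lambda>, \<xi>>, and its difference part leaves values at \<sigma>_\<alpha> x; hence the
  ratios. Bounding them meets a sign problem, since the factor <y, x> in the recursion of the
  components may be negative. Multiplication by exp(|x||y|), a constant on the orbit of x, turns it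
  into a factor between 0 and 2|x||y|; then each component is nonnegative and controlled by the
  previous one. For n \<ge> 1 the operator n + \<gamma> - S is invertible because S has norm at most
  \<gamma> for the maximum norm on an orbit.\<close>

lemma cdot_commute: "cdot z w = cdot w z"
  by (simp add: cdot_def mult.commute)

lemma cdot_add_right: "cdot z (v + w) = cdot z v + cdot z w"
  by (simp add: cdot_def distrib_left sum.distrib)

lemma cdot_add_left: "cdot (v + w) z = cdot v z + cdot w z"
  by (simp add: cdot_def distrib_right sum.distrib)

lemma cdot_diff_right: "cdot z (v - w) = cdot z v - cdot z w"
  by (simp add: cdot_def right_diff_distrib sum_subtractf)

lemma cdot_diff_left: "cdot (v - w) z = cdot v z - cdot w z"
  by (simp add: cdot_def left_diff_distrib sum_subtractf)

lemma cdot_scale_right: "cdot z (c *s w) = c * cdot z w"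
  by (simp add: cdot_def sum_distrib_left mult_ac)

lemma cdot_scale_left: "cdot (c *s z) w = c * cdot z w"
  by (simp add: cdot_def sum_distrib_left mult_ac)

lemma cdot_zero_right [simp]: "cdot z 0 = 0"
  by (simp add: cdot_def)

lemma cdot_zero_left [simp]: "cdot 0 z = 0"
  by (simp add: cdot_def)

lemmas cdot_linear =
  cdot_add_left cdot_add_right cdot_diff_left cdot_diff_right cdot_scale_left cdot_scale_right

lemma cdot_cvec: "cdot (cvec x) (cvec y) = complex_of_real (x \<bullet> y)"
  by (simp add: cdot_def cvec_def inner_vec_def)

lemma cdot_axis [simp]: "cdot (axis i 1) z = z $ i" "cdot z (axis i 1) = z $ i"
  by (simp_all add: cdot_def axis_def if_distrib[of "\<lambda>x. x * _"] if_distrib[of "\<lambda>x. _ * x"] cong: if_cong)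

lemma norm_cdot_le: "norm (cdot z w) \<le> norm z * norm w"
proof -
  have "norm (cdot z w) \<le> (\<Sum>i\<in>UNIV. norm (z $ i) * norm (w $ i))"
    unfolding cdot_def by (rule order_trans[OF norm_sum]) (simp add: norm_mult)
  also have "\<dots> \<le> norm z * norm w"
    using L2_set_mult_ineq[of "\<lambda>i. norm (z $ i)" "\<lambda>i. norm (w $ i)" UNIV] by (simp add: norm_vec_def)
  finally show ?thesis .
qed

lemma cvec_add: "cvec (x + y) = cvec x + cvec y"
  by (simp add: cvec_def vec_eq_iff)

lemma cvec_scale: "cvec (c *\<^sub>R x) = complex_of_real c *s cvec x"
  by (simp add: cvec_def vec_eq_iff)

lemma cvec_minus: "cvec (- x) = - cvec x"
  by (simp add: cvec_def vec_eq_iff)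

lemma cvec_zero [simp]: "cvec 0 = 0"
  by (simp add: cvec_def vec_eq_iff)

lemma norm_cvec [simp]: "norm (cvec x) = norm x"
  by (simp add: cvec_def norm_vec_def)

lemma scaleR_complex_vec: "r *\<^sub>R z = complex_of_real r *s z" for z :: "complex^'n"
  unfolding vec_eq_iff vector_scaleR_component vector_smult_component by (simp add: scaleR_conv_of_real)

lemma norm_scale: "norm (c *s (z::complex^'n)) = norm c * norm z"
  by (simp add: norm_vec_def norm_mult L2_set_right_distrib)

lemma bounded_linear_cdot: "bounded_linear (cdot z)"
proof (rule bounded_linear_intro)
  show "cdot z (r *\<^sub>R x) = r *\<^sub>R cdot z x" for r x
    by (simp add: cdot_def scaleR_sum_right)
  show "norm (cdot z x) \<le> norm x * norm z" for x
    using norm_cdot_le[of z x] by (simp add: mult.commute)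
qed (simp add: cdot_add_right)

lemma continuous_on_cdot [continuous_intros]:
  "continuous_on A f \<Longrightarrow> continuous_on A (\<lambda>x. cdot z (f x))"
  by (rule bounded_linear.continuous_on[OF bounded_linear_cdot])

lemma creflection_nth:
  "creflection \<alpha> z $ i = z $ i - 2 / complex_of_real (\<alpha> \<bullet> \<alpha>) * cdot (cvec \<alpha>) z * complex_of_real (\<alpha> $ i)"
  by (simp add: creflection_def cvec_def)

lemma creflection_add: "creflection \<alpha> (z + w) = creflection \<alpha> z + creflection \<alpha> w"
  by (simp add: vec_eq_iff creflection_nth cdot_add_right algebra_simps)

lemma creflection_diff: "creflection \<alpha> (z - w) = creflection \<alpha> z - creflection \<alpha> w"
  by (simp add: vec_eq_iff creflection_nth cdot_diff_right algebra_simps)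

lemma creflection_scale: "creflection \<alpha> (c *s z) = c *s creflection \<alpha> z"
  by (simp add: vec_eq_iff creflection_nth cdot_scale_right algebra_simps)

lemma creflection_uminus_root: "creflection (- \<alpha>) z = creflection \<alpha> z"
  by (simp add: vec_eq_iff creflection_nth cvec_minus cdot_def sum_negf)

lemma creflection_cvec: "creflection \<alpha> (cvec x) = cvec (reflection \<alpha> x)"
  by (simp add: vec_eq_iff creflection_nth reflection_def cdot_cvec) (simp add: cvec_def)

lemma creflection_alt:
  "creflection \<alpha> z = z - (2 / complex_of_real (\<alpha> \<bullet> \<alpha>) * cdot (cvec \<alpha>) z) *s cvec \<alpha>"
  by (simp add: creflection_def)

lemma cdot_creflection: "cdot (creflection \<alpha> z) w = cdot z (creflection \<alpha> w)"
  by (simp add: creflection_alt cdot_linear cdot_commute[of z "cvec \<alpha>"])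

lemma cdot_root_creflection:
  assumes "\<alpha> \<noteq> 0"
  shows "cdot (cvec \<alpha>) (creflection \<alpha> z) = - cdot (cvec \<alpha>) z"
  using assms by (simp add: creflection_alt cdot_linear cdot_cvec)

lemma creflection_involution:
  assumes "\<alpha> \<noteq> 0"
  shows "creflection \<alpha> (creflection \<alpha> z) = z"
  by (simp add: vec_eq_iff creflection_nth cdot_root_creflection[OF assms])

lemma cdot_creflection_both:
  assumes "\<alpha> \<noteq> 0"
  shows "cdot (creflection \<alpha> z) (creflection \<alpha> w) = cdot z w"
  by (simp add: cdot_creflection creflection_involution assms)

lemma creflection_fixed: "cdot (cvec \<alpha>) z = 0 \<Longrightarrow> creflection \<alpha> z = z"
  by (simp add: vec_eq_iff creflection_nth)

lemma norm_reflection: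
  fixes \<alpha> x :: "real^'n"
  assumes "\<alpha> \<noteq> 0"
  shows "norm (reflection \<alpha> x) = norm x"
  using cdot_creflection_both[OF assms, of "cvec x" "cvec x"]
  unfolding creflection_cvec cdot_cvec norm_eq_sqrt_inner by simp

text \<open>The norm is Hermitian while reflections preserve only the bilinear form. As the root is
  real, the reflection commutes with complex conjugation, and the squared norm of z is the bilinear
  product of z with its conjugate.\<close>

lemma norm_creflection:
  assumes "\<alpha> \<noteq> 0"
  shows "norm (creflection \<alpha> z) = norm z"
proof -
  define cj :: "complex^'a \<Rightarrow> complex^'a" where "cj = (\<lambda>z. \<chi> i. cnj (z $ i))"
  have n: "complex_of_real ((norm z)\<^sup>2) = cdot z (cj z)" for z
    by (simp add: norm_vec_def L2_set_def cdot_def cj_def complex_norm_square[symmetric] sum_nonneg)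
  have cd: "cdot (cvec \<alpha>) (cj z) = cnj (cdot (cvec \<alpha>) z)"
    by (simp add: cdot_def cj_def cvec_def)
  have c: "cj (creflection \<alpha> z) = creflection \<alpha> (cj z)"
    by (simp add: vec_eq_iff creflection_nth cd) (simp add: cj_def creflection_nth)
  have "complex_of_real ((norm (creflection \<alpha> z))\<^sup>2) = complex_of_real ((norm z)\<^sup>2)"
    unfolding n c by (rule cdot_creflection_both[OF assms])
  then have "(norm (creflection \<alpha> z))\<^sup>2 = (norm z)\<^sup>2"
    by (simp only: of_real_eq_iff)
  then show ?thesis by simp
qed

text \<open>The conjugation rule in the group; it is what makes difference quotients equivariant
  under reflections.\<close>

lemma creflection_conj:
  assumes "\<beta> \<noteq> 0"
  shows "creflection \<beta> (creflection \<alpha> z) = creflection (reflection \<beta> \<alpha>) (creflection \<beta> z)"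
proof -
  have 1: "reflection \<beta> \<alpha> \<bullet> reflection \<beta> \<alpha> = \<alpha> \<bullet> \<alpha>"
    using norm_reflection[OF assms, of \<alpha>] by (simp add: dot_square_norm)
  have 2: "cdot (cvec (reflection \<beta> \<alpha>)) (creflection \<beta> z) = cdot (cvec \<alpha>) z"
    by (simp add: creflection_cvec[symmetric] cdot_creflection_both[OF assms])
  show ?thesis
    unfolding creflection_alt[of \<alpha> z] creflection_alt[of "reflection \<beta> \<alpha>" "creflection \<beta> z"] 1 2
    by (simp add: creflection_diff creflection_scale creflection_cvec)
qed


section \<open>Directional derivatives\<close>

definition dirderiv :: "complex^'n \<Rightarrow> (complex^'n \<Rightarrow> complex) \<Rightarrow> complex^'n \<Rightarrow> complex" where
  "dirderiv v f z = deriv (\<lambda>s. f (z + s *s v)) 0"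

lemma has_derivative_line: "((\<lambda>s. z + s *s v) has_derivative (\<lambda>s. s *s v)) (at s)"
  for z v :: "complex^'n"
proof -
  have "bounded_linear (\<lambda>s. s *s v)"
  proof (rule bounded_linear_intro)
    show "(r *\<^sub>R s) *s v = r *\<^sub>R (s *s v)" for r s
      unfolding scaleR_complex_vec by (simp add: scaleR_conv_of_real)
    show "norm (s *s v) \<le> norm s * norm v" for s
      by (simp add: norm_scale)
  qed (simp add: vec_eq_iff algebra_simps)
  from bounded_linear.has_derivative[OF this has_derivative_ident] show ?thesis
    by (auto intro!: derivative_eq_intros)
qed

lemma has_field_derivative_along:
  fixes f :: "complex^'n \<Rightarrow> complex"
  assumes "(f has_derivative D) (at (z + s *s v))" and "\<And>c v. D (c *s v) = c * D v"
  shows "((\<lambda>s. f (z + s *s v)) has_field_derivative D v) (at s)"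
proof -
  have "((\<lambda>s. f (z + s *s v)) has_derivative (\<lambda>s. D (s *s v))) (at s)"
    using diff_chain_at[OF has_derivative_line[of z v s] assms(1)] by (simp add: o_def)
  then show ?thesis
    by (simp add: has_field_derivative_def assms(2) mult.commute[of _ "D v"])
qed

lemma dirderiv_eq:
  fixes f :: "complex^'n \<Rightarrow> complex"
  assumes "(f has_derivative D) (at z)" and "\<And>c v. D (c *s v) = c * D v"
  shows "dirderiv v f z = D v"
  unfolding dirderiv_def
  using has_field_derivative_along[of f D z 0 v] assms by (auto intro!: DERIV_imp_deriv)

lemma entireI:
  assumes "\<And>z. (f has_derivative D z) (at z)" and "\<And>z c v. D z (c *s v) = c * D z v"
  shows "entire f"
  using assms unfolding entire_def by blast

lemma entire_has_derivative:
  assumes "entire f"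
  shows "(f has_derivative (\<lambda>v. dirderiv v f z)) (at z)"
proof -
  obtain D where D: "(f has_derivative D) (at z)" "\<And>c v. D (c *s v) = c * D v"
    using assms unfolding entire_def by metis
  have "(\<lambda>v. dirderiv v f z) = D"
    by (rule ext) (rule dirderiv_eq[OF D])
  with D show ?thesis by simp
qed

lemma dirderiv_scale:
  assumes "entire f"
  shows "dirderiv (c *s v) f z = c * dirderiv v f z"
proof -
  obtain D where D: "(f has_derivative D) (at z)" "\<And>c v. D (c *s v) = c * D v"
    using assms unfolding entire_def by metis
  show ?thesis using dirderiv_eq[OF D] D by simp
qed

lemma dirderiv_vadd:
  assumes "entire f"
  shows "dirderiv (v + w) f z = dirderiv v f z + dirderiv w f z"
  using has_derivative_bounded_linear[OF entire_has_derivative[OF assms]]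
  by (rule linear_add[OF bounded_linear.linear])

lemma entire_along:
  assumes "entire f"
  shows "((\<lambda>s. f (z + s *s v)) has_field_derivative dirderiv v f (z + s *s v)) (at s)"
  by (rule has_field_derivative_along[OF entire_has_derivative[OF assms]])
    (rule dirderiv_scale[OF assms])

lemma entire_along_holomorphic:
  assumes "entire f"
  shows "(\<lambda>s. f (z + s *s v)) holomorphic_on A"
  using entire_along[OF assms] unfolding holomorphic_on_def
  by (meson field_differentiable_def field_differentiable_at_within)

lemma entire_continuous:
  assumes "entire f"
  shows "continuous_on A f"
  by (intro continuous_at_imp_continuous_on ballI has_derivative_continuous[OF entire_has_derivative[OF assms]])

lemma entire_const: "entire (\<lambda>z. c)"
  by (rule entireI[of _ "\<lambda>z v. 0"]) auto

lemma dirderiv_const: "dirderiv v (\<lambda>z. c) z = 0"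
  by (simp add: dirderiv_def)

lemma entire_add:
  assumes "entire f" "entire g"
  shows "entire (\<lambda>z. f z + g z)"
  by (rule entireI[of _ "\<lambda>z v. dirderiv v f z + dirderiv v g z"])
    (rule derivative_eq_intros entire_has_derivative assms refl |
      simp add: dirderiv_scale assms algebra_simps)+

lemma dirderiv_add:
  assumes "entire f" "entire g"
  shows "dirderiv v (\<lambda>z. f z + g z) z = dirderiv v f z + dirderiv v g z"
  by (rule dirderiv_eq)
    (rule derivative_eq_intros entire_has_derivative assms refl |
      simp add: dirderiv_scale assms algebra_simps)+

lemma entire_mult:
  assumes "entire f" "entire g"
  shows "entire (\<lambda>z. f z * g z)"
  by (rule entireI[of _ "\<lambda>z v. f z * dirderiv v g z + dirderiv v f z * g z"])
    (rule derivative_eq_intros entire_has_derivative assms refl |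
      simp add: dirderiv_scale assms algebra_simps)+

lemma dirderiv_mult:
  assumes "entire f" "entire g"
  shows "dirderiv v (\<lambda>z. f z * g z) z = f z * dirderiv v g z + dirderiv v f z * g z"
  by (rule dirderiv_eq)
    (rule derivative_eq_intros entire_has_derivative assms refl |
      simp add: dirderiv_scale assms algebra_simps)+

lemma entire_cdot: "entire (cdot w)"
  by (rule entireI[of _ "\<lambda>z. cdot w"])
    (auto simp: cdot_scale_right intro: bounded_linear.has_derivative[OF bounded_linear_cdot] has_derivative_ident)

lemma dirderiv_cdot: "dirderiv v (cdot w) z = cdot w v"
  by (rule dirderiv_eq)
    (auto simp: cdot_scale_right intro: bounded_linear.has_derivative[OF bounded_linear_cdot] has_derivative_ident)

lemma bounded_linear_creflection: "bounded_linear (creflection \<alpha>)"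
proof (rule bounded_linear_intro)
  show "creflection \<alpha> (r *\<^sub>R x) = r *\<^sub>R creflection \<alpha> x" for r x
    by (simp add: scaleR_complex_vec creflection_scale)
  show "norm (creflection \<alpha> x) \<le> norm x * 1" for x
    by (cases "\<alpha> = 0") (simp_all add: norm_creflection creflection_uminus_root creflection_fixed)
qed (rule creflection_add)

lemma entire_creflection:
  assumes "entire f"
  shows "entire (\<lambda>z. f (creflection \<alpha> z))"
proof (rule entireI)
  show "((\<lambda>z. f (creflection \<alpha> z)) has_derivative (\<lambda>v. dirderiv (creflection \<alpha> v) f (creflection \<alpha> z))) (at z)" for z
    using diff_chain_at[OF bounded_linear.has_derivative[OF bounded_linear_creflection has_derivative_ident]
        entire_has_derivative[OF assms]] by (simp add: o_def)
qed (simp add: creflection_scale dirderiv_scale[OF assms])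

lemma dirderiv_creflection:
  "dirderiv v (\<lambda>z. f (creflection \<alpha> z)) z = dirderiv (creflection \<alpha> v) f (creflection \<alpha> z)"
  by (simp add: dirderiv_def creflection_add creflection_scale)


section \<open>Homogeneous polynomials\<close>

text \<open>Building polynomials by one coordinate at a time reduces Euler's identity, divisibility
  by a root form and commutativity of Dunkl operators to a product rule with a single linear form.
  The zero function has every degree, so each degree gives a vector space.\<close>

inductive hpoly :: "nat \<Rightarrow> (complex^'n \<Rightarrow> complex) \<Rightarrow> bool" where
  const: "hpoly 0 (\<lambda>z. c)"
| add: "hpoly n p \<Longrightarrow> hpoly n q \<Longrightarrow> hpoly n (\<lambda>z. p z + q z)"
| coord: "hpoly n p \<Longrightarrow> hpoly (Suc n) (\<lambda>z. z $ i * p z)"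

lemma hpoly_scale: "hpoly n p \<Longrightarrow> hpoly n (\<lambda>z. c * p z)"
proof (induction rule: hpoly.induct)
  case (coord n p i)
  then show ?case using hpoly.coord[of n "\<lambda>z. c * p z" i] by (simp add: mult.left_commute)
qed (auto simp: distrib_left intro: hpoly.const hpoly.add)

lemma hpoly_zero: "hpoly n (\<lambda>z. 0)"
proof (induction n)
  case (Suc n)
  then show ?case using hpoly.coord[OF Suc] by simp
qed (rule hpoly.const)

lemma hpoly_sum:
  "(\<And>i. i \<in> A \<Longrightarrow> hpoly n (p i)) \<Longrightarrow> hpoly n (\<lambda>z. \<Sum>i\<in>A. p i z)"
  by (induction A rule: infinite_finite_induct) (auto intro: hpoly_zero hpoly.add)

lemma hpoly_cdot: "hpoly n p \<Longrightarrow> hpoly (Suc n) (\<lambda>z. cdot w z * p z)"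
  unfolding cdot_def sum_distrib_right mult.assoc
  by (intro hpoly_sum hpoly_scale hpoly.coord)

lemma hpoly_comp:
  assumes "hpoly n p" and g: "\<And>i z. g z $ i = cdot (v i) z"
  shows "hpoly n (\<lambda>z. p (g z))"
  using assms(1)
  by (induction rule: hpoly.induct) (auto simp: g intro: hpoly.const hpoly.add hpoly_cdot)

lemma hpoly_creflection: "hpoly n p \<Longrightarrow> hpoly n (\<lambda>z. p (creflection \<alpha> z))"
  by (rule hpoly_comp[where v = "\<lambda>i. creflection \<alpha> (axis i 1)"])
    (simp_all add: cdot_creflection)

lemma hpoly_homogeneous: "hpoly n p \<Longrightarrow> p (c *s z) = c ^ n * p z"
  by (induction rule: hpoly.induct) (auto simp: algebra_simps)

lemma hpoly_0_const: "hpoly 0 p \<Longrightarrow> p = (\<lambda>z. p 0)"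
  using hpoly_homogeneous[of 0 p 0] by (intro ext) (metis mult_1 power_0 vector_smult_lzero)

lemma entire_coord: "entire (\<lambda>z. z $ i)"
  using entire_cdot[of "axis i 1"] by (simp add: cdot_axis[abs_def])

lemma hpoly_entire: "hpoly n p \<Longrightarrow> entire p"
  by (induction rule: hpoly.induct) (auto intro: entire_const entire_add entire_mult entire_coord)

lemma dirderiv_coord: "dirderiv v (\<lambda>z. z $ i) z = v $ i"
  using dirderiv_cdot[of v "axis i 1"] by (simp add: cdot_axis[abs_def])

lemma hpoly_cong: "(\<And>z. p z = q z) \<Longrightarrow> hpoly n p = hpoly n q"
  by (rule arg_cong[of p q]) (rule ext)

lemma hpoly_dirderiv: "hpoly n p \<Longrightarrow> hpoly (n - 1) (dirderiv v p)"
proof (induction rule: hpoly.induct)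
  case (const c)
  then show ?case by (simp add: dirderiv_const[abs_def] hpoly.const)
next
  case (add n p q)
  then show ?case
    using hpoly.add[OF add.IH] by (subst hpoly_cong[OF dirderiv_add]) (auto intro: hpoly_entire)
next
  case (coord n p i)
  have eq: "dirderiv v (\<lambda>z. z $ i * p z) = (\<lambda>z. z $ i * dirderiv v p z + v $ i * p z)"
    using coord by (auto simp: dirderiv_mult entire_coord hpoly_entire dirderiv_coord)
  \<comment> \<open>For \<open>n = 0\<close> the truncated degree \<open>n - 1\<close> is not one
    less, so multiplying by a coordinate would give degree 1; but then \<open>p\<close> is constant
    and its derivative vanishes.\<close>
  have "hpoly n (\<lambda>z. z $ i * dirderiv v p z)"
  proof (cases n)
    case 0
    then have "dirderiv v p = (\<lambda>z. 0)"
      using hpoly_0_const[of p] coord dirderiv_const[of v "p 0"] by metis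
    then show ?thesis by (simp add: hpoly_zero)
  next
    case (Suc m)
    then show ?thesis using hpoly.coord[OF coord.IH, of i] by simp
  qed
  then show ?case unfolding eq using coord by (auto intro: hpoly.add hpoly_scale)
qed

lemma dirderiv_euler: "hpoly n p \<Longrightarrow> dirderiv z p z = of_nat n * p z"
  by (induction rule: hpoly.induct)
    (auto simp: dirderiv_const dirderiv_add hpoly_entire dirderiv_mult entire_coord dirderiv_coord algebra_simps)

text \<open>A twisted product rule: the difference for z_i p(z) is z_i times the difference for p,
  plus z_i minus its reflected value times the reflected p. Both summands are divisible by the root
  form.\<close>

lemma hpoly_reflection_quotient:
  assumes "\<alpha> \<noteq> 0" "hpoly n p"
  shows "\<exists>q. hpoly (n - 1) q \<and> (\<forall>z. p z - p (creflection \<alpha> z) = cdot (cvec \<alpha>) z * q z)"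
  using assms(2)
proof (induction rule: hpoly.induct)
  case (const c)
  show ?case by (rule exI[of _ "\<lambda>z. 0"]) (simp add: hpoly_zero)
next
  case (add n p q)
  then obtain p' q' where "hpoly (n - 1) p'" "\<forall>z. p z - p (creflection \<alpha> z) = cdot (cvec \<alpha>) z * p' z"
    "hpoly (n - 1) q'" "\<forall>z. q z - q (creflection \<alpha> z) = cdot (cvec \<alpha>) z * q' z" by blast
  then show ?case
    by (intro exI[of _ "\<lambda>z. p' z + q' z"]) (simp add: distrib_left add_diff_add hpoly.add)
next
  case (coord n p i)
  \<comment> \<open>In degree 0 the quotient has to be exactly zero: degree 0 from the induction
    hypothesis would become 1 after multiplication by the coordinate, whereas degree
    \<open>n\<close> is required below.\<close>
  obtain q where q: "n > 0 \<Longrightarrow> hpoly (n - 1) q" "n = 0 \<Longrightarrow> q = (\<lambda>z. 0)"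
    "\<forall>z. p z - p (creflection \<alpha> z) = cdot (cvec \<alpha>) z * q z"
  proof (cases n)
    case 0
    then have "p z = p (creflection \<alpha> z)" for z
      using hpoly_0_const coord.hyps by metis
    then show ?thesis using that[of "\<lambda>z. 0"] 0 by simp
  next
    case (Suc m)
    then show ?thesis using that coord.IH by auto
  qed
  have 1: "hpoly n (\<lambda>z. z $ i * q z)"
    using q(1,2) hpoly.coord[of "n - 1" q i] hpoly_zero[of 0] by (cases n) auto
  have 2: "hpoly n (\<lambda>z. 2 / complex_of_real (\<alpha> \<bullet> \<alpha>) * complex_of_real (\<alpha> $ i) * p (creflection \<alpha> z))"
    using coord by (intro hpoly_scale hpoly_creflection)
  have eq: "z $ i * p z - creflection \<alpha> z $ i * p (creflection \<alpha> z) =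
    cdot (cvec \<alpha>) z * (z $ i * q z + 2 / complex_of_real (\<alpha> \<bullet> \<alpha>) * complex_of_real (\<alpha> $ i) * p (creflection \<alpha> z))" for z
  proof -
    have "z $ i * p z = z $ i * p (creflection \<alpha> z) + z $ i * (cdot (cvec \<alpha>) z * q z)"
      using q(3)[rule_format, of z] by (metis add.commute diff_add_cancel distrib_left)
    then show ?thesis unfolding creflection_nth by (simp add: algebra_simps)
  qed
  show ?case using hpoly.add[OF 1 2] eq by auto
qed

section \<open>Dunkl operators\<close>

text \<open>Every entire function is in fact regular, but only polynomials and the Dunkl kernel are
  needed, for which the quotient can be exhibited directly.\<close>

definition regular :: "(complex^'n \<Rightarrow> complex) \<Rightarrow> bool" where
  "regular f \<longleftrightarrow> entire f \<and> (\<forall>\<alpha>. \<alpha> \<noteq> 0 \<longrightarrow> (\<exists>q. continuous_on UNIV q \<and>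
     (\<forall>z. f z - f (creflection \<alpha> z) = cdot (cvec \<alpha>) z * q z)))"

text \<open>The \<open>Lim\<close> in \<open>dunkl_quotient\<close> has a determined value only if
  the filter is nontrivial; at a point of the hyperplane, moving along the root leaves it.\<close>

lemma hyperplane_complement_islimpt:
  fixes \<alpha> :: "real^'n"
  assumes \<alpha>: "\<alpha> \<noteq> 0"
  shows "z islimpt {y. cdot (cvec \<alpha>) y \<noteq> 0}" (is "z islimpt ?S")
proof (cases "cdot (cvec \<alpha>) z = 0")
  case True
  show ?thesis
    unfolding islimpt_approachable
  proof (intro allI impI)
    fix e :: real assume "e > 0"
    define y where "y = z + complex_of_real (e / (2 * norm \<alpha>)) *s cvec \<alpha>"
    have "cdot (cvec \<alpha>) y = complex_of_real (e / (2 * norm \<alpha>) * (\<alpha> \<bullet> \<alpha>))"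
      by (simp add: y_def cdot_linear True cdot_cvec)
    then have "y \<in> ?S" using \<open>e > 0\<close> \<alpha> by (simp add: y_def)
    moreover have "dist y z < e"
      using \<open>e > 0\<close> \<alpha> by (simp add: y_def dist_norm norm_scale norm_divide)
    moreover have "y \<noteq> z" using \<open>y \<in> ?S\<close> True by auto
    ultimately show "\<exists>x'\<in>?S. x' \<noteq> z \<and> dist x' z < e" by blast
  qed
next
  case False
  have "open ?S"
    by (intro open_Collect_neq continuous_on_cdot continuous_on_id continuous_on_const)
  then show ?thesis using False by (intro interior_limit_point) (auto simp: interior_open)
qed

text \<open>The way every quotient below is computed: a continuous factor in the product identity
  agrees with the quotient off the hyperplane, hence also with its limit there.\<close>

lemma dunkl_quotient_eqI:
  fixes \<alpha> :: "real^'n"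
  assumes \<alpha>: "\<alpha> \<noteq> 0" and q: "continuous_on UNIV q"
    and eq: "\<And>z. f z - f (creflection \<alpha> z) = cdot (cvec \<alpha>) z * q z"
  shows "dunkl_quotient \<alpha> f z = q z"
proof (cases "cdot (cvec \<alpha>) z = 0")
  case False
  then show ?thesis by (simp add: dunkl_quotient_def eq)
next
  case True
  let ?S = "{y. cdot (cvec \<alpha>) y \<noteq> 0}"
  have nt: "\<not> trivial_limit (at z within ?S)"
    using hyperplane_complement_islimpt[OF \<alpha>]
    by (simp add: trivial_limit_within)
  have "(q \<longlongrightarrow> q z) (at z within ?S)"
    using q by (meson UNIV_I continuous_on tendsto_within_subset top_greatest)
  then have "((\<lambda>y. (f y - f (creflection \<alpha> y)) / cdot (cvec \<alpha>) y) \<longlongrightarrow> q z) (at z within ?S)"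
    by (rule Lim_transform_eventually)
      (auto simp: eventually_at_filter eq)
  then show ?thesis
    using True tendsto_Lim[OF nt] by (simp add: dunkl_quotient_def)
qed

lemma regularI:
  assumes "entire f" "\<And>\<alpha>. \<alpha> \<noteq> 0 \<Longrightarrow> continuous_on UNIV (q \<alpha>)"
    and "\<And>\<alpha> z. \<alpha> \<noteq> 0 \<Longrightarrow> f z - f (creflection \<alpha> z) = cdot (cvec \<alpha>) z * q \<alpha> z"
  shows "regular f"
  using assms unfolding regular_def by blast

lemma regular_entire: "regular f \<Longrightarrow> entire f"
  by (simp add: regular_def)

lemma regular_quotient:
  assumes "regular f" "\<alpha> \<noteq> 0"
  shows "continuous_on UNIV (dunkl_quotient \<alpha> f)"
    and "f z - f (creflection \<alpha> z) = cdot (cvec \<alpha>) z * dunkl_quotient \<alpha> f z"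
proof -
  obtain q where q: "continuous_on UNIV q"
    "\<And>z. f z - f (creflection \<alpha> z) = cdot (cvec \<alpha>) z * q z"
    using assms unfolding regular_def by blast
  have "dunkl_quotient \<alpha> f = q"
    by (rule ext) (rule dunkl_quotient_eqI[OF assms(2) q])
  then show "continuous_on UNIV (dunkl_quotient \<alpha> f)"
    and "f z - f (creflection \<alpha> z) = cdot (cvec \<alpha>) z * dunkl_quotient \<alpha> f z"
    using q by auto
qed

lemma hpoly_dunkl_quotient:
  assumes "hpoly n p" "\<alpha> \<noteq> 0"
  shows "hpoly (n - 1) (dunkl_quotient \<alpha> p)"
proof -
  obtain q where q: "hpoly (n - 1) q" "\<And>z. p z - p (creflection \<alpha> z) = cdot (cvec \<alpha>) z * q z"
    using hpoly_reflection_quotient[OF assms(2,1)] by blast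
  have "dunkl_quotient \<alpha> p = q"
    by (rule ext, rule dunkl_quotient_eqI[OF assms(2) _ q(2)])
      (rule entire_continuous[OF hpoly_entire[OF q(1)]])
  with q show ?thesis by simp
qed

lemma hpoly_regular: "hpoly n p \<Longrightarrow> regular p"
  unfolding regular_def
  using hpoly_reflection_quotient entire_continuous hpoly_entire by metis

lemma regular_add_aux:
  assumes "regular f" "regular g" "\<alpha> \<noteq> 0"
  shows "f z + g z - (f (creflection \<alpha> z) + g (creflection \<alpha> z)) =
    cdot (cvec \<alpha>) z * (dunkl_quotient \<alpha> f z + dunkl_quotient \<alpha> g z)"
  unfolding distrib_left regular_quotient(2)[OF assms(1,3), symmetric]
    regular_quotient(2)[OF assms(2,3), symmetric] by simp

lemma regular_add:
  assumes "regular f" "regular g"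
  shows "regular (\<lambda>z. f z + g z)"
  by (rule regularI[OF _ _ regular_add_aux[OF assms]])
    (auto intro: entire_add regular_entire assms continuous_on_add regular_quotient(1))

lemma dunkl_quotient_add:
  assumes "regular f" "regular g" "\<alpha> \<noteq> 0"
  shows "dunkl_quotient \<alpha> (\<lambda>z. f z + g z) z = dunkl_quotient \<alpha> f z + dunkl_quotient \<alpha> g z"
  by (rule dunkl_quotient_eqI[OF assms(3) _ regular_add_aux[OF assms]])
    (intro continuous_on_add regular_quotient(1) assms)

text \<open>Product rule for the difference part. The last term comes from the linear form itself,
  whose difference under the reflection is an explicit multiple of the root form.\<close>

lemma regular_mult_aux:
  assumes "regular f" "\<alpha> \<noteq> 0"
  shows "cdot w z * f z - cdot w (creflection \<alpha> z) * f (creflection \<alpha> z) =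
    cdot (cvec \<alpha>) z * (cdot w z * dunkl_quotient \<alpha> f z
      + 2 / complex_of_real (\<alpha> \<bullet> \<alpha>) * cdot w (cvec \<alpha>) * f (creflection \<alpha> z))"
proof -
  have 1: "f z = f (creflection \<alpha> z) + cdot (cvec \<alpha>) z * dunkl_quotient \<alpha> f z"
    using regular_quotient(2)[OF assms] by (metis add.commute diff_add_cancel)
  show ?thesis
    by (subst 1) (simp add: creflection_alt[of _ z] cdot_linear algebra_simps)
qed

lemma regular_cdot_mult:
  assumes "regular f"
  shows "regular (\<lambda>z. cdot w z * f z)"
proof (rule regularI[OF _ _ regular_mult_aux[OF assms]])
  show "entire (\<lambda>z. cdot w z * f z)"
    by (rule entire_mult[OF entire_cdot regular_entire[OF assms]])
  show "continuous_on UNIV (\<lambda>z. cdot w z * dunkl_quotient \<alpha> f z +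
      2 / complex_of_real (\<alpha> \<bullet> \<alpha>) * cdot w (cvec \<alpha>) * f (creflection \<alpha> z))" if "\<alpha> \<noteq> 0" for \<alpha>
    by (intro continuous_intros entire_cdot regular_quotient(1) assms that entire_continuous
      entire_creflection regular_entire[OF assms(1)])
qed

lemma dunkl_quotient_cdot_mult:
  assumes "regular f" "\<alpha> \<noteq> 0"
  shows "dunkl_quotient \<alpha> (\<lambda>z. cdot w z * f z) z = cdot w z * dunkl_quotient \<alpha> f z
      + 2 / complex_of_real (\<alpha> \<bullet> \<alpha>) * cdot w (cvec \<alpha>) * f (creflection \<alpha> z)"
  by (rule dunkl_quotient_eqI[OF assms(2) _ regular_mult_aux[OF assms]])
    (intro continuous_intros entire_cdot regular_quotient(1) assms entire_continuous
      entire_creflection regular_entire[OF assms(1)])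

lemma regular_scale_aux:
  assumes "regular f" "\<alpha> \<noteq> 0"
  shows "c * f z - c * f (creflection \<alpha> z) = cdot (cvec \<alpha>) z * (c * dunkl_quotient \<alpha> f z)"
  using regular_quotient(2)[OF assms] by (metis mult.left_commute right_diff_distrib)

lemma regular_scale:
  assumes "regular f"
  shows "regular (\<lambda>z. c * f z)"
  by (rule regularI[OF _ _ regular_scale_aux[OF assms]])
    (auto intro: entire_mult[OF entire_const regular_entire[OF assms]] continuous_on_mult_left
      regular_quotient(1)[OF assms])

lemma dunkl_quotient_scale:
  assumes "regular f" "\<alpha> \<noteq> 0"
  shows "dunkl_quotient \<alpha> (\<lambda>z. c * f z) z = c * dunkl_quotient \<alpha> f z"
  by (rule dunkl_quotient_eqI[OF assms(2) _ regular_scale_aux[OF assms]])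
    (intro continuous_intros regular_quotient(1) assms)

lemma regular_const: "regular (\<lambda>z. c)"
  by (rule hpoly_regular[OF hpoly.const])

lemma regular_sum: "(\<And>i. i \<in> A \<Longrightarrow> regular (f i)) \<Longrightarrow> regular (\<lambda>z. \<Sum>i\<in>A. f i z)"
  by (induction A rule: infinite_finite_induct) (auto intro: regular_const regular_add)

lemma dunkl_quotient_const: "\<alpha> \<noteq> 0 \<Longrightarrow> dunkl_quotient \<alpha> (\<lambda>z. c) z = 0"
  by (rule dunkl_quotient_eqI) auto

lemma dunkl_quotient_creflection:
  assumes "regular f" "\<alpha> \<noteq> 0" "\<beta> \<noteq> 0"
  shows "dunkl_quotient \<alpha> (\<lambda>z. f (creflection \<beta> z)) z =
    dunkl_quotient (reflection \<beta> \<alpha>) f (creflection \<beta> z)"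
proof -
  have nz: "reflection \<beta> \<alpha> \<noteq> 0"
    using norm_reflection[OF assms(3), of \<alpha>] assms(2) by auto
  show ?thesis
  proof (rule dunkl_quotient_eqI[OF assms(2)])
    show "f (creflection \<beta> z) - f (creflection \<beta> (creflection \<alpha> z)) =
      cdot (cvec \<alpha>) z * dunkl_quotient (reflection \<beta> \<alpha>) f (creflection \<beta> z)" for z
      using regular_quotient(2)[OF assms(1) nz, of "creflection \<beta> z"]
      by (simp add: creflection_conj[OF assms(3), symmetric] creflection_cvec[symmetric]
          cdot_creflection_both[OF assms(3)])
    show "continuous_on UNIV (\<lambda>z. dunkl_quotient (reflection \<beta> \<alpha>) f (creflection \<beta> z))"
      by (rule continuous_on_compose2[OF regular_quotient(1)[OF assms(1) nz]])
        (auto intro: bounded_linear.continuous_on[OF bounded_linear_creflection] continuous_on_id)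
  qed
qed

section \<open>Dunkl operators of a root system: product rule, equivariance, commutativity\<close>

locale dunkl =
  fixes R Rp :: "(real^'n) set" and k :: "real^'n \<Rightarrow> real"
  assumes root: "root_system R" and pos: "positive_subsystem R Rp"
    and mult: "multiplicity_function R k"
begin

abbreviation T :: "complex^'n \<Rightarrow> (complex^'n \<Rightarrow> complex) \<Rightarrow> complex^'n \<Rightarrow> complex" where
  "T \<equiv> dunkl_operator Rp k"

definition gam :: real where "gam = sum k Rp"

lemma finite_R: "finite R" and zero_notin_R: "0 \<notin> R"
  and reflection_in_R: "\<alpha> \<in> R \<Longrightarrow> \<beta> \<in> R \<Longrightarrow> reflection \<alpha> \<beta> \<in> R"
  using root unfolding root_system_def by auto

lemma Rp_subset: "Rp \<subseteq> R"
  using pos unfolding positive_subsystem_def by auto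

lemma finite_Rp: "finite Rp"
  using finite_R Rp_subset finite_subset by blast

lemma root_nz: "\<alpha> \<in> R \<Longrightarrow> \<alpha> \<noteq> 0" and pos_root_nz: "\<alpha> \<in> Rp \<Longrightarrow> \<alpha> \<noteq> 0"
  using zero_notin_R Rp_subset by auto

lemma k_pos_nonneg: "\<alpha> \<in> Rp \<Longrightarrow> 0 \<le> k \<alpha>"
  using mult Rp_subset unfolding multiplicity_function_def by auto

lemma gam_nonneg: "0 \<le> gam"
  unfolding gam_def by (intro sum_nonneg k_pos_nonneg)

lemma reflection_self: "reflection \<alpha> \<alpha> = - \<alpha>" for \<alpha> :: "real^'n"
  by (cases "\<alpha> = 0") (auto simp: reflection_def scaleR_2)

lemma uminus_in_R: "\<alpha> \<in> R \<Longrightarrow> - \<alpha> \<in> R"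
  using reflection_in_R[of \<alpha> \<alpha>] by (simp add: reflection_self)

lemma k_reflection: "\<alpha> \<in> R \<Longrightarrow> \<beta> \<in> R \<Longrightarrow> k (reflection \<beta> \<alpha>) = k \<alpha>"
  using mult reflection_group.intros(2)[OF reflection_group.intros(1), of \<beta> R]
  unfolding multiplicity_function_def by (auto simp: o_def)

lemma k_uminus: "\<alpha> \<in> R \<Longrightarrow> k (- \<alpha>) = k \<alpha>"
  using k_reflection[of \<alpha> \<alpha>] by (simp add: reflection_self)

text \<open>Reflections permute the full root system but not the positive roots. Summands that are
  even in the root can be moved to the full system, reindexed there and moved back.\<close>

lemma sum_R_even:
  fixes F :: "real^'n \<Rightarrow> complex"
  assumes "\<And>\<alpha>. \<alpha> \<in> R \<Longrightarrow> F (- \<alpha>) = F \<alpha>"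
  shows "(\<Sum>\<alpha>\<in>R. F \<alpha>) = 2 * (\<Sum>\<alpha>\<in>Rp. F \<alpha>)"
proof -
  obtain v where v: "\<forall>\<alpha>\<in>R. \<alpha> \<bullet> v \<noteq> 0" "Rp = {\<alpha>\<in>R. \<alpha> \<bullet> v > 0}"
    using pos unfolding positive_subsystem_def by blast
  have R: "R = Rp \<union> uminus ` Rp"
  proof
    show "R \<subseteq> Rp \<union> uminus ` Rp"
    proof
      fix \<alpha> assume a: "\<alpha> \<in> R"
      show "\<alpha> \<in> Rp \<union> uminus ` Rp"
      proof (cases "\<alpha> \<bullet> v > 0")
        case False
        then have "- \<alpha> \<in> Rp" using v a uminus_in_R[OF a]
          by (metis (mono_tags, lifting) inner_minus_left linorder_neqE_linordered_idom mem_Collect_eq neg_0_less_iff_less)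
        then show ?thesis by (metis UnI2 imageI minus_minus)
      qed (use a v in auto)
    qed
  qed (use Rp_subset uminus_in_R in auto)
  have "Rp \<inter> uminus ` Rp = {}" using v by auto
  then have "(\<Sum>\<alpha>\<in>R. F \<alpha>) = (\<Sum>\<alpha>\<in>Rp. F \<alpha>) + (\<Sum>\<alpha>\<in>uminus ` Rp. F \<alpha>)"
    using finite_Rp unfolding R by (intro sum.union_disjoint) auto
  also have "(\<Sum>\<alpha>\<in>uminus ` Rp. F \<alpha>) = (\<Sum>\<alpha>\<in>Rp. F (- \<alpha>))"
    by (subst sum.reindex) (auto simp: inj_on_def)
  also have "\<dots> = (\<Sum>\<alpha>\<in>Rp. F \<alpha>)"
    using Rp_subset assms by (intro sum.cong) auto
  finally show ?thesis by simp
qed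

lemma T_eq: "T \<xi> f z = dirderiv \<xi> f z
    + (\<Sum>\<alpha>\<in>Rp. complex_of_real (k \<alpha>) * cdot (cvec \<alpha>) \<xi> * dunkl_quotient \<alpha> f z)"
  by (simp add: dunkl_operator_def dirderiv_def)

lemma hpoly_T: "hpoly n p \<Longrightarrow> hpoly (n - 1) (T \<xi> p)"
  unfolding T_eq[abs_def]
  by (intro hpoly.add hpoly_sum hpoly_scale hpoly_dirderiv hpoly_dunkl_quotient pos_root_nz)

lemma T_const: "T \<xi> (\<lambda>z. c) z = 0"
  by (simp add: T_eq dirderiv_const dunkl_quotient_const pos_root_nz)

lemma T_add:
  assumes "regular f" "regular g"
  shows "T \<xi> (\<lambda>z. f z + g z) z = T \<xi> f z + T \<xi> g z"
  using assms
  by (simp add: T_eq dirderiv_add regular_entire dunkl_quotient_add pos_root_nz sum.distrib distrib_left)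

lemma T_scale:
  assumes "regular f"
  shows "T \<xi> (\<lambda>z. c * f z) z = c * T \<xi> f z"
  using assms dirderiv_mult[OF entire_const regular_entire[OF assms], of \<xi> c z]
  by (simp add: T_eq dirderiv_const dunkl_quotient_scale pos_root_nz sum_distrib_left distrib_left mult_ac)

lemma T_sum:
  assumes "finite A" "\<And>i. i \<in> A \<Longrightarrow> regular (f i)"
  shows "T \<xi> (\<lambda>z. \<Sum>i\<in>A. f i z) z = (\<Sum>i\<in>A. T \<xi> (f i) z)"
  using assms
  by (induction A rule: finite_induct) (auto simp: T_const T_add regular_sum)

text \<open>The commutation relation between a Dunkl operator and multiplication by a linear form:
  the Leibniz rule plus one reflection term for each positive root.\<close>

lemma T_cdot_mult:
  assumes "regular f"
  shows "T \<xi> (\<lambda>z. cdot w z * f z) z = cdot w z * T \<xi> f z + cdot w \<xi> * f z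
    + (\<Sum>\<alpha>\<in>Rp. complex_of_real (k \<alpha>) * cdot (cvec \<alpha>) \<xi> *
         (2 / complex_of_real (\<alpha> \<bullet> \<alpha>) * cdot w (cvec \<alpha>)) * f (creflection \<alpha> z))"
proof -
  have "(\<Sum>\<alpha>\<in>Rp. complex_of_real (k \<alpha>) * cdot (cvec \<alpha>) \<xi> * dunkl_quotient \<alpha> (\<lambda>z. cdot w z * f z) z) =
    cdot w z * (\<Sum>\<alpha>\<in>Rp. complex_of_real (k \<alpha>) * cdot (cvec \<alpha>) \<xi> * dunkl_quotient \<alpha> f z) +
    (\<Sum>\<alpha>\<in>Rp. complex_of_real (k \<alpha>) * cdot (cvec \<alpha>) \<xi> *
         (2 / complex_of_real (\<alpha> \<bullet> \<alpha>) * cdot w (cvec \<alpha>)) * f (creflection \<alpha> z))"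
    unfolding sum_distrib_left sum.distrib[symmetric]
    by (intro sum.cong refl, subst dunkl_quotient_cdot_mult[OF assms pos_root_nz])
      (simp_all only: distrib_left mult_ac)
  then show ?thesis
    by (simp add: T_eq dirderiv_mult[OF entire_cdot regular_entire[OF assms]] dirderiv_cdot distrib_left)
qed

lemma T_vadd:
  assumes "entire f"
  shows "T (\<xi> + \<eta>) f z = T \<xi> f z + T \<eta> f z"
  by (simp add: T_eq dirderiv_vadd[OF assms] cdot_linear distrib_left distrib_right sum.distrib)

lemma T_vscale:
  assumes "entire f"
  shows "T (c *s \<xi>) f z = c * T \<xi> f z"
  by (simp add: T_eq dirderiv_scale[OF assms] cdot_linear distrib_left sum_distrib_left mult_ac)

lemma T_vcreflection:
  assumes "entire f"
  shows "T (creflection \<alpha> \<xi>) f z =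
    T \<xi> f z - 2 / complex_of_real (\<alpha> \<bullet> \<alpha>) * cdot (cvec \<alpha>) \<xi> * T (cvec \<alpha>) f z"
proof -
  have "creflection \<alpha> \<xi> = \<xi> + (- (2 / complex_of_real (\<alpha> \<bullet> \<alpha>) * cdot (cvec \<alpha>) \<xi>)) *s cvec \<alpha>"
    by (simp add: creflection_alt vec_eq_iff)
  then show ?thesis by (simp only: T_vadd[OF assms] T_vscale[OF assms]) simp
qed

text \<open>Equivariance under the group. Root form and quotient both change sign with the root, so
  the summand is even; reindexing by the reflection then uses invariance of
  \<open>k\<close>.\<close>

lemma T_creflection:
  assumes f: "regular f" and \<beta>: "\<beta> \<in> R"
  shows "T \<xi> (\<lambda>z. f (creflection \<beta> z)) z = T (creflection \<beta> \<xi>) f (creflection \<beta> z)"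
proof -
  note nz = root_nz[OF \<beta>]
  define F where "F \<alpha> = complex_of_real (k \<alpha>) * cdot (cvec \<alpha>) (creflection \<beta> \<xi>) *
    dunkl_quotient \<alpha> f (creflection \<beta> z)" for \<alpha>
  have dq: "dunkl_quotient (- \<alpha>) f w = - dunkl_quotient \<alpha> f w" if "\<alpha> \<noteq> 0" for \<alpha> w
    by (rule dunkl_quotient_eqI)
      (use that regular_quotient[OF f that] in \<open>auto simp: cvec_minus cdot_def sum_negf creflection_uminus_root
         intro: continuous_on_minus\<close>)
  have ev: "F (- \<alpha>) = F \<alpha>" if "\<alpha> \<in> R" for \<alpha>
    using that root_nz[OF that] by (simp add: F_def k_uminus dq cvec_minus cdot_def sum_negf)
  have rr: "reflection \<beta> (reflection \<beta> x) = x" for x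
    using creflection_involution[OF nz, of "cvec x"]
    by (simp add: creflection_cvec) (simp add: cvec_def vec_eq_iff)
  have refl_minus: "reflection \<beta> (- x) = - reflection \<beta> x" for x
    by (simp add: reflection_def)
  have bij: "bij_betw (reflection \<beta>) R R"
    by (rule bij_betwI[of _ _ _ "reflection \<beta>"]) (auto simp: rr reflection_in_R \<beta>)
  have "2 * (\<Sum>\<alpha>\<in>Rp. F (reflection \<beta> \<alpha>)) = (\<Sum>\<alpha>\<in>R. F (reflection \<beta> \<alpha>))"
    by (rule sum_R_even[symmetric]) (simp add: refl_minus ev reflection_in_R \<beta>)
  also have "\<dots> = (\<Sum>\<alpha>\<in>R. F \<alpha>)"
    by (rule sum.reindex_bij_betw[OF bij])
  also have "\<dots> = 2 * (\<Sum>\<alpha>\<in>Rp. F \<alpha>)"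
    using ev by (rule sum_R_even)
  finally have eq: "(\<Sum>\<alpha>\<in>Rp. F (reflection \<beta> \<alpha>)) = (\<Sum>\<alpha>\<in>Rp. F \<alpha>)" by simp
  have "F (reflection \<beta> \<alpha>) = complex_of_real (k \<alpha>) * cdot (cvec \<alpha>) \<xi> *
      dunkl_quotient \<alpha> (\<lambda>z. f (creflection \<beta> z)) z" if "\<alpha> \<in> Rp" for \<alpha>
    using that Rp_subset \<beta>
    by (subst dunkl_quotient_creflection[OF f pos_root_nz[OF that] nz])
      (auto simp: F_def k_reflection creflection_cvec[symmetric] cdot_creflection_both[OF nz])
  then show ?thesis
    by (simp add: T_eq dirderiv_creflection F_def[symmetric] eq[symmetric])
qed

text \<open>The commutator of \<open>T a\<close> and \<open>T b\<close> kills constants and commutes with multiplication by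
  linear forms.\<close>

lemma T_commute: "hpoly n p \<Longrightarrow> T a (T b p) z = T b (T a p) z"
proof (induction arbitrary: z rule: hpoly.induct)
  case (const c)
  then show ?case by (simp add: T_const[abs_def])
next
  case (add n p q)
  have 1: "T b (\<lambda>z. p z + q z) = (\<lambda>z. T b p z + T b q z)" for b
    using add by (intro ext T_add) (auto intro: hpoly_regular)
  have "T a (T b (\<lambda>z. p z + q z)) z = T a (T b p) z + T a (T b q) z" for a b
    unfolding 1 using add by (intro T_add) (auto intro: hpoly_regular hpoly_T)
  then show ?case using add.IH by simp
next
  case (coord n p i)
  define v :: "complex^'n" where "v = axis i 1"
  define c where "c \<alpha> b = complex_of_real (k \<alpha>) * cdot (cvec \<alpha>) b *
    (2 / complex_of_real (\<alpha> \<bullet> \<alpha>) * cdot v (cvec \<alpha>))" for \<alpha> b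
  have p: "regular p" "entire p" and Tp: "regular (T b p)" for b
    using coord.hyps by (auto intro: hpoly_regular hpoly_entire hpoly_T)
  have pr: "regular (\<lambda>z. p (creflection \<alpha> z))" for \<alpha>
    using coord.hyps by (intro hpoly_regular hpoly_creflection)
  have 1: "T b (\<lambda>z. cdot v z * p z) =
    (\<lambda>z. cdot v z * T b p z + (cdot v b * p z + (\<Sum>\<alpha>\<in>Rp. c \<alpha> b * p (creflection \<alpha> z))))" for b
    by (rule ext) (simp add: T_cdot_mult[OF p(1)] c_def)
  have 2: "T a (T b (\<lambda>z. cdot v z * p z)) z = cdot v z * T a (T b p) z + cdot v a * T b p z
     + (\<Sum>\<alpha>\<in>Rp. c \<alpha> a * T b p (creflection \<alpha> z)) + cdot v b * T a p z
     + (\<Sum>\<alpha>\<in>Rp. c \<alpha> b * T a p (creflection \<alpha> z))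
     - (\<Sum>\<alpha>\<in>Rp. c \<alpha> b * (2 / complex_of_real (\<alpha> \<bullet> \<alpha>) * cdot (cvec \<alpha>) a) * T (cvec \<alpha>) p (creflection \<alpha> z))" for a b
  proof -
    have s: "T a (\<lambda>z. \<Sum>\<alpha>\<in>Rp. c \<alpha> b * p (creflection \<alpha> z)) z =
      (\<Sum>\<alpha>\<in>Rp. c \<alpha> b * T a p (creflection \<alpha> z))
      - (\<Sum>\<alpha>\<in>Rp. c \<alpha> b * (2 / complex_of_real (\<alpha> \<bullet> \<alpha>) * cdot (cvec \<alpha>) a) * T (cvec \<alpha>) p (creflection \<alpha> z))"
    proof -
      have "T a (\<lambda>z. \<Sum>\<alpha>\<in>Rp. c \<alpha> b * p (creflection \<alpha> z)) z =
        (\<Sum>\<alpha>\<in>Rp. c \<alpha> b * T (creflection \<alpha> a) p (creflection \<alpha> z))"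
        using Rp_subset
        by (subst T_sum) (auto intro!: regular_scale pr finite_Rp sum.cong
            simp: T_scale[OF pr] T_creflection[OF p(1)] subset_eq)
      also have "\<dots> = (\<Sum>\<alpha>\<in>Rp. c \<alpha> b * T a p (creflection \<alpha> z)
        - c \<alpha> b * (2 / complex_of_real (\<alpha> \<bullet> \<alpha>) * cdot (cvec \<alpha>) a) * T (cvec \<alpha>) p (creflection \<alpha> z))"
        unfolding T_vcreflection[OF p(2)] by (intro sum.cong refl) (simp add: right_diff_distrib mult.assoc)
      finally show ?thesis by (simp add: sum_subtractf)
    qed
    show ?thesis
      unfolding 1
      apply (subst T_add)
        apply (intro regular_cdot_mult Tp)
       apply (intro regular_add regular_scale regular_sum p pr)
      apply (subst T_add)
        apply (intro regular_scale p)
       apply (intro regular_sum regular_scale pr)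
      unfolding T_cdot_mult[OF Tp] T_scale[OF p(1)] s by (simp add: c_def)
  qed
  \<comment> \<open>In \<open>2\<close> the first term is symmetric by the induction hypothesis and
    the middle ones are exchanged in pairs; only the last sum remains, where
    \<open>c \<alpha> b\<close> hides a factor \<open>cdot (cvec \<alpha>) b\<close> matching the
    visible one with \<open>a\<close>.\<close>
  have 3: "(\<Sum>\<alpha>\<in>Rp. c \<alpha> b * (2 / complex_of_real (\<alpha> \<bullet> \<alpha>) * cdot (cvec \<alpha>) a) * T (cvec \<alpha>) p (creflection \<alpha> z)) =
    (\<Sum>\<alpha>\<in>Rp. c \<alpha> a * (2 / complex_of_real (\<alpha> \<bullet> \<alpha>) * cdot (cvec \<alpha>) b) * T (cvec \<alpha>) p (creflection \<alpha> z))"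
    by (intro sum.cong refl) (simp add: c_def)
  have "T a (T b (\<lambda>z. cdot v z * p z)) z = T b (T a (\<lambda>z. cdot v z * p z)) z"
    unfolding 2 3 coord.IH by simp
  then show ?case by (simp add: v_def)
qed

end

section \<open>The reflection group acting on complex vectors\<close>

lemma reflection_linear: "linear (reflection \<alpha>)"
  by (rule linearI) (simp_all add: reflection_def inner_right_distrib inner_scaleR_right algebra_simps
      add_divide_distrib)

lemma reflection_group_linear: "g \<in> reflection_group R \<Longrightarrow> linear g"
  by (induction rule: reflection_group.induct)
    (simp_all only: linear_id linear_compose reflection_linear)

lemma reflection_group_fixes_orthogonal:
  "g \<in> reflection_group R \<Longrightarrow> (\<And>\<alpha>. \<alpha> \<in> R \<Longrightarrow> \<alpha> \<bullet> x = 0) \<Longrightarrow> g x = x"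
  by (induction rule: reflection_group.induct) (auto simp: reflection_def)

lemma reflection_group_fixes_roots:
  "g \<in> reflection_group R \<Longrightarrow> root_system R \<Longrightarrow> \<alpha> \<in> R \<Longrightarrow> g \<alpha> \<in> R"
  by (induction rule: reflection_group.induct) (auto simp: root_system_def)

text \<open>A group element permutes the roots and is determined by this permutation: it is linear
  on the span of the roots and the identity on the orthogonal complement. The second point matters
  because the roots may fail to span.\<close>

lemma finite_reflection_group:
  fixes R :: "'a::euclidean_space set"
  assumes "root_system R"
  shows "finite (reflection_group R)"
proof -
  have "inj_on (\<lambda>g. restrict g R) (reflection_group R)"
  proof (rule inj_onI)
    fix g h assume gh: "g \<in> reflection_group R" "h \<in> reflection_group R"
      and eq: "restrict g R = restrict h R"
    have on_R: "g \<alpha> = h \<alpha>" if "\<alpha> \<in> R" for \<alpha>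
      using fun_cong[OF eq, of \<alpha>] that by simp
    show "g = h"
    proof
      fix x
      obtain y z where yz: "y \<in> span R" "\<And>w. w \<in> span R \<Longrightarrow> orthogonal z w" "x = y + z"
        using orthogonal_subspace_decomp_exists[of R x] by blast
      have z: "\<alpha> \<bullet> z = 0" if "\<alpha> \<in> R" for \<alpha>
        using yz(2)[OF span_base[OF that]] by (simp add: orthogonal_def inner_commute)
      have "g z = z" "h z = z"
        by (rule reflection_group_fixes_orthogonal[OF gh(1) z], assumption,
            rule reflection_group_fixes_orthogonal[OF gh(2) z], assumption)
      moreover have "g y = h y"
        by (rule linear_eq_on_span[OF reflection_group_linear[OF gh(1)] reflection_group_linear[OF gh(2)] on_R yz(1)])
      ultimately show "g x = h x"
        by (simp add: yz(3) linear_add[OF reflection_group_linear[OF gh(1)]]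
            linear_add[OF reflection_group_linear[OF gh(2)]])
    qed
  qed
  moreover have "(\<lambda>g. restrict g R) ` reflection_group R \<subseteq> R \<rightarrow>\<^sub>E R"
    using assms by (auto intro: reflection_group_fixes_roots)
  moreover have "finite (R \<rightarrow>\<^sub>E R)"
    using assms by (intro finite_PiE) (auto simp: root_system_def)
  ultimately show ?thesis
    by (meson finite_imageD finite_subset)
qed

lemma root_system_nonzero: "root_system R \<Longrightarrow> \<alpha> \<in> R \<Longrightarrow> \<alpha> \<noteq> 0"
  by (auto simp: root_system_def)

lemma norm_reflection_group:
  fixes R :: "(real^'n) set"
  shows "g \<in> reflection_group R \<Longrightarrow> root_system R \<Longrightarrow> norm (g x) = norm x"
  by (induction rule: reflection_group.induct) (auto simp: norm_reflection root_system_nonzero)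

text \<open>The group generated by the complexified reflections. Its elements are complexifications,
  via \<open>lift_real\<close>, of elements of the real group, which transfers finiteness.\<close>

inductive_set cgroup :: "(real^'n) set \<Rightarrow> (complex^'n \<Rightarrow> complex^'n) set" for R where
  id: "id \<in> cgroup R"
| step: "g \<in> cgroup R \<Longrightarrow> \<alpha> \<in> R \<Longrightarrow> creflection \<alpha> \<circ> g \<in> cgroup R"

definition lift_real :: "(real^'n \<Rightarrow> real^'n) \<Rightarrow> complex^'n \<Rightarrow> complex^'n" where
  "lift_real g z = cvec (g (\<chi> i. Re (z $ i))) + \<i> *s cvec (g (\<chi> i. Im (z $ i)))"

lemma cgroup_subset: "cgroup R \<subseteq> lift_real ` reflection_group R"
proof
  fix g assume "g \<in> cgroup R"
  then show "g \<in> lift_real ` reflection_group R"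
  proof induction
    case id
    have "id = lift_real (id :: real^'n \<Rightarrow> real^'n)"
      by (rule ext) (simp add: lift_real_def cvec_def vec_eq_iff complex_eq_iff)
    then show ?case using reflection_group.intros(1)[of R] by (metis image_eqI)
  next
    case (step g \<alpha>)
    then obtain h where h: "h \<in> reflection_group R" "g = lift_real h" by blast
    have "creflection \<alpha> \<circ> g = lift_real (reflection \<alpha> \<circ> h)"
      by (rule ext) (simp add: h lift_real_def creflection_add creflection_scale creflection_cvec)
    then show ?case using reflection_group.intros(2)[OF h(1) step.hyps(2)] by blast
  qed
qed

text \<open>The generation rule extends words on the left, while the sums over the group below are
  shifted by right multiplication.\<close>

lemma cgroup_right: "g \<in> cgroup R \<Longrightarrow> \<alpha> \<in> R \<Longrightarrow> g \<circ> creflection \<alpha> \<in> cgroup R"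
  by (induction rule: cgroup.induct)
    (use cgroup.intros in \<open>fastforce simp: o_assoc[symmetric]\<close>)+

lemma hpoly_cgroup: "g \<in> cgroup R \<Longrightarrow> hpoly n p \<Longrightarrow> hpoly n (\<lambda>z. p (g z))"
  by (induction arbitrary: p rule: cgroup.induct) (auto intro: hpoly_creflection)

section \<open>A maximum principle on finite sets closed under reflections\<close>

context dunkl
begin

lemma finite_cgroup: "finite (cgroup R)"
  using cgroup_subset finite_reflection_group[OF root] by (meson finite_imageI finite_subset)

lemma norm_cgroup: "g \<in> cgroup R \<Longrightarrow> norm (g z) = norm z"
  by (induction rule: cgroup.induct) (auto simp: norm_creflection root_nz)

text \<open>At a minimiser the weighted sum over neighbours is at least \<open>gam\<close> times the
  minimum \<open>M\<close>, which leaves \<open>0 \<le> m * M\<close>. The index type is arbitrary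
  because the principle is applied to complex orbits, to orbits of pairs of direction and point, and
  to real orbits.\<close>

lemma max_principle:
  fixes v :: "'i \<Rightarrow> real" and s :: "real^'n \<Rightarrow> 'i \<Rightarrow> 'i"
  assumes I: "finite I" "g \<in> I" and m: "m > 0"
    and closed: "\<And>\<alpha> g. \<alpha> \<in> Rp \<Longrightarrow> g \<in> I \<Longrightarrow> s \<alpha> g \<in> I"
    and le: "\<And>g. g \<in> I \<Longrightarrow> (\<Sum>\<alpha>\<in>Rp. k \<alpha> * v (s \<alpha> g)) \<le> (m + gam) * v g"
  shows "0 \<le> v g"
proof -
  define M where "M = Min (v ` I)"
  have "M \<in> v ` I" unfolding M_def using I by (intro Min_in) auto
  then obtain h where h: "h \<in> I" "v h = M" by auto
  have M: "M \<le> v x" if "x \<in> I" for x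
    unfolding M_def using that I by simp
  have "gam * M \<le> (\<Sum>\<alpha>\<in>Rp. k \<alpha> * v (s \<alpha> h))"
    unfolding gam_def sum_distrib_right
    by (intro sum_mono mult_left_mono M closed h k_pos_nonneg)
  also have "\<dots> \<le> (m + gam) * M" using le[OF h(1)] h(2) by simp
  finally have "0 \<le> m * M" by (simp add: algebra_simps)
  then show ?thesis using m M[OF I(2)] by (simp add: zero_le_mult_iff)
qed

text \<open>The maximum principle for \<open>B / m - norm (v g)\<close>. The contribution of
  \<open>gam\<close> cancels, so the bound does not depend on the multiplicities; with
  \<open>B = 0\<close> it becomes a uniqueness statement.\<close>

lemma norm_bound:
  fixes v :: "'i \<Rightarrow> complex" and s :: "real^'n \<Rightarrow> 'i \<Rightarrow> 'i"
  assumes I: "finite I" "g \<in> I" and m: "m > 0"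
    and closed: "\<And>\<alpha> g. \<alpha> \<in> Rp \<Longrightarrow> g \<in> I \<Longrightarrow> s \<alpha> g \<in> I"
    and eq: "\<And>g. g \<in> I \<Longrightarrow>
      complex_of_real (m + gam) * v g = (\<Sum>\<alpha>\<in>Rp. complex_of_real (k \<alpha>) * v (s \<alpha> g)) + h g"
    and h: "\<And>g. g \<in> I \<Longrightarrow> norm (h g) \<le> B"
  shows "norm (v g) \<le> B / m"
proof -
  have "0 \<le> B / m - norm (v g)"
  proof (rule max_principle[OF I m closed, where v = "\<lambda>g. B / m - norm (v g)"])
    fix g assume g: "g \<in> I"
    have "(m + gam) * norm (v g) = norm (complex_of_real (m + gam) * v g)"
      using m gam_nonneg by (simp add: norm_mult del: of_real_add)
    also have "\<dots> \<le> norm (\<Sum>\<alpha>\<in>Rp. complex_of_real (k \<alpha>) * v (s \<alpha> g)) + norm (h g)"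
      unfolding eq[OF g] by (rule norm_triangle_ineq)
    also have "\<dots> \<le> (\<Sum>\<alpha>\<in>Rp. k \<alpha> * norm (v (s \<alpha> g))) + B"
      using k_pos_nonneg
      by (intro add_mono h g order_trans[OF norm_sum] sum_mono) (simp add: norm_mult)
    finally have "(m + gam) * norm (v g) \<le> (\<Sum>\<alpha>\<in>Rp. k \<alpha> * norm (v (s \<alpha> g))) + B" .
    moreover have "(\<Sum>\<alpha>\<in>Rp. k \<alpha> * (B / m - norm (v (s \<alpha> g)))) =
      gam * (B / m) - (\<Sum>\<alpha>\<in>Rp. k \<alpha> * norm (v (s \<alpha> g)))"
      by (simp add: gam_def right_diff_distrib sum_subtractf sum_distrib_right del: times_divide_eq_right)
    moreover have "(m + gam) * (B / m) = B + gam * (B / m)"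
      using m by (simp add: field_simps)
    ultimately show "(\<Sum>\<alpha>\<in>Rp. k \<alpha> * (B / m - norm (v (s \<alpha> g)))) \<le> (m + gam) * (B / m - norm (v g))"
      by (simp add: right_diff_distrib del: times_divide_eq_right)
  qed
  then show ?thesis by simp
qed

definition orbit :: "complex^'n \<Rightarrow> (complex^'n) set" where
  "orbit z = (\<lambda>g. g z) ` cgroup R"

lemma orbit_facts:
  "finite (orbit z)" "z \<in> orbit z" "\<alpha> \<in> Rp \<Longrightarrow> x \<in> orbit z \<Longrightarrow> creflection \<alpha> x \<in> orbit z"
  "x \<in> orbit z \<Longrightarrow> norm x = norm z"
proof -
  show "finite (orbit z)" unfolding orbit_def using finite_cgroup by simp
  show "z \<in> orbit z" unfolding orbit_def by (rule image_eqI[of _ _ id]) (auto intro: cgroup.id)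
  show "creflection \<alpha> x \<in> orbit z" if a: "\<alpha> \<in> Rp" "x \<in> orbit z"
  proof -
    obtain g where g: "g \<in> cgroup R" "x = g z" using a(2) unfolding orbit_def by (rule imageE)
    show ?thesis unfolding orbit_def
      by (rule image_eqI[of _ _ "creflection \<alpha> \<circ> g"]) (use g a Rp_subset in \<open>auto intro: cgroup.step\<close>)
  qed
  show "norm x = norm z" if "x \<in> orbit z"
    using that norm_cgroup unfolding orbit_def by auto
qed


section \<open>Homogeneous components of the Dunkl kernel\<close>

text \<open>With \<open>S h = (\<Sum>\<alpha>\<in>Rp. k \<alpha> * h \<circ> creflection \<alpha>)\<close>, the Neumann series of
  \<open>(m + \<gamma> - S)\<^sup>-\<^sup>1\<close> is regrouped according to group elements, so that the result is a finite
  sum and polynomials are mapped to polynomials.\<close>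

primrec walk :: "nat \<Rightarrow> (complex^'n \<Rightarrow> complex^'n) \<Rightarrow> real" where
  "walk 0 g = (if g = id then 1 else 0)"
| "walk (Suc j) g = (\<Sum>\<alpha>\<in>Rp. k \<alpha> * walk j (g \<circ> creflection \<alpha>))"

text \<open>The coefficient of \<open>h \<circ> g\<close> in the Neumann series: the j-th power of S
  applied to h is the sum over g of \<open>walk j g\<close> times \<open>h \<circ> g\<close>. It is
  a Green function of a random walk on the group.\<close>

definition green :: "real \<Rightarrow> (complex^'n \<Rightarrow> complex^'n) \<Rightarrow> real" where
  "green m g = (\<Sum>j. walk j g / (m + gam) ^ Suc j)"

lemma walk_bounds: "0 \<le> walk j g \<and> walk j g \<le> gam ^ j"
proof (induction j arbitrary: g)
  case (Suc j)
  have "(\<Sum>\<alpha>\<in>Rp. k \<alpha> * walk j (g \<circ> creflection \<alpha>)) \<le> (\<Sum>\<alpha>\<in>Rp. k \<alpha> * gam ^ j)"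
    using Suc by (intro sum_mono mult_left_mono k_pos_nonneg) auto
  moreover have "0 \<le> (\<Sum>\<alpha>\<in>Rp. k \<alpha> * walk j (g \<circ> creflection \<alpha>))"
    using Suc by (intro sum_nonneg mult_nonneg_nonneg k_pos_nonneg) auto
  ultimately show ?case by (simp add: gam_def sum_distrib_right)
qed auto

lemma walk_summable:
  assumes "m > 0"
  shows "summable (\<lambda>j. walk j g / (m + gam) ^ j)"
proof (rule summable_comparison_test')
  \<comment> \<open>Here \<open>m > 0\<close> enters: it makes the ratio strictly smaller than
    1.\<close>
  show "summable (\<lambda>j. (gam / (m + gam)) ^ j)"
    using assms gam_nonneg by (intro summable_geometric) simp
  show "norm (walk j g / (m + gam) ^ j) \<le> (gam / (m + gam)) ^ j" for j
    using assms gam_nonneg walk_bounds[of j g]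
    by (simp add: power_divide divide_right_mono)
qed

lemma green_eq:
  assumes m: "m > 0"
  shows "(m + gam) * green m g = (if g = id then 1 else 0) + (\<Sum>\<alpha>\<in>Rp. k \<alpha> * green m (g \<circ> creflection \<alpha>))"
proof -
  have nz: "m + gam \<noteq> 0" using m gam_nonneg by simp
  have s: "summable (\<lambda>j. walk j g / (m + gam) ^ Suc j)" for g
    using summable_mult[OF walk_summable[OF m, of g], of "1 / (m + gam)"] by (simp add: mult.commute)
  have "(m + gam) * green m g = (\<Sum>j. (m + gam) * (walk j g / (m + gam) ^ Suc j))"
    unfolding green_def by (rule suminf_mult[OF s, symmetric])
  also have "\<dots> = (\<Sum>j. walk j g / (m + gam) ^ j)"
    using nz by simp
  also have "\<dots> = walk 0 g + (\<Sum>j. walk (Suc j) g / (m + gam) ^ Suc j)"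
    using suminf_split_head[OF walk_summable[OF m, of g]] by simp
  also have "(\<Sum>j. walk (Suc j) g / (m + gam) ^ Suc j) =
    (\<Sum>j. \<Sum>\<alpha>\<in>Rp. k \<alpha> * (walk j (g \<circ> creflection \<alpha>) / (m + gam) ^ Suc j))"
    by (simp add: sum_divide_distrib)
  also have "\<dots> = (\<Sum>\<alpha>\<in>Rp. \<Sum>j. k \<alpha> * (walk j (g \<circ> creflection \<alpha>) / (m + gam) ^ Suc j))"
    by (rule suminf_sum) (intro summable_mult s)
  also have "\<dots> = (\<Sum>\<alpha>\<in>Rp. k \<alpha> * green m (g \<circ> creflection \<alpha>))"
    unfolding green_def by (intro sum.cong refl suminf_mult s)
  finally show ?thesis by simp
qed

definition resolvent :: "real \<Rightarrow> (complex^'n \<Rightarrow> complex) \<Rightarrow> complex^'n \<Rightarrow> complex" where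
  "resolvent m h z = (\<Sum>g\<in>cgroup R. complex_of_real (green m g) * h (g z))"

lemma resolvent_eq:
  assumes "m > 0"
  shows "complex_of_real (m + gam) * resolvent m h z =
    (\<Sum>\<alpha>\<in>Rp. complex_of_real (k \<alpha>) * resolvent m h (creflection \<alpha> z)) + h z"
proof -
  \<comment> \<open>Right multiplication by a reflection permutes the group, so a reflection in the
    argument can be moved into the weight, where \<open>green_eq\<close> applies.\<close>
  have shift: "resolvent m h (creflection \<alpha> z) =
    (\<Sum>g\<in>cgroup R. complex_of_real (green m (g \<circ> creflection \<alpha>)) * h (g z))" if "\<alpha> \<in> Rp" for \<alpha>
  proof -
    have a: "\<alpha> \<in> R" "\<alpha> \<noteq> 0" using that Rp_subset pos_root_nz by auto
    have "creflection \<alpha> \<circ> creflection \<alpha> = id"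
      by (rule ext) (simp add: creflection_involution a)
    then have inv: "g \<circ> creflection \<alpha> \<circ> creflection \<alpha> = g" for g :: "complex^'n \<Rightarrow> complex^'n"
      by (simp add: o_assoc[symmetric])
    have "bij_betw (\<lambda>g. g \<circ> creflection \<alpha>) (cgroup R) (cgroup R)"
      by (rule bij_betwI[of _ _ _ "\<lambda>g. g \<circ> creflection \<alpha>"]) (auto simp: inv cgroup_right a)
    from sum.reindex_bij_betw[OF this, of "\<lambda>g. complex_of_real (green m g) * h (g (creflection \<alpha> z))", symmetric]
    show ?thesis by (simp add: resolvent_def creflection_involution a)
  qed
  have "(\<Sum>\<alpha>\<in>Rp. complex_of_real (k \<alpha>) * resolvent m h (creflection \<alpha> z)) =
    (\<Sum>g\<in>cgroup R. complex_of_real (\<Sum>\<alpha>\<in>Rp. k \<alpha> * green m (g \<circ> creflection \<alpha>)) * h (g z))"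
  proof -
    have "(\<Sum>\<alpha>\<in>Rp. complex_of_real (k \<alpha>) * resolvent m h (creflection \<alpha> z)) =
      (\<Sum>\<alpha>\<in>Rp. \<Sum>g\<in>cgroup R. complex_of_real (k \<alpha> * green m (g \<circ> creflection \<alpha>)) * h (g z))"
      by (intro sum.cong refl) (simp add: shift sum_distrib_left mult.assoc)
    also have "\<dots> = (\<Sum>g\<in>cgroup R. \<Sum>\<alpha>\<in>Rp. complex_of_real (k \<alpha> * green m (g \<circ> creflection \<alpha>)) * h (g z))"
      by (rule sum.swap)
    finally show ?thesis by (simp add: sum_distrib_right)
  qed
  moreover have "h z = (\<Sum>g\<in>cgroup R. complex_of_real (if g = id then 1 else 0) * h (g z))"
  proof -
    have "(\<Sum>g\<in>cgroup R. complex_of_real (if g = id then 1 else 0) * h (g z)) =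
      (\<Sum>g\<in>cgroup R. if g = id then h z else 0)"
      by (intro sum.cong) auto
    also have "\<dots> = h z"
      by (subst sum.delta[OF finite_cgroup]) (simp only: cgroup.id if_True)
    finally show ?thesis by (rule sym)
  qed
  moreover have "complex_of_real (m + gam) * resolvent m h z =
    (\<Sum>g\<in>cgroup R. complex_of_real ((m + gam) * green m g) * h (g z))"
    by (simp add: resolvent_def sum_distrib_left mult_ac)
  ultimately show ?thesis
    unfolding green_eq[OF assms] by (simp add: sum.distrib distrib_right add.commute)
qed

lemma hpoly_resolvent: "hpoly n h \<Longrightarrow> hpoly n (resolvent m h)"
  unfolding resolvent_def[abs_def] by (rule hpoly_sum, rule hpoly_scale, rule hpoly_cgroup)

primrec kernel_coeff :: "complex^'n \<Rightarrow> nat \<Rightarrow> complex^'n \<Rightarrow> complex" where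
  "kernel_coeff w 0 = (\<lambda>z. 1)"
| "kernel_coeff w (Suc n) = resolvent (real (Suc n)) (\<lambda>z. cdot w z * kernel_coeff w n z)"

lemma hpoly_kernel_coeff: "hpoly n (kernel_coeff w n)"
  by (induction n) (auto intro: hpoly.const hpoly_resolvent hpoly_cdot)

lemma regular_kernel_coeff: "regular (kernel_coeff w n)" and entire_kernel_coeff: "entire (kernel_coeff w n)"
  by (rule hpoly_regular[OF hpoly_kernel_coeff]) (rule hpoly_entire[OF hpoly_kernel_coeff])

lemma kernel_coeff_Suc:
  "complex_of_real (real (Suc n) + gam) * kernel_coeff w (Suc n) z =
    (\<Sum>\<alpha>\<in>Rp. complex_of_real (k \<alpha>) * kernel_coeff w (Suc n) (creflection \<alpha> z)) + cdot w z * kernel_coeff w n z"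
  using resolvent_eq[of "real (Suc n)" "\<lambda>z. cdot w z * kernel_coeff w n z" z] by simp

text \<open>When direction and point coincide, the root form cancels the denominator. On a
  hyperplane both sides vanish whatever value \<open>Lim\<close> has there, so no assumption on
  \<open>f\<close> is made.\<close>

lemma T_radial:
  "T z f z = dirderiv z f z + (\<Sum>\<alpha>\<in>Rp. complex_of_real (k \<alpha>) * (f z - f (creflection \<alpha> z)))"
proof -
  have "cdot (cvec \<alpha>) z * dunkl_quotient \<alpha> f z = f z - f (creflection \<alpha> z)" for \<alpha>
    by (cases "cdot (cvec \<alpha>) z = 0") (auto simp: dunkl_quotient_def creflection_fixed)
  then show ?thesis unfolding T_eq mult.assoc by simp
qed

lemma T_radial_hpoly:
  assumes "hpoly n p"
  shows "T z p z = complex_of_real (real n + gam) * p z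
    - (\<Sum>\<alpha>\<in>Rp. complex_of_real (k \<alpha>) * p (creflection \<alpha> z))"
  unfolding T_radial dirderiv_euler[OF assms]
  by (simp add: right_diff_distrib sum_subtractf gam_def sum_distrib_right distrib_right)

lemma T_expand:
  assumes "entire f"
  shows "(\<Sum>i\<in>UNIV. v $ i * T (axis i 1) f z) = T v f z"
proof -
  have "T (\<Sum>i\<in>A. v $ i *s axis i 1) f z = (\<Sum>i\<in>A. v $ i * T (axis i 1) f z)" if "finite A" for A
    using that
  proof (induction A rule: finite_induct)
    case empty
    have "T 0 f z = 0" using T_vscale[OF assms, of 0 0] by simp
    then show ?case by simp
  qed (simp add: T_vadd[OF assms] T_vscale[OF assms])
  from this[of UNIV] show ?thesis by (simp add: basis_expansion)
qed

text \<open>Applying \<open>T \<xi>\<close> to the recursion for the components shows that the defect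
  \<open>T \<xi> (kernel_coeff w (Suc n)) - cdot w \<xi> * kernel_coeff w n\<close> satisfies a homogeneous equation to which the
  maximum principle applies.\<close>

lemma T_kernel_coeff_step:
  assumes f: "hpoly (Suc n) f" "\<And>z. T z f z = cdot w z * f1 z"
    and f1: "hpoly n f1" "\<And>\<xi> z. T \<xi> f1 z = cdot w \<xi> * f2 z"
  shows "T \<xi> f z = cdot w \<xi> * f1 z"
proof -
  let ?c = "\<lambda>\<alpha>. 2 / complex_of_real (\<alpha> \<bullet> \<alpha>)"
  note rf = hpoly_regular[OF f(1)] and ef = hpoly_entire[OF f(1)]
  have hT: "hpoly n (T \<eta> f)" for \<eta> using hpoly_T[OF f(1)] by simp
  have main: "complex_of_real (real (Suc n) + gam) * (T \<xi> f z - cdot w \<xi> * f1 z) =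
    (\<Sum>\<alpha>\<in>Rp. complex_of_real (k \<alpha>) * (T (creflection \<alpha> \<xi>) f (creflection \<alpha> z)
       - cdot w (creflection \<alpha> \<xi>) * f1 (creflection \<alpha> z)))" for \<xi> z
  proof -
    \<comment> \<open>The direction varies with the point. Expanding it in coordinates gives a sum
      of linear forms times functions, to which the commutation relation applies.\<close>
    have "T \<xi> (\<lambda>z. T z f z) z = T \<xi> (\<lambda>z. \<Sum>i\<in>UNIV. cdot (axis i 1) z * T (axis i 1) f z) z"
      using T_expand[OF ef] by simp
    also have "\<dots> = (\<Sum>i\<in>UNIV. T \<xi> (\<lambda>z. cdot (axis i 1) z * T (axis i 1) f z) z)"
      by (intro T_sum finite regular_cdot_mult hpoly_regular[OF hT])
    also have "\<dots> = (\<Sum>i\<in>UNIV. z $ i * T (axis i 1) (T \<xi> f) z + \<xi> $ i * T (axis i 1) f z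
      + (\<Sum>\<alpha>\<in>Rp. complex_of_real (k \<alpha>) * cdot (cvec \<alpha>) \<xi> * ?c \<alpha> *
           (cvec \<alpha> $ i * T (axis i 1) f (creflection \<alpha> z))))"
      by (intro sum.cong refl, subst T_cdot_mult[OF hpoly_regular[OF hT]])
        (simp add: T_commute[OF f(1), of \<xi>] mult.assoc)
    also have "\<dots> = T z (T \<xi> f) z + T \<xi> f z
      + (\<Sum>\<alpha>\<in>Rp. complex_of_real (k \<alpha>) * cdot (cvec \<alpha>) \<xi> * ?c \<alpha> * T (cvec \<alpha>) f (creflection \<alpha> z))"
      by (simp only: sum.distrib sum.swap[of _ Rp] sum_distrib_left[symmetric] T_expand[OF ef]
          T_expand[OF hpoly_entire[OF hT]])
    also have "T z (T \<xi> f) z = complex_of_real (real n + gam) * T \<xi> f z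
      - (\<Sum>\<alpha>\<in>Rp. complex_of_real (k \<alpha>) * T \<xi> f (creflection \<alpha> z))"
      by (rule T_radial_hpoly[OF hT])
    finally have L: "T \<xi> (\<lambda>z. T z f z) z = complex_of_real (real (Suc n) + gam) * T \<xi> f z
      - (\<Sum>\<alpha>\<in>Rp. complex_of_real (k \<alpha>) * T (creflection \<alpha> \<xi>) f (creflection \<alpha> z))"
      unfolding T_vcreflection[OF ef]
      by (simp add: sum_subtractf right_diff_distrib algebra_simps)
    have "T \<xi> (\<lambda>z. T z f z) z = T \<xi> (\<lambda>z. cdot w z * f1 z) z"
      using f(2) by simp
    also have "\<dots> = cdot w z * (cdot w \<xi> * f2 z) + cdot w \<xi> * f1 z
      + (\<Sum>\<alpha>\<in>Rp. complex_of_real (k \<alpha>) * cdot (cvec \<alpha>) \<xi> * (?c \<alpha> * cdot w (cvec \<alpha>)) * f1 (creflection \<alpha> z))"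
      by (simp only: T_cdot_mult[OF hpoly_regular[OF f1(1)]] f1(2))
    \<comment> \<open>The unknown \<open>f2\<close> is eliminated by reading the equation of
      \<open>f1\<close> backwards in the radial direction, where homogeneity makes the operator
      explicit.\<close>
    also have "cdot w z * (cdot w \<xi> * f2 z) = cdot w \<xi> * T z f1 z"
      using f1(2)[of z z] by simp
    also have "\<dots> = cdot w \<xi> * (complex_of_real (real n + gam) * f1 z
      - (\<Sum>\<alpha>\<in>Rp. complex_of_real (k \<alpha>) * f1 (creflection \<alpha> z)))"
      unfolding T_radial_hpoly[OF f1(1)] ..
    finally have Rr: "T \<xi> (\<lambda>z. T z f z) z = complex_of_real (real (Suc n) + gam) * (cdot w \<xi> * f1 z)
      - (\<Sum>\<alpha>\<in>Rp. complex_of_real (k \<alpha>) * (cdot w (creflection \<alpha> \<xi>) * f1 (creflection \<alpha> z)))"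
      by (simp add: creflection_alt[of _ \<xi>] cdot_linear sum_subtractf right_diff_distrib
          left_diff_distrib sum_distrib_left algebra_simps)
    show ?thesis using L Rr by (simp add: right_diff_distrib sum_subtractf algebra_simps)
  qed
  \<comment> \<open>The equation \<open>main\<close> reflects the direction together with the point,
    so the maximum principle runs over the orbit of the pair.\<close>
  let ?I = "(\<lambda>g. (g \<xi>, g z)) ` cgroup R"
  let ?D = "\<lambda>(\<xi>, z). T \<xi> f z - cdot w \<xi> * f1 z"
  have "norm (?D (\<xi>, z)) \<le> 0 / real (Suc n)"
  proof (rule norm_bound[where I = ?I and h = "\<lambda>_. 0" and s = "\<lambda>\<alpha> (\<xi>, z). (creflection \<alpha> \<xi>, creflection \<alpha> z)" and v = ?D])
    show "finite ?I" using finite_cgroup by simp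
    show "(\<xi>, z) \<in> ?I" by (rule image_eqI[of _ _ id]) (auto intro: cgroup.id)
    fix \<alpha> x assume a: "\<alpha> \<in> Rp" "x \<in> ?I"
    then obtain g where g: "g \<in> cgroup R" "x = (g \<xi>, g z)" by blast
    show "(case x of (\<xi>, z) \<Rightarrow> (creflection \<alpha> \<xi>, creflection \<alpha> z)) \<in> ?I"
      by (rule image_eqI[of _ _ "creflection \<alpha> \<circ> g"]) (use g a Rp_subset in \<open>auto intro: cgroup.step\<close>)
  next
    fix x
    show "complex_of_real (real (Suc n) + gam) * ?D x =
      (\<Sum>\<alpha>\<in>Rp. complex_of_real (k \<alpha>) * ?D (case x of (\<xi>, z) \<Rightarrow> (creflection \<alpha> \<xi>, creflection \<alpha> z))) + 0"
      by (cases x) (simp only: prod.case main add_0_right)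
  qed auto
  then show ?thesis by simp
qed

lemma T_kernel_coeff_Suc: "T \<xi> (kernel_coeff w (Suc n)) z = cdot w \<xi> * kernel_coeff w n z"
proof (induction n arbitrary: \<xi> z)
  have r: "T z (kernel_coeff w (Suc n)) z = cdot w z * kernel_coeff w n z" for n z
    unfolding T_radial_hpoly[OF hpoly_kernel_coeff] kernel_coeff_Suc by simp
  {
    case (0 \<xi> z)
    \<comment> \<open>The first component is constant, so its own predecessor is taken to be
      zero.\<close>
    show ?case
      by (rule T_kernel_coeff_step[OF hpoly_kernel_coeff r hpoly_kernel_coeff, of _ "\<lambda>z. 0"]) (simp add: T_const)
  next
    case (Suc n \<xi> z)
    show ?case
      by (rule T_kernel_coeff_step[OF hpoly_kernel_coeff r hpoly_kernel_coeff Suc])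
  }
qed

end

section \<open>Cauchy estimates for derivatives and difference quotients\<close>

lemma dirderiv_le:
  assumes "entire f" "\<And>s. norm s = 1 \<Longrightarrow> norm (f (z + s *s v)) \<le> B"
  shows "norm (dirderiv v f z) \<le> B"
proof -
  have "norm ((deriv ^^ 1) (\<lambda>s. f (z + s *s v)) 0) \<le> fact 1 * B / 1 ^ 1"
    by (rule Cauchy_inequality)
      (use assms in \<open>auto intro!: entire_along_holomorphic holomorphic_on_imp_continuous_on\<close>)
  then show ?thesis by (simp add: dirderiv_def)
qed

text \<open>Cauchy's estimate on the unit circle in the normalised direction; this is the origin of
  the shift by 1 in the later bounds.\<close>

lemma dirderiv_growth:
  assumes "entire f" "\<And>z. norm (f z) \<le> b (norm z)" "mono_on {0..} b"
  shows "norm (dirderiv v f z) \<le> norm v * b (norm z + 1)"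
proof (cases "v = 0")
  case True
  then show ?thesis by (simp add: dirderiv_def)
next
  case False
  define u where "u = complex_of_real (1 / norm v) *s v"
  have u: "norm u = 1" using False by (simp add: u_def norm_scale norm_divide)
  have v: "v = complex_of_real (norm v) *s u"
    using False by (simp add: u_def vec_eq_iff)
  have "norm (dirderiv u f z) \<le> b (norm z + 1)"
  proof (rule dirderiv_le[OF assms(1)])
    fix s :: complex assume "norm s = 1"
    then have "norm (z + s *s u) \<le> norm z + 1"
      using norm_triangle_ineq[of z "s *s u"] by (simp add: norm_scale u)
    then show "norm (f (z + s *s u)) \<le> b (norm z + 1)"
      by (intro order_trans[OF assms(2)] mono_onD[OF assms(3)]) auto
  qed
  then have "norm v * norm (dirderiv u f z) \<le> norm v * b (norm z + 1)"
    by (rule mult_left_mono) simp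
  then show ?thesis
    by (subst v) (simp add: dirderiv_scale[OF assms(1)] norm_mult)
qed

text \<open>The difference is bounded by the derivative along the segment from the point to its
  mirror image, which by convexity stays in the ball of radius \<open>norm z\<close>. The length of
  the segment is proportional to the root form and cancels the denominator, leaving the factor
  \<open>2 / norm \<alpha>\<close>. Continuity extends the bound to the hyperplane.\<close>

lemma dunkl_quotient_growth:
  fixes \<alpha> :: "real^'n"
  assumes f: "regular f" and b: "\<And>z. norm (f z) \<le> b (norm z)" "mono_on {0..} b" "continuous_on UNIV b"
    and \<alpha>: "\<alpha> \<noteq> 0"
  shows "norm (dunkl_quotient \<alpha> f z) \<le> 2 / norm \<alpha> * b (norm z + 1)"
proof -
  let ?S = "{y. cdot (cvec \<alpha>) y \<noteq> 0}"
  note e = regular_entire[OF f]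
  have off: "norm (dunkl_quotient \<alpha> f y) \<le> 2 / norm \<alpha> * b (norm y + 1)" if y: "y \<in> ?S" for y
  proof -
    define s0 where "s0 = - (2 / complex_of_real (\<alpha> \<bullet> \<alpha>) * cdot (cvec \<alpha>) y)"
    have refl: "creflection \<alpha> y = y + s0 *s cvec \<alpha>"
      by (simp add: creflection_alt s0_def vec_eq_iff)
    have "norm (f (y + s0 *s cvec \<alpha>) - f (y + 0 *s cvec \<alpha>)) \<le> norm \<alpha> * b (norm y + 1) * norm (s0 - 0)"
    proof (rule field_differentiable_bound[where S = "closed_segment 0 s0"])
      fix s assume "s \<in> closed_segment 0 s0"
      then obtain u where u: "0 \<le> u" "u \<le> 1" "s = complex_of_real u * s0"
        by (auto simp: in_segment scaleR_conv_of_real)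
      have "y + s *s cvec \<alpha> = (1 - u) *\<^sub>R y + u *\<^sub>R creflection \<alpha> y"
        unfolding scaleR_complex_vec refl by (simp add: vec_eq_iff u algebra_simps)
      then have "norm (y + s *s cvec \<alpha>) \<le> (1 - u) * norm y + u * norm (creflection \<alpha> y)"
        using u norm_triangle_ineq[of "(1 - u) *\<^sub>R y" "u *\<^sub>R creflection \<alpha> y"] by simp
      then have le: "norm (y + s *s cvec \<alpha>) \<le> norm y"
        by (simp add: norm_creflection[OF \<alpha>] algebra_simps)
      show "((\<lambda>s. f (y + s *s cvec \<alpha>)) has_field_derivative dirderiv (cvec \<alpha>) f (y + s *s cvec \<alpha>))
          (at s within closed_segment 0 s0)"
        by (rule has_field_derivative_at_within[OF entire_along[OF e]])
      have "norm (dirderiv (cvec \<alpha>) f (y + s *s cvec \<alpha>)) \<le> norm (cvec \<alpha>) * b (norm (y + s *s cvec \<alpha>) + 1)"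
        by (rule dirderiv_growth[OF e b(1,2)])
      also have "\<dots> \<le> norm \<alpha> * b (norm y + 1)"
        using le by (auto intro!: mult_left_mono mono_onD[OF b(2)])
      finally show "norm (dirderiv (cvec \<alpha>) f (y + s *s cvec \<alpha>)) \<le> norm \<alpha> * b (norm y + 1)" .
    qed auto
    then have "norm (f y - f (creflection \<alpha> y)) \<le> norm \<alpha> * b (norm y + 1) * norm s0"
      by (simp add: refl norm_minus_commute)
    also have "norm s0 = 2 / (norm \<alpha>)\<^sup>2 * norm (cdot (cvec \<alpha>) y)"
      by (simp add: s0_def norm_mult norm_divide dot_square_norm norm_power)
    finally have "norm (cdot (cvec \<alpha>) y) * norm (dunkl_quotient \<alpha> f y) \<le>
        norm (cdot (cvec \<alpha>) y) * (2 / norm \<alpha> * b (norm y + 1))"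
      using \<alpha> unfolding regular_quotient(2)[OF f \<alpha>] norm_mult by (simp add: power2_eq_square mult_ac)
    then show ?thesis by (rule mult_left_le_imp_le) (use y in simp)
  qed
  have t1: "((\<lambda>y. norm (dunkl_quotient \<alpha> f y)) \<longlongrightarrow> norm (dunkl_quotient \<alpha> f z)) (at z within ?S)"
    using regular_quotient(1)[OF f \<alpha>]
    by (intro tendsto_norm) (meson UNIV_I continuous_on tendsto_within_subset top_greatest)
  have t2: "((\<lambda>y. 2 / norm \<alpha> * b (norm y + 1)) \<longlongrightarrow> 2 / norm \<alpha> * b (norm z + 1)) (at z within ?S)"
  proof (intro tendsto_mult_left)
    have "continuous_on UNIV (\<lambda>y::complex^'n. b (norm y + 1))"
      by (rule continuous_on_compose2[OF b(3)]) (auto intro!: continuous_intros)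
    then show "((\<lambda>y. b (norm y + 1)) \<longlongrightarrow> b (norm z + 1)) (at z within ?S)"
      by (meson UNIV_I continuous_on tendsto_within_subset top_greatest)
  qed
  have nt: "at z within ?S \<noteq> bot"
    using hyperplane_complement_islimpt[OF \<alpha>] by (simp add: trivial_limit_within)
  have ev: "\<forall>\<^sub>F y in at z within ?S. norm (dunkl_quotient \<alpha> f y) \<le> 2 / norm \<alpha> * b (norm y + 1)"
    using off by (auto simp: eventually_at_filter)
  show ?thesis by (rule tendsto_le[OF nt t2 t1 ev])
qed

section \<open>Convergence of the kernel series and its Dunkl equation\<close>

context dunkl
begin

text \<open>Each application of \<open>norm_bound\<close> divides by the degree, which produces the
  factorial; on the orbit the norm in the source term is constant.\<close>

lemma norm_kernel_coeff: "norm (kernel_coeff w n z) \<le> (norm z * norm w) ^ n / fact n"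
proof (induction n arbitrary: z)
  case (Suc n z)
  let ?B = "norm z * norm w * ((norm z * norm w) ^ n / fact n)"
  have "norm (kernel_coeff w (Suc n) z) \<le> ?B / real (Suc n)"
  proof (rule norm_bound[where I = "orbit z" and s = creflection and h = "\<lambda>z. cdot w z * kernel_coeff w n z"])
    fix x assume x: "x \<in> orbit z"
    show "complex_of_real (real (Suc n) + gam) * kernel_coeff w (Suc n) x =
      (\<Sum>\<alpha>\<in>Rp. complex_of_real (k \<alpha>) * kernel_coeff w (Suc n) (creflection \<alpha> x)) + cdot w x * kernel_coeff w n x"
      by (rule kernel_coeff_Suc)
    have "norm (cdot w x) \<le> norm z * norm w"
      using norm_cdot_le[of w x] orbit_facts(4)[OF x] by (simp add: mult.commute)
    then show "norm (cdot w x * kernel_coeff w n x) \<le> ?B"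
      using Suc[of x] orbit_facts(4)[OF x] unfolding norm_mult by (intro mult_mono) auto
  qed (auto intro: orbit_facts)
  then show ?case by (simp add: mult_ac)
qed simp

text \<open>Continuity in the spectral parameter. It yields measurability of the kernel in the
  variable that is integrated over.\<close>

lemma continuous_kernel_coeff: "continuous_on UNIV (\<lambda>w. kernel_coeff w n z)"
proof (induction n arbitrary: z)
  case (Suc n)
  have "continuous_on UNIV (\<lambda>w. cdot w y)" for y :: "complex^'n"
    unfolding cdot_commute[of _ y] by (intro continuous_intros)
  then show ?case
    using Suc by (auto simp: resolvent_def intro!: continuous_intros)
qed simp

lemma exp_sums: "(\<lambda>n. x ^ n / fact n) sums exp (x::real)"
  using exp_converges[of x] by (simp add: divide_inverse mult.commute)

lemma summable_exp_terms: "summable (\<lambda>n. x ^ n / fact n :: real)"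
  using exp_sums sums_summable by blast

definition kernel_series :: "complex^'n \<Rightarrow> complex^'n \<Rightarrow> complex" where
  "kernel_series w z = (\<Sum>n. kernel_coeff w n z)"

lemma summable_norm_kernel_coeff: "summable (\<lambda>n. norm (kernel_coeff w n z))"
  by (rule summable_comparison_test'[OF summable_exp_terms[of "norm z * norm w"]])
    (simp add: norm_kernel_coeff)

lemma summable_kernel_coeff: "summable (\<lambda>n. kernel_coeff w n z)"
  by (rule summable_norm_cancel[OF summable_norm_kernel_coeff])

lemma kernel_series_sums: "(\<lambda>n. kernel_coeff w n z) sums kernel_series w z"
  unfolding kernel_series_def by (rule summable_sums[OF summable_kernel_coeff])

lemma norm_kernel_series_le: "norm (kernel_series w z) \<le> exp (norm z * norm w)"
proof -
  have "norm (kernel_series w z) \<le> (\<Sum>n. (norm z * norm w) ^ n / fact n)"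
    unfolding kernel_series_def
    by (intro norm_suminf_le norm_kernel_coeff summable_exp_terms)
  also have "\<dots> = exp (norm z * norm w)" by (rule sums_unique[OF exp_sums, symmetric])
  finally show ?thesis .
qed

lemma kernel_series_0: "kernel_series w 0 = 1"
proof -
  have "kernel_coeff w n 0 = (if n = 0 then 1 else 0)" for n
    using norm_kernel_coeff[of w n 0] by (cases n) auto
  then have "(\<lambda>n. kernel_coeff w n 0) sums 1"
    using sums_single[of 0 "\<lambda>_. 1::complex"] by simp
  then show ?thesis unfolding kernel_series_def by (rule sums_unique[symmetric])
qed

lemma mono_on_power_fact: "c \<ge> 0 \<Longrightarrow> mono_on {0..} (\<lambda>r::real. (r * c) ^ n / fact n)"
  by (intro mono_onI divide_right_mono power_mono mult_right_mono) auto

lemma dirderiv_kernel_coeff_le: "norm (dirderiv v (kernel_coeff w n) z) \<le> norm v * (((norm z + 1) * norm w) ^ n / fact n)"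
  by (rule dirderiv_growth[OF entire_kernel_coeff, of w n "\<lambda>r. (r * norm w) ^ n / fact n"])
    (auto intro: norm_kernel_coeff mono_on_power_fact)

lemma dunkl_quotient_kernel_coeff_le:
  assumes "\<alpha> \<noteq> 0"
  shows "norm (dunkl_quotient \<alpha> (kernel_coeff w n) z) \<le> 2 / norm \<alpha> * (((norm z + 1) * norm w) ^ n / fact n)"
  by (rule dunkl_quotient_growth[OF regular_kernel_coeff, of w n "\<lambda>r. (r * norm w) ^ n / fact n"])
    (use assms in \<open>auto intro: norm_kernel_coeff mono_on_power_fact intro!: continuous_intros\<close>)

lemma summable_dirderiv_kernel_coeff: "summable (\<lambda>n. dirderiv v (kernel_coeff w n) z)"
  by (rule summable_norm_cancel, rule summable_comparison_test'[OF
        summable_mult[OF summable_exp_terms[of "(norm z + 1) * norm w"], of "norm v"]])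
    (use dirderiv_kernel_coeff_le in simp)

lemma kernel_series_has_derivative: "(kernel_series w has_derivative (\<lambda>v. \<Sum>n. dirderiv v (kernel_coeff w n) z)) (at z)"
proof -
  define r where "r = norm z + 1"
  \<comment> \<open>The additional 1 is the radius lost in the Cauchy estimate; \<open>b\<close>
    dominates all derivatives on the ball relative to the direction, as termwise differentiation
    demands.\<close>
  define b where "b n = ((r + 1) * norm w) ^ n / fact n" for n
  let ?S = "ball 0 r :: (complex^'n) set"
  have z: "z \<in> ?S" by (simp add: r_def)
  have b: "summable b" unfolding b_def by (rule summable_exp_terms)
  have le: "norm (dirderiv v (kernel_coeff w n) x) \<le> norm v * b n" if "x \<in> ?S" for x v n
    using that unfolding b_def
    by (intro order_trans[OF dirderiv_kernel_coeff_le] mult_left_mono divide_right_mono power_mono mult_right_mono)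
      (auto simp: dist_norm)
  have unif: "\<forall>\<^sub>F n in sequentially. \<forall>x\<in>?S. \<forall>h.
      norm (sum (\<lambda>i. dirderiv h (kernel_coeff w i) x) {..<n} - (\<Sum>i. dirderiv h (kernel_coeff w i) x)) \<le> e * norm h"
    if "e > 0" for e
  proof -
    obtain N where N: "\<And>n. n \<ge> N \<Longrightarrow> norm (\<Sum>i. b (i + n)) < e"
      using suminf_exist_split[OF \<open>e > 0\<close> b] by blast
    show ?thesis
      unfolding eventually_sequentially
    proof (intro exI[of _ N] allI impI ballI)
      fix n x h assume n: "N \<le> n" and x: "x \<in> ?S"
      have "norm ((\<Sum>i. dirderiv h (kernel_coeff w i) x) - sum (\<lambda>i. dirderiv h (kernel_coeff w i) x) {..<n}) =
        norm (\<Sum>i. dirderiv h (kernel_coeff w (i + n)) x)"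
        by (subst suminf_minus_initial_segment[OF summable_dirderiv_kernel_coeff]) simp
      also have "\<dots> \<le> (\<Sum>i. norm h * b (i + n))"
        by (intro norm_suminf_le le x summable_mult summable_ignore_initial_segment b)
      also have "\<dots> = norm h * (\<Sum>i. b (i + n))"
        by (intro suminf_mult summable_ignore_initial_segment b)
      also have "\<dots> \<le> norm h * e"
        using N[OF n] by (intro mult_left_mono) auto
      finally show "norm (sum (\<lambda>i. dirderiv h (kernel_coeff w i) x) {..<n} - (\<Sum>i. dirderiv h (kernel_coeff w i) x)) \<le> e * norm h"
        by (simp add: norm_minus_commute mult.commute)
    qed
  qed
  have "\<exists>g. \<forall>x\<in>?S. (\<lambda>n. kernel_coeff w n x) sums g x \<and>
    (g has_derivative (\<lambda>v. \<Sum>n. dirderiv v (kernel_coeff w n) x)) (at x within ?S)"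
    by (rule has_derivative_series[OF convex_ball _ unif z kernel_series_sums])
      (auto intro: has_derivative_at_withinI entire_has_derivative entire_kernel_coeff)
  then obtain g where g: "\<And>x. x \<in> ?S \<Longrightarrow> (\<lambda>n. kernel_coeff w n x) sums g x"
    "(g has_derivative (\<lambda>v. \<Sum>n. dirderiv v (kernel_coeff w n) z)) (at z within ?S)" using z by blast
  have "kernel_series w x = g x" if "x \<in> ?S" for x
    using sums_unique2[OF kernel_series_sums g(1)[OF that]] .
  then have "(kernel_series w has_derivative (\<lambda>v. \<Sum>n. dirderiv v (kernel_coeff w n) z)) (at z within ?S)"
    by (intro has_derivative_transform[OF z _ g(2)]) auto
  then show ?thesis using z by (simp add: at_within_open[of z ?S])
qed

lemma dirderiv_kernel_coeff_scale: "(\<Sum>n. dirderiv (c *s v) (kernel_coeff w n) z) = c * (\<Sum>n. dirderiv v (kernel_coeff w n) z)"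
  by (simp add: dirderiv_scale[OF entire_kernel_coeff] suminf_mult[OF summable_dirderiv_kernel_coeff])

lemma entire_kernel_series: "entire (kernel_series w)"
  by (rule entireI[OF kernel_series_has_derivative dirderiv_kernel_coeff_scale])

lemma dirderiv_kernel_series: "dirderiv v (kernel_series w) z = (\<Sum>n. dirderiv v (kernel_coeff w n) z)"
  by (rule dirderiv_eq[OF kernel_series_has_derivative dirderiv_kernel_coeff_scale])

lemma dirderiv_kernel_series_le: "norm (dirderiv v (kernel_series w) z) \<le> norm v * exp ((norm z + 1) * norm w)"
  by (rule dirderiv_growth[OF entire_kernel_series, of w "\<lambda>r. exp (r * norm w)"])
    (auto intro!: norm_kernel_series_le mono_onI mult_right_mono)

text \<open>Exchanges the limit at the hyperplane with the series: by the Weierstrass test the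
  termwise sum is continuous, so it is the quotient everywhere.\<close>

lemma dunkl_quotient_kernel_series:
  assumes \<alpha>: "\<alpha> \<noteq> 0"
  shows "(\<lambda>n. dunkl_quotient \<alpha> (kernel_coeff w n) z) sums dunkl_quotient \<alpha> (kernel_series w) z"
proof -
  \<comment> \<open>Here only a local name for the sum of the quotients, unrelated to moments of the
    transition kernel.\<close>
  define moment_bound where "moment_bound z = (\<Sum>n. dunkl_quotient \<alpha> (kernel_coeff w n) z)" for z
  have s: "summable (\<lambda>n. dunkl_quotient \<alpha> (kernel_coeff w n) z)" for z
    by (rule summable_norm_cancel, rule summable_comparison_test'[OF
        summable_mult[OF summable_exp_terms[of "(norm z + 1) * norm w"], of "2 / norm \<alpha>"]])
      (use dunkl_quotient_kernel_coeff_le[OF \<alpha>] in simp)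
  have "continuous_on UNIV moment_bound"
  proof (rule continuous_at_imp_continuous_on, rule ballI)
    fix z :: "complex^'n"
    define r where "r = norm z + 1"
    let ?S = "ball 0 r :: (complex^'n) set"
    have "uniform_limit ?S (\<lambda>n x. \<Sum>i<n. dunkl_quotient \<alpha> (kernel_coeff w i) x) moment_bound sequentially"
      unfolding moment_bound_def
    proof (rule Weierstrass_m_test)
      show "summable (\<lambda>n. 2 / norm \<alpha> * (((r + 1) * norm w) ^ n / fact n))"
        by (intro summable_mult summable_exp_terms)
      show "norm (dunkl_quotient \<alpha> (kernel_coeff w n) x) \<le> 2 / norm \<alpha> * (((r + 1) * norm w) ^ n / fact n)"
        if "x \<in> ?S" for n x
        using that
        by (intro order_trans[OF dunkl_quotient_kernel_coeff_le[OF \<alpha>]] mult_left_mono divide_right_mono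
            power_mono mult_right_mono) (auto simp: dist_norm)
    qed
    then have "continuous_on ?S moment_bound"
      by (rule uniform_limit_theorem[rotated])
        (auto intro!: always_eventually continuous_on_sum continuous_on_subset[OF regular_quotient(1)[OF regular_kernel_coeff \<alpha>]])
    then show "isCont moment_bound z"
      by (rule continuous_on_interior) (simp add: r_def interior_open)
  qed
  moreover have "kernel_series w z - kernel_series w (creflection \<alpha> z) = cdot (cvec \<alpha>) z * moment_bound z" for z
  proof -
    have "(\<lambda>n. kernel_coeff w n z - kernel_coeff w n (creflection \<alpha> z)) sums (kernel_series w z - kernel_series w (creflection \<alpha> z))"
      by (intro sums_diff kernel_series_sums)
    moreover have "(\<lambda>n. cdot (cvec \<alpha>) z * dunkl_quotient \<alpha> (kernel_coeff w n) z) sums (cdot (cvec \<alpha>) z * moment_bound z)"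
      unfolding moment_bound_def by (intro sums_mult summable_sums s)
    ultimately show ?thesis
      unfolding regular_quotient(2)[OF regular_kernel_coeff \<alpha>] by (rule sums_unique2)
  qed
  ultimately have "dunkl_quotient \<alpha> (kernel_series w) z = moment_bound z"
    by (rule dunkl_quotient_eqI[OF \<alpha>])
  then show ?thesis unfolding moment_bound_def using summable_sums[OF s[of z]] by simp
qed

lemma T_kernel_series: "T \<xi> (kernel_series w) z = cdot \<xi> w * kernel_series w z"
proof -
  have "(\<lambda>n. T \<xi> (kernel_coeff w n) z) sums T \<xi> (kernel_series w) z"
    unfolding T_eq dirderiv_kernel_series
    by (intro sums_add sums_sum sums_mult dunkl_quotient_kernel_series pos_root_nz
        summable_sums summable_dirderiv_kernel_coeff)
  then have "(\<lambda>n. T \<xi> (kernel_coeff w (Suc n)) z) sums T \<xi> (kernel_series w) z"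
    by (subst sums_Suc_iff) (simp add: T_const)
  moreover have "(\<lambda>n. cdot w \<xi> * kernel_coeff w n z) sums (cdot w \<xi> * kernel_series w z)"
    by (intro sums_mult kernel_series_sums)
  ultimately show ?thesis
    unfolding T_kernel_coeff_Suc cdot_commute[of \<xi>] by (rule sums_unique2)
qed

text \<open>Uniqueness uses only the equation in the radial direction, whose Taylor coefficients along
  complex lines satisfy the recursion for the components.\<close>

lemma kernel_series_unique:
  assumes f: "entire f" "\<And>z. T z f z = cdot z w * f z" "f 0 = 1"
  shows "f = kernel_series w"
proof -
  define a where "a n z = (deriv ^^ n) (\<lambda>s. f (s *s z)) 0 / fact n" for n z
  have hol: "(\<lambda>s. f (s *s z)) holomorphic_on A" for z A
    using entire_along_holomorphic[OF f(1), of 0 z] by simp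
  have sums: "(\<lambda>n. a n z * s ^ n) sums f (s *s z)" for z s
    unfolding a_def
    using holomorphic_power_series[OF hol, of s 0 "norm s + 1"] by simp
  \<comment> \<open>The operator s d/ds multiplies the n-th Taylor coefficient by n; this replaces
    Euler's identity, since homogeneity of \<open>a n\<close> is not yet known.\<close>
  have dsums: "(\<lambda>n. of_nat n * a n z * s ^ n) sums (s * dirderiv z f (s *s z))" for z s
  proof -
    have d: "deriv (\<lambda>s. f (s *s z)) s = dirderiv z f (s *s z)" for s
      using entire_along[OF f(1), of 0 z s] by (simp add: DERIV_imp_deriv)
    have "(\<lambda>n. (deriv ^^ n) (deriv (\<lambda>s. f (s *s z))) 0 / fact n * s ^ n) sums deriv (\<lambda>s. f (s *s z)) s"
      using holomorphic_power_series[OF holomorphic_deriv[OF hol open_ball], of s 0 "norm s + 1" z] by simp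
    then have "(\<lambda>n. s * ((deriv ^^ n) (deriv (\<lambda>s. f (s *s z))) 0 / fact n * s ^ n)) sums (s * dirderiv z f (s *s z))"
      unfolding d by (rule sums_mult)
    moreover have "s * ((deriv ^^ n) (deriv (\<lambda>s. f (s *s z))) 0 / fact n * s ^ n) = of_nat (Suc n) * a (Suc n) z * s ^ Suc n" for n
    proof -
      have 1: "(deriv ^^ Suc n) (\<lambda>s. f (s *s z)) 0 = (deriv ^^ n) (deriv (\<lambda>s. f (s *s z))) 0"
        by (simp add: funpow_Suc_right del: funpow.simps)
      have 2: "complex_of_nat (Suc n) / fact (Suc n) = 1 / fact n"
        by (simp add: field_simps del: of_nat_Suc)
      have "of_nat (Suc n) * a (Suc n) z = (of_nat (Suc n) / fact (Suc n)) * (deriv ^^ Suc n) (\<lambda>s. f (s *s z)) 0"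
        by (simp add: a_def del: of_nat_Suc fact_Suc funpow.simps)
      then have "of_nat (Suc n) * a (Suc n) z = (deriv ^^ n) (deriv (\<lambda>s. f (s *s z))) 0 / fact n"
        unfolding 1 2 by simp
      then show ?thesis by simp
    qed
    ultimately show ?thesis
      using sums_Suc[of "\<lambda>n. of_nat n * a n z * s ^ n"] by simp
  qed
  have rec: "complex_of_real (real (Suc n) + gam) * a (Suc n) z =
    (\<Sum>\<alpha>\<in>Rp. complex_of_real (k \<alpha>) * a (Suc n) (creflection \<alpha> z)) + cdot w z * a n z" for n z
  proof -
    \<comment> \<open>The n-th Taylor coefficient in \<open>s\<close> of the difference between the
      two sides of the radial equation at the point \<open>s *s z\<close>.\<close>
    define c where "c n = of_nat n * a n z + (\<Sum>\<alpha>\<in>Rp. complex_of_real (k \<alpha>) * (a n z - a n (creflection \<alpha> z)))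
      - (if n = 0 then 0 else cdot w z * a (n - 1) z)" for n
    have "(\<lambda>n. c n * s ^ n) sums 0" for s
    proof -
      have sh: "(\<lambda>n. (if n = 0 then 0 else cdot w z * a (n - 1) z) * s ^ n) sums (s * cdot w z * f (s *s z))"
      proof -
        have "(\<lambda>n. s * cdot w z * (a n z * s ^ n)) sums (s * cdot w z * f (s *s z))"
          by (intro sums_mult sums)
        then show ?thesis
          using sums_Suc[of "\<lambda>n. (if n = 0 then 0 else cdot w z * a (n - 1) z) * s ^ n"]
          by (simp add: mult_ac)
      qed
      have "(\<lambda>n. of_nat n * a n z * s ^ n
          + (\<Sum>\<alpha>\<in>Rp. complex_of_real (k \<alpha>) * (a n z * s ^ n - a n (creflection \<alpha> z) * s ^ n))
          - (if n = 0 then 0 else cdot w z * a (n - 1) z) * s ^ n) sums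
        (s * dirderiv z f (s *s z)
          + (\<Sum>\<alpha>\<in>Rp. complex_of_real (k \<alpha>) * (f (s *s z) - f (s *s creflection \<alpha> z)))
          - s * cdot w z * f (s *s z))"
        by (intro sums_diff sums_add sums_sum sums_mult dsums sums sh)
      moreover have "s * dirderiv z f (s *s z)
          + (\<Sum>\<alpha>\<in>Rp. complex_of_real (k \<alpha>) * (f (s *s z) - f (s *s creflection \<alpha> z)))
          - s * cdot w z * f (s *s z) = 0"
        using f(2)[of "s *s z"] unfolding T_radial
        by (simp add: dirderiv_scale[OF f(1)] creflection_scale cdot_linear cdot_commute[of w])
      ultimately show ?thesis
        by (simp add: c_def distrib_right left_diff_distrib right_diff_distrib sum_distrib_right mult.assoc)
    qed
    then have "c (Suc n) = 0"
    proof (rule_tac ccontr)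
      assume s: "\<And>s. (\<lambda>n. c n * s ^ n) sums 0" and nz: "c (Suc n) \<noteq> 0"
      \<comment> \<open>A power series with a nonzero coefficient has no zero in some punctured
        disc, whereas this one vanishes identically.\<close>
      show False
      proof (rule powser_0_nonzero[of 1 0 c "\<lambda>_. 0" "Suc n"])
        fix r :: real assume r: "r > 0" "\<And>z::complex. z \<in> cball 0 r - {0} \<Longrightarrow> (0::complex) \<noteq> 0"
        have "complex_of_real r \<in> cball 0 r - {0}" using r(1) by simp
        from r(2)[OF this] show False by simp
      qed (use s nz in auto)
    qed
    then show ?thesis
      by (simp add: c_def right_diff_distrib sum_subtractf gam_def distrib_right
          sum_distrib_right[symmetric] algebra_simps)
  qed
  have "a n z = kernel_coeff w n z" for n z
  proof (induction n arbitrary: z)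
    case (Suc n z)
    have "norm (a (Suc n) z - kernel_coeff w (Suc n) z) \<le> 0 / real (Suc n)"
    proof (rule norm_bound[where I = "orbit z" and s = creflection and h = "\<lambda>_. 0" and
          v = "\<lambda>z. a (Suc n) z - kernel_coeff w (Suc n) z"])
      fix x
      show "complex_of_real (real (Suc n) + gam) * (a (Suc n) x - kernel_coeff w (Suc n) x) =
        (\<Sum>\<alpha>\<in>Rp. complex_of_real (k \<alpha>) * (a (Suc n) (creflection \<alpha> x) - kernel_coeff w (Suc n) (creflection \<alpha> x))) + 0"
        unfolding right_diff_distrib rec kernel_coeff_Suc Suc by (simp add: sum_subtractf)
    qed (auto intro: orbit_facts)
    then show ?case by simp
  qed (simp add: a_def f(3))
  then have "(\<lambda>n. kernel_coeff w n z) sums f z" for z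
    using sums[of z 1] by simp
  then show ?thesis
    using kernel_series_sums sums_unique2 by blast
qed

lemma dunkl_kernel_eq: "dunkl_kernel Rp k w = kernel_series w"
  unfolding dunkl_kernel_def
  by (rule the_equality) (auto simp: entire_kernel_series T_kernel_series kernel_series_0 intro!: kernel_series_unique)

end

section \<open>The Dunkl kernel at real arguments\<close>

context dunkl
begin

lemma dunkl_E_eq: "dunkl_E Rp k x y = Re (kernel_series (cvec y) (cvec x))"
  by (simp add: dunkl_E_def dunkl_kernel_eq)

lemma abs_dunkl_E_le: "\<bar>dunkl_E Rp k x y\<bar> \<le> exp (norm x * norm y)"
  using norm_kernel_series_le[of "cvec y" "cvec x"] abs_Re_le_cmod[of "kernel_series (cvec y) (cvec x)"]
  by (simp add: dunkl_E_eq)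

definition dunkl_E_dirderiv :: "real^'n \<Rightarrow> real^'n \<Rightarrow> real^'n \<Rightarrow> real" where
  "dunkl_E_dirderiv v x y = Re (dirderiv (cvec v) (kernel_series (cvec y)) (cvec x))"

lemma dunkl_E_has_derivative:
  "((\<lambda>s. dunkl_E Rp k (x + s *\<^sub>R v) y) has_real_derivative dunkl_E_dirderiv v (x + s *\<^sub>R v) y) (at s)"
proof -
  have "((\<lambda>s. kernel_series (cvec y) (cvec x + s *s cvec v)) has_field_derivative
     dirderiv (cvec v) (kernel_series (cvec y)) (cvec x + complex_of_real s *s cvec v)) (at (complex_of_real s))"
    by (rule entire_along[OF entire_kernel_series])
  from has_field_derivative_Re[OF has_vector_derivative_real_field[OF this]]
  show ?thesis by (simp add: dunkl_E_eq dunkl_E_dirderiv_def cvec_add cvec_scale o_def)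
qed

lemma abs_dunkl_E_dirderiv_le: "\<bar>dunkl_E_dirderiv v x y\<bar> \<le> norm v * exp ((norm x + 1) * norm y)"
  using dirderiv_kernel_series_le[of "cvec v" "cvec y" "cvec x"]
    abs_Re_le_cmod[of "dirderiv (cvec v) (kernel_series (cvec y)) (cvec x)"]
  by (simp add: dunkl_E_dirderiv_def)

text \<open>Taking real parts is compatible with the Dunkl equation, because at real points and
  directions all coefficients are real.\<close>

lemma dunkl_E_equation:
  assumes "\<And>\<alpha>. \<alpha> \<in> Rp \<Longrightarrow> \<alpha> \<bullet> x \<noteq> 0"
  shows "dunkl_E_dirderiv \<xi> x y + (\<Sum>\<alpha>\<in>Rp. k \<alpha> * (\<alpha> \<bullet> \<xi>) *
    ((dunkl_E Rp k x y - dunkl_E Rp k (reflection \<alpha> x) y) / (\<alpha> \<bullet> x))) = (\<xi> \<bullet> y) * dunkl_E Rp k x y"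
proof -
  have "Re (dunkl_quotient \<alpha> (kernel_series (cvec y)) (cvec x)) =
      (dunkl_E Rp k x y - dunkl_E Rp k (reflection \<alpha> x) y) / (\<alpha> \<bullet> x)" if "\<alpha> \<in> Rp" for \<alpha>
    using assms[OF that] by (simp add: dunkl_quotient_def cdot_cvec creflection_cvec dunkl_E_eq)
  then show ?thesis
    using arg_cong[OF T_kernel_series[of "cvec \<xi>" "cvec y" "cvec x"], of Re]
    by (simp add: T_eq cdot_cvec dunkl_E_dirderiv_def dunkl_E_eq flip: of_real_mult)
qed

lemma continuous_dunkl_E: "continuous_on UNIV (\<lambda>x. dunkl_E Rp k x y)"
proof -
  have "continuous_on UNIV (cvec :: real^'n \<Rightarrow> _)"
    unfolding cvec_def by (intro continuous_intros)
  then have "continuous_on UNIV (\<lambda>x. kernel_series (cvec y) (cvec x))"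
    by (intro continuous_on_compose2[OF entire_continuous[OF entire_kernel_series, of UNIV]]) auto
  then show ?thesis unfolding dunkl_E_eq by (intro continuous_intros)
qed

lemma borel_measurable_dunkl_E [measurable]:
  "(\<lambda>y. dunkl_E Rp k x y) \<in> borel_measurable borel"
proof -
  have "continuous_on UNIV (cvec :: real^'n \<Rightarrow> _)"
    unfolding cvec_def by (intro continuous_intros)
  then have "continuous_on UNIV (\<lambda>y. kernel_coeff (cvec y) n (cvec x))" for n
    by (intro continuous_on_compose2[OF continuous_kernel_coeff[of n "cvec x"]]) auto
  then have [measurable]: "(\<lambda>y. kernel_coeff (cvec y) n (cvec x)) \<in> borel_measurable borel" for n
    by (rule borel_measurable_continuous_onI)
  have "(\<lambda>y. kernel_series (cvec y) (cvec x)) \<in> borel_measurable borel"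
    unfolding kernel_series_def by measurable
  then show ?thesis unfolding dunkl_E_eq by measurable
qed

section \<open>Positivity and a Harnack inequality\<close>

lemma Re_kernel_coeff_Suc:
  "(real (Suc n) + gam) * Re (kernel_coeff (cvec y) (Suc n) (cvec x)) =
    (\<Sum>\<alpha>\<in>Rp. k \<alpha> * Re (kernel_coeff (cvec y) (Suc n) (cvec (reflection \<alpha> x)))) + (y \<bullet> x) * Re (kernel_coeff (cvec y) n (cvec x))"
  using arg_cong[OF kernel_coeff_Suc[of n "cvec y" "cvec x"], of Re]
  by (simp add: creflection_cvec cdot_cvec)

text \<open>Taylor components of \<open>exp c * E\<^sub>k(x, y)\<close>, where \<open>c\<close> is given degree one. Choosing
  \<open>c = norm x * norm y\<close> makes their recursion have nonnegative coefficients.\<close>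

definition tcoef :: "real \<Rightarrow> real^'n \<Rightarrow> nat \<Rightarrow> real^'n \<Rightarrow> real" where
  "tcoef c y n x = (\<Sum>j\<le>n. c ^ j / fact j * Re (kernel_coeff (cvec y) (n - j) (cvec x)))"

lemma tcoef_0 [simp]: "tcoef c y 0 x = 1"
  by (simp add: tcoef_def)

lemma tcoef_sums: "(\<lambda>n. tcoef c y n x) sums (exp c * dunkl_E Rp k x y)"
proof -
  have "(\<lambda>n. \<Sum>j\<le>n. c ^ j / fact j * Re (kernel_coeff (cvec y) (n - j) (cvec x))) sums
    ((\<Sum>j. c ^ j / fact j) * (\<Sum>n. Re (kernel_coeff (cvec y) n (cvec x))))"
  proof (rule Cauchy_product_sums)
    show "summable (\<lambda>j. norm (c ^ j / fact j))"
      using summable_exp_terms[of "\<bar>c\<bar>"] by (simp add: power_abs)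
    show "summable (\<lambda>n. norm (Re (kernel_coeff (cvec y) n (cvec x))))"
      by (rule summable_comparison_test'[OF summable_norm_kernel_coeff[of "cvec y" "cvec x"]])
        (simp add: abs_Re_le_cmod)
  qed
  moreover have "(\<Sum>j. c ^ j / fact j) = exp c"
    by (rule sums_unique[OF exp_sums, symmetric])
  moreover have "(\<Sum>n. Re (kernel_coeff (cvec y) n (cvec x))) = dunkl_E Rp k x y"
    using sums_Re[OF kernel_series_sums[of "cvec y" "cvec x"]] by (simp add: dunkl_E_eq sums_unique[symmetric])
  ultimately show ?thesis by (simp add: tcoef_def)
qed

text \<open>The degree n splits into n - j for the kernel component and j for the exponential. The
  first part obeys the recursion of the components; the second satisfies
  \<open>j * p j = c * p (j - 1)\<close> and adds \<open>c\<close> to the inner product.\<close>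

lemma tcoef_Suc:
  "(real (Suc n) + gam) * tcoef c y (Suc n) x =
    (\<Sum>\<alpha>\<in>Rp. k \<alpha> * tcoef c y (Suc n) (reflection \<alpha> x)) + (y \<bullet> x + c) * tcoef c y n x"
proof -
  define r where "r n x = Re (kernel_coeff (cvec y) n (cvec x))" for n x
  define p where "p j = c ^ j / fact j" for j
  have tc: "tcoef c y n x = (\<Sum>j\<le>n. p j * r (n - j) x)" for n x
    by (simp add: tcoef_def p_def r_def)
  have p: "real (Suc j) * p (Suc j) = c * p j" for j
    unfolding p_def by (simp add: field_simps del: of_nat_Suc)
  have r: "(real m + gam) * r m x - (\<Sum>\<alpha>\<in>Rp. k \<alpha> * r m (reflection \<alpha> x)) =
    (if m = 0 then 0 else (y \<bullet> x) * r (m - 1) x)" for m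
    using Re_kernel_coeff_Suc[of "m - 1" y x] by (cases m) (auto simp: r_def gam_def)
  have swap: "(\<Sum>\<alpha>\<in>Rp. k \<alpha> * tcoef c y (Suc n) (reflection \<alpha> x)) =
    (\<Sum>j\<le>Suc n. p j * (\<Sum>\<alpha>\<in>Rp. k \<alpha> * r (Suc n - j) (reflection \<alpha> x)))"
    unfolding tc sum_distrib_left by (subst sum.swap) (simp add: mult_ac)
  have "(real (Suc n) + gam) * tcoef c y (Suc n) x - (\<Sum>\<alpha>\<in>Rp. k \<alpha> * tcoef c y (Suc n) (reflection \<alpha> x)) =
    (\<Sum>j\<le>Suc n. p j * ((real (Suc n) + gam) * r (Suc n - j) x - (\<Sum>\<alpha>\<in>Rp. k \<alpha> * r (Suc n - j) (reflection \<alpha> x))))"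
    unfolding swap unfolding tc sum_distrib_left[of "real (Suc n) + gam"] sum_subtractf[symmetric]
    by (intro sum.cong refl) (simp add: right_diff_distrib)
  also have "\<dots> = (\<Sum>j\<le>Suc n. p j * (if Suc n - j = 0 then 0 else (y \<bullet> x) * r (Suc n - j - 1) x)
      + real j * p j * r (Suc n - j) x)"
  proof (intro sum.cong refl)
    fix j assume "j \<in> {..Suc n}"
    then have "real (Suc n) = real (Suc n - j) + real j" by (simp add: of_nat_diff)
    then have "(real (Suc n) + gam) * r (Suc n - j) x - (\<Sum>\<alpha>\<in>Rp. k \<alpha> * r (Suc n - j) (reflection \<alpha> x)) =
      (if Suc n - j = 0 then 0 else (y \<bullet> x) * r (Suc n - j - 1) x) + real j * r (Suc n - j) x"
      unfolding r[symmetric] by (simp only: distrib_right)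
    then show "p j * ((real (Suc n) + gam) * r (Suc n - j) x - (\<Sum>\<alpha>\<in>Rp. k \<alpha> * r (Suc n - j) (reflection \<alpha> x))) =
      p j * (if Suc n - j = 0 then 0 else (y \<bullet> x) * r (Suc n - j - 1) x) + real j * p j * r (Suc n - j) x"
      by (simp only: distrib_left mult_ac)
  qed
  also have "\<dots> = (\<Sum>j\<le>Suc n. p j * (if Suc n - j = 0 then 0 else (y \<bullet> x) * r (Suc n - j - 1) x))
      + (\<Sum>j\<le>Suc n. real j * p j * r (Suc n - j) x)"
    by (rule sum.distrib)
  also have "(\<Sum>j\<le>Suc n. p j * (if Suc n - j = 0 then 0 else (y \<bullet> x) * r (Suc n - j - 1) x)) =
    (\<Sum>j\<le>n. p j * ((y \<bullet> x) * r (n - j) x))"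
    by (simp add: Suc_diff_le)
  also have "\<dots> = (y \<bullet> x) * tcoef c y n x"
    by (simp add: tc sum_distrib_left mult_ac)
  also have "(\<Sum>j\<le>Suc n. real j * p j * r (Suc n - j) x) = (\<Sum>j\<le>n. c * p j * r (n - j) x)"
    unfolding sum.atMost_Suc_shift p by simp
  also have "\<dots> = c * tcoef c y n x"
    by (simp add: tc sum_distrib_left mult_ac)
  finally show ?thesis by (simp add: algebra_simps)
qed

context
  fixes x y :: "real^'n"
begin

text \<open>The norm is constant on the orbit, so Cauchy-Schwarz places the factor of the recursion
  between 0 and 2c for one common c, with lower bound used for positivity and upper bound for
  growth.\<close>

lemma real_orbit:
  defines "I \<equiv> (\<lambda>g. g x) ` reflection_group R"
  shows "finite I" "x \<in> I" "\<alpha> \<in> Rp \<Longrightarrow> z \<in> I \<Longrightarrow> reflection \<alpha> z \<in> I"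
    and "z \<in> I \<Longrightarrow> 0 \<le> y \<bullet> z + norm x * norm y \<and> y \<bullet> z + norm x * norm y \<le> 2 * (norm x * norm y)"
proof -
  show "finite I" unfolding I_def using finite_reflection_group[OF root] by simp
  show "x \<in> I" unfolding I_def by (rule image_eqI[of _ _ id]) (auto intro: reflection_group.intros)
  show "reflection \<alpha> z \<in> I" if a: "\<alpha> \<in> Rp" "z \<in> I"
  proof -
    obtain g where g: "g \<in> reflection_group R" "z = g x"
      using a(2) unfolding I_def by (rule imageE)
    show ?thesis unfolding I_def
      by (rule image_eqI[of _ _ "reflection \<alpha> \<circ> g"])
        (use g a Rp_subset in \<open>auto intro: reflection_group.intros\<close>)
  qed
  show "0 \<le> y \<bullet> z + norm x * norm y \<and> y \<bullet> z + norm x * norm y \<le> 2 * (norm x * norm y)" if "z \<in> I"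
  proof -
    have "norm z = norm x" using that norm_reflection_group[OF _ root] unfolding I_def by auto
    then show ?thesis using Cauchy_Schwarz_ineq2[of y z] by (simp add: mult.commute abs_le_iff)
  qed
qed

text \<open>Induction on the degree: the source term of the recursion is nonnegative on the whole
  orbit, so the maximum principle passes the sign to the next degree.\<close>

lemma tcoef_nonneg:
  defines "c \<equiv> norm x * norm y"
  shows "z \<in> (\<lambda>g. g x) ` reflection_group R \<Longrightarrow> 0 \<le> tcoef c y n z"
proof (induction n arbitrary: z)
  case (Suc n z)
  show ?case
  proof (rule max_principle[OF real_orbit(1) Suc.prems _ real_orbit(3), where m = "real (Suc n)" and v = "tcoef c y (Suc n)"])
    fix z assume z: "z \<in> (\<lambda>g. g x) ` reflection_group R"
    have "0 \<le> (y \<bullet> z + c) * tcoef c y n z"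
      using real_orbit(4)[OF z] Suc.IH[OF z] by (simp add: c_def)
    then show "(\<Sum>\<alpha>\<in>Rp. k \<alpha> * tcoef c y (Suc n) (reflection \<alpha> z)) \<le> (real (Suc n) + gam) * tcoef c y (Suc n) z"
      unfolding tcoef_Suc by simp
  qed auto
qed simp

text \<open>The comparison sequence is the Taylor series of exp(2c), for which equality holds. The
  defect satisfies a recursion of the same type with a nonnegative source.\<close>

lemma tcoef_growth:
  defines "c \<equiv> norm x * norm y"
  shows "z \<in> (\<lambda>g. g x) ` reflection_group R \<Longrightarrow> real (Suc n) * tcoef c y (Suc n) z \<le> 2 * c * tcoef c y n z"
proof (induction n arbitrary: z)
  case (0 z)
  have "0 \<le> 2 * c * tcoef c y 0 z - real (Suc 0) * tcoef c y (Suc 0) z"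
  proof (rule max_principle[OF real_orbit(1) 0 _ real_orbit(3), where m = 1 and
        v = "\<lambda>z. 2 * c * tcoef c y 0 z - real (Suc 0) * tcoef c y (Suc 0) z"])
    fix z assume z: "z \<in> (\<lambda>g. g x) ` reflection_group R"
    have "y \<bullet> z + c \<le> 2 * c"
      using real_orbit(4)[OF z] by (simp add: c_def)
    moreover have "(\<Sum>\<alpha>\<in>Rp. k \<alpha> * (2 * c * tcoef c y 0 (reflection \<alpha> z) - real (Suc 0) * tcoef c y (Suc 0) (reflection \<alpha> z)))
      = gam * (2 * c) - (\<Sum>\<alpha>\<in>Rp. k \<alpha> * tcoef c y (Suc 0) (reflection \<alpha> z))"
      by (simp add: right_diff_distrib sum_subtractf sum_distrib_right gam_def)
    ultimately show "(\<Sum>\<alpha>\<in>Rp. k \<alpha> * (2 * c * tcoef c y 0 (reflection \<alpha> z) - real (Suc 0) * tcoef c y (Suc 0) (reflection \<alpha> z)))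
      \<le> (1 + gam) * (2 * c * tcoef c y 0 z - real (Suc 0) * tcoef c y (Suc 0) z)"
      using tcoef_Suc[of 0 c y z] by (simp add: algebra_simps)
  qed auto
  then show ?case by simp
next
  case (Suc n z)
  let ?D = "\<lambda>z. 2 * c * tcoef c y (Suc n) z - real (Suc (Suc n)) * tcoef c y (Suc (Suc n)) z"
  have "0 \<le> ?D z"
  proof (rule max_principle[OF real_orbit(1) Suc.prems _ real_orbit(3), where m = "real (Suc (Suc n))" and v = ?D])
    fix z assume z: "z \<in> (\<lambda>g. g x) ` reflection_group R"
    define q where "q = y \<bullet> z + c"
    define b where "b n z = tcoef c y n z" for n z
    define S where "S n = (\<Sum>\<alpha>\<in>Rp. k \<alpha> * b n (reflection \<alpha> z))" for n
    have 1: "(real (Suc n) + gam) * b (Suc n) z = S (Suc n) + q * b n z"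
      and 2: "(real (Suc (Suc n)) + gam) * b (Suc (Suc n)) z = S (Suc (Suc n)) + q * b (Suc n) z"
      unfolding b_def S_def q_def by (rule tcoef_Suc)+
    \<comment> \<open>The source for the defect of the next degree: \<open>q\<close> times the
      previous defect, plus a remainder that is nonnegative because \<open>q\<close> is at most
      2c.\<close>
    have "0 \<le> q * (2 * c * b n z - real (Suc n) * b (Suc n) z) + (2 * c - q) * b (Suc n) z"
      using real_orbit(4)[OF z] Suc.IH[OF z] tcoef_nonneg[OF z, of "Suc n"]
      by (intro add_nonneg_nonneg mult_nonneg_nonneg) (auto simp: b_def q_def c_def)
    also have "\<dots> = (real (Suc (Suc n)) + gam) * (2 * c * b (Suc n) z - real (Suc (Suc n)) * b (Suc (Suc n)) z)
      - (2 * c * S (Suc n) - real (Suc (Suc n)) * S (Suc (Suc n)))"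
    proof -
      have "(real (Suc (Suc n)) + gam) * (2 * c * b (Suc n) z - real (Suc (Suc n)) * b (Suc (Suc n)) z) =
        2 * c * ((real (Suc n) + gam) * b (Suc n) z) + 2 * c * b (Suc n) z
        - real (Suc (Suc n)) * ((real (Suc (Suc n)) + gam) * b (Suc (Suc n)) z)"
        by (simp add: algebra_simps)
      then show ?thesis unfolding 1 2 by (simp add: algebra_simps)
    qed
    also have "2 * c * S (Suc n) - real (Suc (Suc n)) * S (Suc (Suc n)) =
      (\<Sum>\<alpha>\<in>Rp. k \<alpha> * (2 * c * b (Suc n) (reflection \<alpha> z) - real (Suc (Suc n)) * b (Suc (Suc n)) (reflection \<alpha> z)))"
      by (simp add: S_def sum_distrib_left right_diff_distrib sum_subtractf mult_ac del: of_nat_Suc)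
    finally show "(\<Sum>\<alpha>\<in>Rp. k \<alpha> * ?D (reflection \<alpha> z)) \<le> (real (Suc (Suc n)) + gam) * ?D z"
      by (simp only: b_def)
  qed auto
  then show ?case by simp
qed

text \<open>The component of degree 0 is 1 and the others are nonnegative, so the kernel is at least
  exp(-|x||y|).\<close>

lemma dunkl_E_pos: "0 < dunkl_E Rp k x y"
proof -
  let ?c = "norm x * norm y"
  have "1 \<le> exp ?c * dunkl_E Rp k x y"
  proof (rule sums_le[OF _ sums_single[of 0 "\<lambda>_. 1"] tcoef_sums])
    show "(if n = 0 then 1 else 0) \<le> tcoef ?c y n x" for n
      using tcoef_nonneg[OF real_orbit(2), of n] by simp
  qed
  then have "0 < exp ?c * dunkl_E Rp k x y" by linarith
  then show ?thesis by (simp add: zero_less_mult_iff)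
qed

text \<open>Summed from a bound in each degree: the recursion expresses the reflected components by
  (n + \<gamma>) times the component minus a nonnegative term, and \<open>tcoef_growth\<close>
  trades the factor n for 2c and one lower degree. Linear growth of the constant in
  \<open>norm x\<close> is what later keeps second moments quadratic.\<close>

lemma dunkl_E_harnack:
  "(\<Sum>\<alpha>\<in>Rp. k \<alpha> * dunkl_E Rp k (reflection \<alpha> x) y) \<le> (2 * (norm x * norm y) + gam) * dunkl_E Rp k x y"
proof -
  define c where "c = norm x * norm y"
  define b where "b = tcoef c y"
  note orb = real_orbit(2)
  have nn: "0 \<le> b n x" for n
    using tcoef_nonneg[OF orb] by (simp add: b_def c_def)
  let ?G = "\<lambda>n. (if n = 0 then 0 else 2 * c * b (n - 1) x) + gam * b n x"
  have s: "(\<lambda>n. b n z) sums (exp c * dunkl_E Rp k z y)" for z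
    unfolding b_def by (rule tcoef_sums)
  have "(\<lambda>n. if n = 0 then 0 else 2 * c * b (n - 1) x) sums (2 * c * (exp c * dunkl_E Rp k x y))"
    using sums_Suc[of "\<lambda>n. if n = 0 then 0 else 2 * c * b (n - 1) x"] sums_mult[OF s, of "2 * c" x] by simp
  then have G: "?G sums (2 * c * (exp c * dunkl_E Rp k x y) + gam * (exp c * dunkl_E Rp k x y))"
    by (intro sums_add sums_mult s)
  have F: "(\<lambda>n. \<Sum>\<alpha>\<in>Rp. k \<alpha> * b n (reflection \<alpha> x)) sums (\<Sum>\<alpha>\<in>Rp. k \<alpha> * (exp c * dunkl_E Rp k (reflection \<alpha> x) y))"
    by (intro sums_sum sums_mult s)
  have "(\<Sum>\<alpha>\<in>Rp. k \<alpha> * b n (reflection \<alpha> x)) \<le> ?G n" for n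
  proof (cases n)
    case 0
    then show ?thesis by (simp add: b_def gam_def)
  next
    case (Suc m)
    have "(\<Sum>\<alpha>\<in>Rp. k \<alpha> * b n (reflection \<alpha> x)) = (real n + gam) * b n x - (y \<bullet> x + c) * b m x"
      unfolding Suc b_def tcoef_Suc by simp
    moreover have "real n * b n x \<le> 2 * c * b m x"
      using tcoef_growth[OF orb, of m] by (simp add: Suc b_def c_def)
    moreover have "0 \<le> (y \<bullet> x + c) * b m x"
      using real_orbit(4)[OF orb] nn by (simp add: c_def)
    ultimately show ?thesis by (simp add: Suc distrib_right)
  qed
  from sums_le[OF this F G]
  have "exp c * (\<Sum>\<alpha>\<in>Rp. k \<alpha> * dunkl_E Rp k (reflection \<alpha> x) y) \<le> exp c * ((2 * c + gam) * dunkl_E Rp k x y)"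
    by (simp add: sum_distrib_left algebra_simps)
  then show ?thesis by (simp add: c_def)
qed

end

end

section \<open>Gaussian integrals against the Dunkl kernel\<close>

lemma integrable_gaussian:
  fixes a :: real
  assumes a: "a > 0"
  shows "integrable lborel (\<lambda>y::'a::euclidean_space. exp (- a * (norm y)\<^sup>2))"
proof (rule integrableI_bounded)
  define g where "g u = ennreal (exp (- a * u\<^sup>2))" for u :: real
  have "(\<integral>\<^sup>+(y::'a). ennreal (norm (exp (- a * (norm y)\<^sup>2))) \<partial>lborel) =
    (\<integral>\<^sup>+(y::'a). (\<Prod>b\<in>Basis. g (y \<bullet> b)) \<partial>lborel)"
  proof (intro nn_integral_cong)
    fix y :: 'a
    have "(norm y)\<^sup>2 = (\<Sum>b\<in>Basis. (y \<bullet> b)\<^sup>2)"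
      unfolding power2_norm_eq_inner by (subst euclidean_inner) (simp add: power2_eq_square)
    then have "exp (- a * (norm y)\<^sup>2) = (\<Prod>b\<in>Basis. exp (- a * (y \<bullet> b)\<^sup>2))"
      by (simp add: exp_sum sum_distrib_left sum_negf[symmetric])
    then show "ennreal (norm (exp (- a * (norm y)\<^sup>2))) = (\<Prod>b\<in>Basis. g (y \<bullet> b))"
      by (simp add: g_def prod_ennreal abs_of_nonneg prod_nonneg)
  qed
  also have "\<dots> = (\<Prod>b\<in>(Basis::'a set). (\<integral>\<^sup>+u. g u \<partial>lborel))"
    by (rule nn_integral_lborel_prod) (auto simp: g_def)
  also have "\<dots> < \<infinity>"
  proof -
    define \<sigma> where "\<sigma> = sqrt (1 / (2 * a))"
    have \<sigma>: "\<sigma> > 0" "\<sigma>\<^sup>2 = 1 / (2 * a)" using a by (auto simp: \<sigma>_def)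
    have "integrable lborel (\<lambda>u. sqrt (2 * pi * \<sigma>\<^sup>2) * normal_density 0 \<sigma> u)"
      using \<sigma> by (intro integrable_mult_right integrable_normal_density)
    then have "integrable lborel (\<lambda>u::real. exp (- a * u\<^sup>2))"
      using a by (simp add: normal_density_def \<sigma>(2) mult.commute)
    then have "(\<integral>\<^sup>+u. g u \<partial>lborel) < \<infinity>"
      by (auto simp: integrable_iff_bounded g_def)
    then show ?thesis by (simp add: power_less_top_ennreal)
  qed
  finally show "(\<integral>\<^sup>+(y::'a). ennreal (norm (exp (- a * (norm y)\<^sup>2))) \<partial>lborel) < \<infinity>" .
qed measurable

text \<open>Completing the square lets half of the quadratic exponent absorb the linear one.\<close>

lemma integrable_exp_gaussian:
  fixes a c :: real
  assumes a: "a > 0"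
  shows "integrable lborel (\<lambda>y::'a::euclidean_space. exp (c * norm y) * exp (- a * (norm y)\<^sup>2))"
proof (rule Bochner_Integration.integrable_bound)
  show "integrable lborel (\<lambda>y::'a. exp (c\<^sup>2 / (2 * a)) * exp (- (a / 2) * (norm y)\<^sup>2))"
    using a by (intro integrable_mult_right integrable_gaussian) simp
  have "c * r + (- a * r\<^sup>2) \<le> c\<^sup>2 / (2 * a) + (- (a / 2) * r\<^sup>2)" for r
  proof -
    have "0 \<le> (a / 2) * (r - c / a)\<^sup>2" using a by simp
    also have "\<dots> = c\<^sup>2 / (2 * a) + (a / 2) * r\<^sup>2 - c * r"
      using a by (simp add: power2_eq_square field_simps)
    finally show ?thesis by simp
  qed
  then show "AE y::'a in lborel. norm (exp (c * norm y) * exp (- a * (norm y)\<^sup>2)) \<le>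
      norm (exp (c\<^sup>2 / (2 * a)) * exp (- (a / 2) * (norm y)\<^sup>2))"
    by (simp add: mult_exp_exp del: exp_le_cancel_iff) (simp add: exp_le_cancel_iff)
qed measurable

lemma le_exp: "x \<le> exp x" for x :: real
  using exp_ge_add_one_self[of x] by linarith

text \<open>A class stable under multiplication by functions of at most exponential growth, hence by
  the kernel and by all moment factors; it also supplies the majorants for dominated
  convergence.\<close>

definition rapid :: "('a::euclidean_space \<Rightarrow> real) \<Rightarrow> bool" where
  "rapid H \<longleftrightarrow> H \<in> borel_measurable borel \<and> (\<forall>c. integrable lborel (\<lambda>y. exp (c * norm y) * H y))"

lemma rapid_measurable [measurable_dest]: "rapid H \<Longrightarrow> H \<in> borel_measurable borel"
  by (simp add: rapid_def)

lemma rapid_bound: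
  assumes H: "rapid H" and [measurable]: "f \<in> borel_measurable borel"
    and le: "\<And>y. \<bar>f y\<bar> \<le> A * exp (c * norm y)"
  shows "integrable lborel (\<lambda>y. f y * H y)"
proof (rule Bochner_Integration.integrable_bound)
  show "integrable lborel (\<lambda>y. A * (exp (c * norm y) * H y))"
    using H by (auto simp: rapid_def)
  show "AE y in lborel. norm (f y * H y) \<le> norm (A * (exp (c * norm y) * H y))"
  proof (rule AE_I2)
    fix y
    have "\<bar>f y\<bar> * \<bar>H y\<bar> \<le> \<bar>A * exp (c * norm y)\<bar> * \<bar>H y\<bar>"
      using le[of y] by (intro mult_right_mono) auto
    then show "norm (f y * H y) \<le> norm (A * (exp (c * norm y) * H y))"
      by (simp add: abs_mult mult.assoc)
  qed
  show "(\<lambda>y. f y * H y) \<in> borel_measurable lborel"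
    using H by measurable
qed

lemma rapid_mult:
  assumes H: "rapid H" and f[measurable]: "f \<in> borel_measurable borel"
    and le: "\<And>y. \<bar>f y\<bar> \<le> A * exp (c * norm y)"
  shows "rapid (\<lambda>y. f y * H y)"
  unfolding rapid_def
proof (intro conjI allI)
  show "(\<lambda>y. f y * H y) \<in> borel_measurable borel" using H by measurable
  fix d
  have "integrable lborel (\<lambda>y. (exp (d * norm y) * f y) * H y)"
  proof (rule rapid_bound[OF H])
    show "\<bar>exp (d * norm y) * f y\<bar> \<le> A * exp ((c + d) * norm y)" for y
    proof -
      have "exp (d * norm y) * \<bar>f y\<bar> \<le> exp (d * norm y) * (A * exp (c * norm y))"
        by (intro mult_left_mono le) simp
      also have "\<dots> = A * exp ((c + d) * norm y)"
        by (simp add: distrib_right exp_add)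
      finally show ?thesis by (simp add: abs_mult)
    qed
  qed measurable
  then show "integrable lborel (\<lambda>y. exp (d * norm y) * (f y * H y))"
    by (simp add: mult.assoc)
qed

lemma rapid_inner:
  assumes "rapid H"
  shows "rapid (\<lambda>y. (y \<bullet> \<xi>) * H y)"
proof (rule rapid_mult[OF assms])
  have "\<bar>y \<bullet> \<xi>\<bar> \<le> norm \<xi> * norm y" for y
    using Cauchy_Schwarz_ineq2[of y \<xi>] by (simp add: mult.commute)
  also have "norm \<xi> * norm y \<le> norm \<xi> * exp (1 * norm y)" for y :: 'a
    by (intro mult_left_mono) (simp_all add: le_exp)
  finally show "\<bar>y \<bullet> \<xi>\<bar> \<le> norm \<xi> * exp (1 * norm y)" for y .
qed measurable

section \<open>The integral transform behind the transition kernel\<close>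

context dunkl
begin

abbreviation "E \<equiv> dunkl_E Rp k"
abbreviation "wt \<equiv> dunkl_weight Rp k"

lemma weight_nonneg: "0 \<le> wt y"
  unfolding dunkl_weight_def by (intro prod_nonneg) auto

lemma weight_measurable [measurable]: "wt \<in> borel_measurable borel"
  unfolding dunkl_weight_def[abs_def] by measurable

lemma weight_le: "wt y \<le> exp ((\<Sum>\<alpha>\<in>Rp. 2 * k \<alpha> * norm \<alpha>) * norm y)"
proof -
  have "wt y \<le> (\<Prod>\<alpha>\<in>Rp. exp (2 * k \<alpha> * norm \<alpha> * norm y))"
    unfolding dunkl_weight_def
  proof (intro prod_mono conjI)
    fix \<alpha> assume a: "\<alpha> \<in> Rp"
    have kn: "0 \<le> k \<alpha>" using a by (rule k_pos_nonneg)
    show "(if k \<alpha> = 0 then 1 else \<bar>\<alpha> \<bullet> y\<bar> powr (2 * k \<alpha>)) \<le> exp (2 * k \<alpha> * norm \<alpha> * norm y)"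
    proof (cases "k \<alpha> = 0 \<or> \<alpha> \<bullet> y = 0")
      case False
      have "ln \<bar>\<alpha> \<bullet> y\<bar> \<le> \<bar>\<alpha> \<bullet> y\<bar>" using False ln_bound[of "\<bar>\<alpha> \<bullet> y\<bar>"] by simp
      also have "\<dots> \<le> norm \<alpha> * norm y" by (rule Cauchy_Schwarz_ineq2)
      finally have "2 * k \<alpha> * ln \<bar>\<alpha> \<bullet> y\<bar> \<le> 2 * k \<alpha> * (norm \<alpha> * norm y)"
        using kn by (intro mult_left_mono) auto
      then show ?thesis using False by (simp add: powr_def mult.assoc)
    qed auto
  qed auto
  also have "\<dots> = exp ((\<Sum>\<alpha>\<in>Rp. 2 * k \<alpha> * norm \<alpha>) * norm y)"
    by (simp add: exp_sum[OF finite_Rp] sum_distrib_right)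
  finally show ?thesis .
qed

text \<open>The function H of the overview: what remains of the density after removing constants,
  factors in the starting point alone, and the kernel coupling both points.\<close>

definition gauss_weight :: "real \<Rightarrow> real^'n \<Rightarrow> real^'n \<Rightarrow> real" where
  "gauss_weight t lam y = exp (- (norm y)\<^sup>2 / (2 * t)) * E y lam * wt y"

lemma gauss_weight_nonneg: "0 \<le> gauss_weight t lam y"
  unfolding gauss_weight_def using dunkl_E_pos[of y lam] weight_nonneg[of y] by simp

lemma rapid_gauss_weight:
  assumes t: "t > 0"
  shows "rapid (gauss_weight t lam)"
proof -
  have "rapid (\<lambda>y::real^'n. exp (- (1 / (2 * t)) * (norm y)\<^sup>2))"
    unfolding rapid_def using t by (intro conjI allI integrable_exp_gaussian) auto
  then have 1: "rapid (\<lambda>y. wt y * exp (- (1 / (2 * t)) * (norm y)\<^sup>2))"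
    by (rule rapid_mult[where A = 1]) (use weight_le weight_nonneg in auto)
  have [measurable]: "(\<lambda>y. E y lam) \<in> borel_measurable borel"
    by (rule borel_measurable_continuous_onI[OF continuous_dunkl_E])
  have "rapid (\<lambda>y. E y lam * (wt y * exp (- (1 / (2 * t)) * (norm y)\<^sup>2)))"
    by (rule rapid_mult[OF 1, where A = 1 and c = "norm lam"]) (use abs_dunkl_E_le[of _ lam] in \<open>auto simp: mult.commute\<close>)
  then show ?thesis by (simp add: gauss_weight_def[abs_def] mult_ac)
qed

definition scaled_E :: "real \<Rightarrow> real^'n \<Rightarrow> real^'n \<Rightarrow> real" where
  "scaled_E t x y = E (x /\<^sub>R sqrt t) (y /\<^sub>R sqrt t)"

text \<open>Up to scaling, the Dunkl analogue of the Laplace transform of \<open>H\<close>.\<close>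

definition K :: "real \<Rightarrow> (real^'n \<Rightarrow> real) \<Rightarrow> real^'n \<Rightarrow> real" where
  "K t H x = (\<integral>y. scaled_E t x y * H y \<partial>lborel)"

lemma scaled_E_pos: "0 < scaled_E t x y"
  unfolding scaled_E_def by (rule dunkl_E_pos)

lemma scaled_E_measurable [measurable]: "scaled_E t x \<in> borel_measurable borel"
  unfolding scaled_E_def[abs_def] by measurable

lemma scaled_E_le:
  assumes "t > 0" "norm x \<le> B"
  shows "\<bar>scaled_E t x y\<bar> \<le> 1 * exp (B / t * norm y)"
proof -
  have "\<bar>scaled_E t x y\<bar> \<le> exp (norm x * norm y / t)"
    using abs_dunkl_E_le[of "x /\<^sub>R sqrt t" "y /\<^sub>R sqrt t"] assms
    by (simp add: scaled_E_def field_simps)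
  also have "\<dots> \<le> exp (B / t * norm y)"
    using assms by (simp add: divide_right_mono mult_right_mono)
  finally show ?thesis by simp
qed

lemma integrable_scaled_E:
  assumes "t > 0" "rapid H"
  shows "integrable lborel (\<lambda>y. scaled_E t x y * H y)"
  by (rule rapid_bound[OF assms(2) scaled_E_measurable scaled_E_le[OF assms(1) order_refl]])

text \<open>A convergent sequence is bounded, so one exponential dominates the kernel along it. This
  carries identities from generic points to all points.\<close>

lemma K_continuous:
  assumes t: "t > 0" and H: "rapid H" and X: "X \<longlonglongrightarrow> x"
  shows "(\<lambda>n. K t H (X n)) \<longlonglongrightarrow> K t H x"
proof -
  note [measurable] = rapid_measurable[OF H]
  obtain B where B: "\<And>n. norm (X n) \<le> B"
    using convergent_imp_Bseq[OF convergentI[OF X]] by (auto simp: Bseq_def)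
  have "continuous_on UNIV (\<lambda>x. scaled_E t x y)" for y
    unfolding scaled_E_def
    by (intro continuous_on_compose2[OF continuous_dunkl_E]) (auto intro!: continuous_intros)
  then have lim: "(\<lambda>n. scaled_E t (X n) y) \<longlonglongrightarrow> scaled_E t x y" for y
    using X continuous_on_tendsto_compose[of UNIV "\<lambda>x. scaled_E t x y" X x] by auto
  show ?thesis
    unfolding K_def
  proof (rule integral_dominated_convergence[where w = "\<lambda>y. \<bar>exp (B / t * norm y) * H y\<bar>"])
    show "integrable lborel (\<lambda>y. \<bar>exp (B / t * norm y) * H y\<bar>)"
      using H unfolding rapid_def by (intro integrable_abs) blast
    show "AE y in lborel. (\<lambda>n. scaled_E t (X n) y * H y) \<longlonglongrightarrow> scaled_E t x y * H y"
      by (intro AE_I2 tendsto_mult_right lim)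
    show "AE y in lborel. norm (scaled_E t (X n) y * H y) \<le> \<bar>exp (B / t * norm y) * H y\<bar>" for n
      using scaled_E_le[OF t B[of n]] by (auto simp: abs_mult intro!: mult_right_mono)
  qed measurable
qed

text \<open>Off the reflecting hyperplanes Dunkl operators involve no limits; the moment identities
  extend to all points by continuity.\<close>

definition generic :: "real^'n \<Rightarrow> bool" where
  "generic x \<longleftrightarrow> (\<forall>\<alpha>\<in>Rp. \<alpha> \<bullet> x \<noteq> 0)"

text \<open>The transform intertwines the Dunkl operator with multiplication by a linear form, by
  differentiation under the integral. The derivative \<open>D\<close> is a hypothesis because in
  each use a closed form of the transform provides it; uniqueness of derivatives then links the
  two.\<close>

lemma K_equation:
  assumes t: "t > 0" and H: "rapid H" and x: "generic x"
    and D: "((\<lambda>s. K t H (x + s *\<^sub>R \<xi>)) has_real_derivative D) (at 0)"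
  shows "D + (\<Sum>\<alpha>\<in>Rp. k \<alpha> * (\<alpha> \<bullet> \<xi>) * ((K t H x - K t H (reflection \<alpha> x)) / (\<alpha> \<bullet> x))) =
    K t (\<lambda>y. (y \<bullet> \<xi>) * H y) x / t"
proof -
  note [measurable] = rapid_measurable[OF H]
  define d where "d y = dunkl_E_dirderiv (\<xi> /\<^sub>R sqrt t) (x /\<^sub>R sqrt t) (y /\<^sub>R sqrt t)" for y
  define S where "S y = (\<Sum>\<alpha>\<in>Rp. k \<alpha> * (\<alpha> \<bullet> \<xi>) * ((scaled_E t x y - scaled_E t (reflection \<alpha> x) y) / (\<alpha> \<bullet> x)))" for y
  \<comment> \<open>The Dunkl equation solved for the derivative. The scalings cancel in the
    difference part, and the two factors \<open>1 / sqrt t\<close> combine to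
    \<open>1 / t\<close>.\<close>
  have deq: "d y = (y \<bullet> \<xi>) / t * scaled_E t x y - S y" for y
  proof -
    have r: "reflection \<alpha> (x /\<^sub>R sqrt t) = reflection \<alpha> x /\<^sub>R sqrt t" for \<alpha>
      using linear_scale[OF reflection_linear] by blast
    have "d y + (\<Sum>\<alpha>\<in>Rp. k \<alpha> * (\<alpha> \<bullet> (\<xi> /\<^sub>R sqrt t)) *
      ((E (x /\<^sub>R sqrt t) (y /\<^sub>R sqrt t) - E (reflection \<alpha> (x /\<^sub>R sqrt t)) (y /\<^sub>R sqrt t)) / (\<alpha> \<bullet> (x /\<^sub>R sqrt t))))
      = ((\<xi> /\<^sub>R sqrt t) \<bullet> (y /\<^sub>R sqrt t)) * E (x /\<^sub>R sqrt t) (y /\<^sub>R sqrt t)"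
      unfolding d_def using x t by (intro dunkl_E_equation) (auto simp: generic_def)
    moreover have "(\<Sum>\<alpha>\<in>Rp. k \<alpha> * (\<alpha> \<bullet> (\<xi> /\<^sub>R sqrt t)) *
      ((E (x /\<^sub>R sqrt t) (y /\<^sub>R sqrt t) - E (reflection \<alpha> (x /\<^sub>R sqrt t)) (y /\<^sub>R sqrt t)) / (\<alpha> \<bullet> (x /\<^sub>R sqrt t)))) = S y"
      unfolding S_def r scaled_E_def using t by (intro sum.cong refl) simp
    moreover have "(\<xi> /\<^sub>R sqrt t) \<bullet> (y /\<^sub>R sqrt t) = (y \<bullet> \<xi>) / t"
      using t by (simp add: inner_commute field_simps)
    ultimately show ?thesis by (simp add: scaled_E_def)
  qed
  have [measurable]: "S \<in> borel_measurable borel"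
    unfolding S_def[abs_def] by measurable
  \<comment> \<open>The derivative is measurable in the spectral variable because \<open>deq\<close>
    expresses it by values of the kernel.\<close>
  have [measurable]: "d \<in> borel_measurable borel"
    unfolding deq[abs_def] by measurable
  have deriv: "((\<lambda>s. scaled_E t (x + s *\<^sub>R \<xi>) y) has_real_derivative
      dunkl_E_dirderiv (\<xi> /\<^sub>R sqrt t) ((x + s *\<^sub>R \<xi>) /\<^sub>R sqrt t) (y /\<^sub>R sqrt t)) (at s)" for s y
    using dunkl_E_has_derivative[of "x /\<^sub>R sqrt t" "\<xi> /\<^sub>R sqrt t" "y /\<^sub>R sqrt t" s]
    by (simp add: scaled_E_def scaleR_add_right mult.commute)
  have "((\<lambda>s. K t H (x + s *\<^sub>R \<xi>)) has_real_derivative (\<integral>y. d y * H y \<partial>lborel)) (at 0)"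
    unfolding DERIV_def tendsto_at_iff_sequentially comp_def
  proof (intro allI impI)
    fix h :: "nat \<Rightarrow> real" assume h: "\<forall>i. h i \<in> UNIV - {0}" "h \<longlonglongrightarrow> 0"
    obtain B where B: "B > 0" "\<And>n. norm (h n) \<le> B"
      using convergent_imp_Bseq[OF convergentI[OF h(2)]] by (auto simp: Bseq_def)
    \<comment> \<open>Read off from \<open>abs_dunkl_E_dirderiv_le\<close> for base points within
      \<open>B * norm \<xi>\<close> of \<open>x\<close>: the inner 1 stems from the Cauchy estimate,
      the outer division from rescaling \<open>y\<close>.\<close>
    define c where "c = ((norm x + B * norm \<xi>) / sqrt t + 1) / sqrt t"
    define A where "A = norm \<xi> / sqrt t"
    have bound: "\<bar>(scaled_E t (x + h n *\<^sub>R \<xi>) y - scaled_E t x y) / h n\<bar> \<le> A * exp (c * norm y)" for n y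
    proof -
      have "norm (scaled_E t (x + h n *\<^sub>R \<xi>) y - scaled_E t (x + 0 *\<^sub>R \<xi>) y) \<le> A * exp (c * norm y) * norm (h n - 0)"
      proof (rule field_differentiable_bound[where S = "{-B..B}"])
        fix s assume s: "s \<in> {-B..B}"
        show "((\<lambda>s. scaled_E t (x + s *\<^sub>R \<xi>) y) has_field_derivative
          dunkl_E_dirderiv (\<xi> /\<^sub>R sqrt t) ((x + s *\<^sub>R \<xi>) /\<^sub>R sqrt t) (y /\<^sub>R sqrt t)) (at s within {-B..B})"
          by (rule has_field_derivative_at_within[OF deriv])
        have "norm (x + s *\<^sub>R \<xi>) \<le> norm x + \<bar>s\<bar> * norm \<xi>"
          using norm_triangle_ineq[of x "s *\<^sub>R \<xi>"] by simp
        also have "\<dots> \<le> norm x + B * norm \<xi>"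
          using s by (intro add_left_mono mult_right_mono) auto
        finally have n: "norm (x + s *\<^sub>R \<xi>) \<le> norm x + B * norm \<xi>" .
        have "\<bar>dunkl_E_dirderiv (\<xi> /\<^sub>R sqrt t) ((x + s *\<^sub>R \<xi>) /\<^sub>R sqrt t) (y /\<^sub>R sqrt t)\<bar> \<le>
          A * exp ((norm (x + s *\<^sub>R \<xi>) / sqrt t + 1) * (norm y / sqrt t))"
          using abs_dunkl_E_dirderiv_le[of "\<xi> /\<^sub>R sqrt t" "(x + s *\<^sub>R \<xi>) /\<^sub>R sqrt t" "y /\<^sub>R sqrt t"] t
          by (simp add: A_def divide_inverse mult.commute)
        also have "\<dots> \<le> A * exp (((norm x + B * norm \<xi>) / sqrt t + 1) * (norm y / sqrt t))"
          using n t by (auto simp: A_def intro!: mult_left_mono mult_right_mono divide_right_mono)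
        finally show "norm (dunkl_E_dirderiv (\<xi> /\<^sub>R sqrt t) ((x + s *\<^sub>R \<xi>) /\<^sub>R sqrt t) (y /\<^sub>R sqrt t)) \<le> A * exp (c * norm y)"
          by (simp add: c_def)
      qed (use B in \<open>auto simp: abs_le_iff\<close>, smt (verit) B(2) real_norm_def)
      then show ?thesis using h(1)[rule_format, of n] by (simp add: field_simps)
    qed
    have lim: "(\<lambda>n. (scaled_E t (x + h n *\<^sub>R \<xi>) y - scaled_E t x y) / h n) \<longlonglongrightarrow> d y" for y
      using deriv[of y 0] h unfolding DERIV_def tendsto_at_iff_sequentially comp_def d_def by simp
    have diff: "(K t H (x + h n *\<^sub>R \<xi>) - K t H x) / h n =
      (\<integral>y. (scaled_E t (x + h n *\<^sub>R \<xi>) y - scaled_E t x y) / h n * H y \<partial>lborel)" for n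
    proof -
      have "K t H (x + h n *\<^sub>R \<xi>) - K t H x = (\<integral>y. scaled_E t (x + h n *\<^sub>R \<xi>) y * H y - scaled_E t x y * H y \<partial>lborel)"
        unfolding K_def by (intro Bochner_Integration.integral_diff[symmetric] integrable_scaled_E t H)
      then show ?thesis by (simp add: left_diff_distrib diff_divide_distrib flip: integral_divide_zero)
    qed
    have "(\<lambda>n. \<integral>y. (scaled_E t (x + h n *\<^sub>R \<xi>) y - scaled_E t x y) / h n * H y \<partial>lborel) \<longlonglongrightarrow> (\<integral>y. d y * H y \<partial>lborel)"
    proof (rule integral_dominated_convergence[where w = "\<lambda>y. \<bar>A * (exp (c * norm y) * H y)\<bar>"])
      show "integrable lborel (\<lambda>y. \<bar>A * (exp (c * norm y) * H y)\<bar>)"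
        using H by (auto simp: rapid_def)
      show "AE y in lborel. (\<lambda>n. (scaled_E t (x + h n *\<^sub>R \<xi>) y - scaled_E t x y) / h n * H y) \<longlonglongrightarrow> d y * H y"
        by (intro AE_I2 tendsto_mult_right lim)
      show "AE y in lborel. norm ((scaled_E t (x + h n *\<^sub>R \<xi>) y - scaled_E t x y) / h n * H y) \<le> \<bar>A * (exp (c * norm y) * H y)\<bar>" for n
      proof (rule AE_I2)
        fix y
        have "\<bar>(scaled_E t (x + h n *\<^sub>R \<xi>) y - scaled_E t x y) / h n\<bar> * \<bar>H y\<bar> \<le> (A * exp (c * norm y)) * \<bar>H y\<bar>"
          by (intro mult_right_mono bound) simp
        also have "\<dots> = \<bar>A * (exp (c * norm y) * H y)\<bar>"
          using t by (simp add: abs_mult A_def)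
        finally show "norm ((scaled_E t (x + h n *\<^sub>R \<xi>) y - scaled_E t x y) / h n * H y) \<le> \<bar>A * (exp (c * norm y) * H y)\<bar>"
          by (simp add: abs_mult)
      qed
    qed measurable
    then show "(\<lambda>n. (K t H (x + (0 + h n) *\<^sub>R \<xi>) - K t H (x + 0 *\<^sub>R \<xi>)) / h n) \<longlonglongrightarrow> (\<integral>y. d y * H y \<partial>lborel)"
      by (simp add: diff)
  qed
  with D have "D = (\<integral>y. d y * H y \<partial>lborel)"
    by (rule DERIV_unique)
  also have "\<dots> = (\<integral>y. scaled_E t x y * ((y \<bullet> \<xi>) * H y) / t - (\<Sum>\<alpha>\<in>Rp. k \<alpha> * (\<alpha> \<bullet> \<xi>) * ((scaled_E t x y * H y - scaled_E t (reflection \<alpha> x) y * H y) / (\<alpha> \<bullet> x))) \<partial>lborel)"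
  proof (intro Bochner_Integration.integral_cong refl)
    fix y
    have "S y * H y = (\<Sum>\<alpha>\<in>Rp. k \<alpha> * (\<alpha> \<bullet> \<xi>) * ((scaled_E t x y * H y - scaled_E t (reflection \<alpha> x) y * H y) / (\<alpha> \<bullet> x)))"
      unfolding S_def sum_distrib_right by (intro sum.cong refl) (simp add: left_diff_distrib)
    moreover have "d y * H y = scaled_E t x y * ((y \<bullet> \<xi>) * H y) / t - S y * H y"
      unfolding deq left_diff_distrib by simp
    ultimately show "d y * H y = scaled_E t x y * ((y \<bullet> \<xi>) * H y) / t - (\<Sum>\<alpha>\<in>Rp. k \<alpha> * (\<alpha> \<bullet> \<xi>) * ((scaled_E t x y * H y - scaled_E t (reflection \<alpha> x) y * H y) / (\<alpha> \<bullet> x)))"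
      by simp
  qed
  also have "\<dots> = (\<integral>y. scaled_E t x y * ((y \<bullet> \<xi>) * H y) / t \<partial>lborel) -
     (\<integral>y. (\<Sum>\<alpha>\<in>Rp. k \<alpha> * (\<alpha> \<bullet> \<xi>) * ((scaled_E t x y * H y - scaled_E t (reflection \<alpha> x) y * H y) / (\<alpha> \<bullet> x))) \<partial>lborel)"
    by (intro Bochner_Integration.integral_diff Bochner_Integration.integrable_divide
        Bochner_Integration.integrable_sum integrable_mult_right Bochner_Integration.integrable_diff
        integrable_scaled_E t rapid_inner H)
  also have "(\<integral>y. (\<Sum>\<alpha>\<in>Rp. k \<alpha> * (\<alpha> \<bullet> \<xi>) * ((scaled_E t x y * H y - scaled_E t (reflection \<alpha> x) y * H y) / (\<alpha> \<bullet> x))) \<partial>lborel) =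
    (\<Sum>\<alpha>\<in>Rp. k \<alpha> * (\<alpha> \<bullet> \<xi>) * ((K t H x - K t H (reflection \<alpha> x)) / (\<alpha> \<bullet> x)))"
    by (simp add: Bochner_Integration.integral_sum Bochner_Integration.integral_diff integrable_scaled_E t H K_def)
  finally show ?thesis by (simp add: K_def)
qed

text \<open>The vector defining the positive subsystem is orthogonal to no root, so small multiples
  of it push any point off all reflecting hyperplanes.\<close>

lemma generic_sequence: obtains X where "X \<longlonglongrightarrow> x" "\<And>n. generic (X n)"
proof -
  obtain v where v: "\<forall>\<alpha>\<in>R. \<alpha> \<bullet> v \<noteq> 0"
    using pos unfolding positive_subsystem_def by blast
  define Y where "Y n = x + inverse (real (Suc n)) *\<^sub>R v" for n
  have Y: "Y \<longlonglongrightarrow> x"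
    unfolding Y_def using tendsto_add[OF tendsto_const tendsto_scaleR[OF LIMSEQ_inverse_real_of_nat tendsto_const], of x v]
    by simp
  have "\<forall>\<^sub>F n in sequentially. \<alpha> \<bullet> Y n \<noteq> 0" if a: "\<alpha> \<in> Rp" for \<alpha>
  proof (cases "\<alpha> \<bullet> x = 0")
    case True
    then show ?thesis using a v Rp_subset by (auto simp: Y_def inner_add_right)
  next
    case False
    have "(\<lambda>n. \<alpha> \<bullet> Y n) \<longlonglongrightarrow> \<alpha> \<bullet> x" by (intro tendsto_intros Y)
    then show ?thesis using False by (rule tendsto_imp_eventually_ne)
  qed
  then have "\<forall>\<^sub>F n in sequentially. generic (Y n)"
    unfolding generic_def by (intro eventually_ball_finite finite_Rp) auto
  then obtain N where "\<And>n. n \<ge> N \<Longrightarrow> generic (Y n)"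
    by (auto simp: eventually_sequentially)
  then show ?thesis
    using that[of "\<lambda>n. Y (n + N)"] LIMSEQ_ignore_initial_segment[OF Y] by auto
qed

lemma dunkl_const_nonneg: "0 \<le> dunkl_const Rp k"
  unfolding dunkl_const_def by (auto intro!: divide_nonneg_nonneg integral_nonneg_AE simp: weight_nonneg)

end

section \<open>First and second moments of the transition kernel at a fixed time\<close>

locale dunkl_markov = dunkl R Rp k
  for R Rp :: "(real^'n) set" and k +
  fixes lam :: "real^'n" and t :: real
  assumes t: "t > 0" and prob: "\<And>x. prob_space (dunkl_transition Rp k lam t x)"
begin

definition norm_const :: real where
  "norm_const = dunkl_const Rp k * exp (- (norm lam)\<^sup>2 * t / 2) / t powr (sum k Rp + real CARD('n) / 2)"

definition rho :: "real^'n \<Rightarrow> real" where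
  "rho x = norm_const * exp (- (norm x)\<^sup>2 / (2 * t)) / E x lam"

abbreviation "g0 \<equiv> gauss_weight t lam"

lemma rho_nonneg: "0 \<le> rho x"
  unfolding rho_def norm_const_def using dunkl_const_nonneg dunkl_E_pos[of x lam] t
  by (auto intro!: divide_nonneg_nonneg mult_nonneg_nonneg simp: less_imp_le)

lemma density_eq: "dunkl_density Rp k lam t x y = rho x * (scaled_E t x y * g0 y)"
proof -
  have "exp (- ((norm x)\<^sup>2 + (norm y)\<^sup>2) / (2 * t)) = exp (- (norm x)\<^sup>2 / (2 * t)) * exp (- (norm y)\<^sup>2 / (2 * t))"
    by (simp add: exp_add[symmetric] add_divide_distrib diff_divide_distrib)
  then show ?thesis
    unfolding dunkl_density_def rho_def norm_const_def gauss_weight_def scaled_E_def by (simp add: mult_ac)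
qed

lemma rapid_g0: "rapid g0"
  by (rule rapid_gauss_weight[OF t])

lemma g0_measurable [measurable]: "g0 \<in> borel_measurable borel"
  using rapid_g0 by (rule rapid_measurable)

lemma transition_eq:
  "dunkl_transition Rp k lam t x = density lborel (\<lambda>y. ennreal (rho x * (scaled_E t x y * g0 y)))"
  by (simp add: dunkl_transition_def density_eq)

lemma kernel_nonneg: "0 \<le> rho x * (scaled_E t x y * g0 y)"
  using rho_nonneg[of x] scaled_E_pos[of t x y] gauss_weight_nonneg[of t lam y] by (simp add: less_imp_le)

lemma transition_integral:
  fixes f :: "real^'n \<Rightarrow> real"
  assumes [measurable]: "f \<in> borel_measurable borel" and le: "\<And>y. \<bar>f y\<bar> \<le> A * exp (c * norm y)"
  shows "integrable (dunkl_transition Rp k lam t x) f"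
    and "(\<integral>y. f y \<partial>dunkl_transition Rp k lam t x) = rho x * K t (\<lambda>y. f y * g0 y) x"
proof -
  have "integrable lborel (\<lambda>y. rho x * (scaled_E t x y * (f y * g0 y)))"
    by (intro integrable_mult_right integrable_scaled_E t rapid_mult[OF rapid_g0 _ le]) measurable
  then show "integrable (dunkl_transition Rp k lam t x) f"
    unfolding transition_eq using kernel_nonneg
    by (subst integrable_density) (auto simp: mult_ac)
  show "(\<integral>y. f y \<partial>dunkl_transition Rp k lam t x) = rho x * K t (\<lambda>y. f y * g0 y) x"
    unfolding transition_eq K_def using kernel_nonneg
    by (subst integral_density) (auto simp: mult_ac simp flip: integral_mult_right_zero)
qed

lemma rho_K: "rho x * K t g0 x = 1"
proof -
  interpret prob_space "dunkl_transition Rp k lam t x" by (rule prob)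
  have "(\<integral>y. 1 \<partial>dunkl_transition Rp k lam t x) = rho x * K t (\<lambda>y. 1 * g0 y) x"
    by (rule transition_integral[where A = 1 and c = 0]) auto
  then show ?thesis using prob_space by simp
qed

text \<open>Forced by the total mass: with a vanishing constant the kernel would be the zero
  measure.\<close>

lemma norm_const_nz: "norm_const \<noteq> 0"
  using rho_K[of 0] by (auto simp: rho_def)

text \<open>Total mass one solved for the transform. This closed form, valid at every point, is what
  Dunkl operators are applied to.\<close>

lemma K_g0: "K t g0 x = exp ((x \<bullet> x) / (2 * t)) * E x lam / norm_const"
proof -
  have "rho x = norm_const / (exp ((x \<bullet> x) / (2 * t)) * E x lam)"
    by (simp add: rho_def power2_norm_eq_inner exp_minus field_simps)
  moreover have "K t g0 x = 1 / rho x" using rho_K[of x] by (metis mult_zero_left nonzero_eq_divide_eq mult.commute zero_neq_one)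
  ultimately show ?thesis by simp
qed

lemma K_g0_deriv:
  "((\<lambda>s. K t g0 (x + s *\<^sub>R \<xi>)) has_real_derivative
     (x \<bullet> \<xi>) / t * K t g0 x + exp ((x \<bullet> x) / (2 * t)) * dunkl_E_dirderiv \<xi> x lam / norm_const) (at 0)"
proof -
  have 1: "((\<lambda>s. E (x + s *\<^sub>R \<xi>) lam) has_real_derivative dunkl_E_dirderiv \<xi> x lam) (at 0)"
    using dunkl_E_has_derivative[of x \<xi> lam 0] by simp
  have 2: "(x + s *\<^sub>R \<xi>) \<bullet> (x + s *\<^sub>R \<xi>) = x \<bullet> x + 2 * s * (x \<bullet> \<xi>) + s * s * (\<xi> \<bullet> \<xi>)" for s
    by (simp add: inner_add_left inner_add_right inner_commute algebra_simps)
  show ?thesis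
    unfolding K_g0 2 using t norm_const_nz
    by (auto intro!: derivative_eq_intros 1 simp: field_simps)
qed

lemma K_first_generic:
  assumes x: "generic x"
  shows "K t (\<lambda>y. (y \<bullet> \<xi>) * g0 y) x = (x \<bullet> \<xi> + t * (lam \<bullet> \<xi>)) * K t g0 x"
proof -
  define c where "c = exp ((x \<bullet> x) / (2 * t)) / norm_const"
  have K: "K t g0 x = c * E x lam" by (simp add: K_g0 c_def)
  \<comment> \<open>The Gaussian factor is invariant under reflections, so in the difference part it
    acts as a constant; only the derivative sees it and yields the term with
    \<open>x \<bullet> \<xi>\<close>.\<close>
  have Kr: "K t g0 (reflection \<alpha> x) = c * E (reflection \<alpha> x) lam" if "\<alpha> \<in> Rp" for \<alpha>
    using norm_reflection[OF pos_root_nz[OF that], of x]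
    by (simp add: K_g0 c_def power2_norm_eq_inner[symmetric])
  have "(x \<bullet> \<xi>) / t * K t g0 x + c * dunkl_E_dirderiv \<xi> x lam +
    (\<Sum>\<alpha>\<in>Rp. k \<alpha> * (\<alpha> \<bullet> \<xi>) * ((K t g0 x - K t g0 (reflection \<alpha> x)) / (\<alpha> \<bullet> x))) =
    K t (\<lambda>y. (y \<bullet> \<xi>) * g0 y) x / t"
    by (rule K_equation[OF t rapid_g0 x]) (use K_g0_deriv[of x \<xi>] in \<open>simp add: c_def\<close>)
  moreover have "(\<Sum>\<alpha>\<in>Rp. k \<alpha> * (\<alpha> \<bullet> \<xi>) * ((K t g0 x - K t g0 (reflection \<alpha> x)) / (\<alpha> \<bullet> x))) =
    c * (\<Sum>\<alpha>\<in>Rp. k \<alpha> * (\<alpha> \<bullet> \<xi>) * ((E x lam - E (reflection \<alpha> x) lam) / (\<alpha> \<bullet> x)))"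
    unfolding sum_distrib_left by (intro sum.cong refl) (simp add: K Kr right_diff_distrib[symmetric])
  moreover have "c * dunkl_E_dirderiv \<xi> x lam + c * (\<Sum>\<alpha>\<in>Rp. k \<alpha> * (\<alpha> \<bullet> \<xi>) * ((E x lam - E (reflection \<alpha> x) lam) / (\<alpha> \<bullet> x)))
    = (\<xi> \<bullet> lam) * K t g0 x"
    unfolding distrib_left[symmetric]
    using x by (subst dunkl_E_equation) (auto simp: generic_def K)
  ultimately have "K t (\<lambda>y. (y \<bullet> \<xi>) * g0 y) x / t = (x \<bullet> \<xi>) / t * K t g0 x + (\<xi> \<bullet> lam) * K t g0 x"
    by simp
  then show ?thesis using t by (simp add: field_simps inner_commute)
qed

lemma K_first: "K t (\<lambda>y. (y \<bullet> \<xi>) * g0 y) x = (x \<bullet> \<xi> + t * (lam \<bullet> \<xi>)) * K t g0 x"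
proof -
  obtain X where X: "X \<longlonglongrightarrow> x" "\<And>n. generic (X n)" using generic_sequence[of x] by blast
  have "(\<lambda>n. K t (\<lambda>y. (y \<bullet> \<xi>) * g0 y) (X n)) \<longlonglongrightarrow> K t (\<lambda>y. (y \<bullet> \<xi>) * g0 y) x"
    by (rule K_continuous[OF t rapid_inner[OF rapid_g0] X(1)])
  moreover have "(\<lambda>n. (X n \<bullet> \<xi> + t * (lam \<bullet> \<xi>)) * K t g0 (X n)) \<longlonglongrightarrow> (x \<bullet> \<xi> + t * (lam \<bullet> \<xi>)) * K t g0 x"
    by (intro tendsto_intros X K_continuous[OF t rapid_g0])
  ultimately show ?thesis
    unfolding K_first_generic[OF X(2)] by (rule LIMSEQ_unique)
qed

text \<open>A second use of \<open>K_equation\<close>, now for the first-moment integrand. Its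
  transform must be known along a whole line and at mirror images, hence the extension
  \<open>K_first\<close>. The reflection terms come from the difference of the linear
  factor.\<close>

lemma K_second_generic:
  assumes x: "generic x"
  shows "K t (\<lambda>y. (y \<bullet> \<xi>) * ((y \<bullet> \<xi>) * g0 y)) x =
    (t * (\<xi> \<bullet> \<xi>) + (x \<bullet> \<xi> + t * (lam \<bullet> \<xi>))\<^sup>2) * K t g0 x
    + t * (\<Sum>\<alpha>\<in>Rp. k \<alpha> * (2 * (\<alpha> \<bullet> \<xi>)\<^sup>2 / (\<alpha> \<bullet> \<alpha>)) * K t g0 (reflection \<alpha> x))"
proof -
  define l where "l x = x \<bullet> \<xi> + t * (lam \<bullet> \<xi>)" for x
  define D where "D = (x \<bullet> \<xi>) / t * K t g0 x + exp ((x \<bullet> x) / (2 * t)) * dunkl_E_dirderiv \<xi> x lam / norm_const"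
  define S where "S = (\<Sum>\<alpha>\<in>Rp. k \<alpha> * (\<alpha> \<bullet> \<xi>) * ((K t g0 x - K t g0 (reflection \<alpha> x)) / (\<alpha> \<bullet> x)))"
  have K1: "K t (\<lambda>y. (y \<bullet> \<xi>) * g0 y) z = l z * K t g0 z" for z
    unfolding l_def by (rule K_first)
  have D: "((\<lambda>s. K t g0 (x + s *\<^sub>R \<xi>)) has_real_derivative D) (at 0)"
    unfolding D_def by (rule K_g0_deriv)
  have DS: "D + S = l x * K t g0 x / t"
    unfolding S_def K1[symmetric] by (rule K_equation[OF t rapid_g0 x D])
  have "((\<lambda>s. l (x + s *\<^sub>R \<xi>)) has_real_derivative \<xi> \<bullet> \<xi>) (at 0)"
    unfolding l_def inner_add_left inner_scaleR_left by (auto intro!: derivative_eq_intros)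
  from DERIV_mult[OF this D]
  have D1: "((\<lambda>s. K t (\<lambda>y. (y \<bullet> \<xi>) * g0 y) (x + s *\<^sub>R \<xi>)) has_real_derivative
      (\<xi> \<bullet> \<xi>) * K t g0 x + D * l x) (at 0)"
    by (simp add: K1)
  have diff: "(l x * K t g0 x - l (reflection \<alpha> x) * K t g0 (reflection \<alpha> x)) / (\<alpha> \<bullet> x) =
    l x * ((K t g0 x - K t g0 (reflection \<alpha> x)) / (\<alpha> \<bullet> x)) + 2 * (\<alpha> \<bullet> \<xi>) / (\<alpha> \<bullet> \<alpha>) * K t g0 (reflection \<alpha> x)"
    if "\<alpha> \<in> Rp" for \<alpha>
  proof -
    have nz: "\<alpha> \<bullet> x \<noteq> 0" "\<alpha> \<bullet> \<alpha> \<noteq> 0"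
      using x that pos_root_nz by (auto simp: generic_def)
    have "l x - l (reflection \<alpha> x) = 2 * (\<alpha> \<bullet> \<xi>) / (\<alpha> \<bullet> \<alpha>) * (\<alpha> \<bullet> x)"
      by (simp add: l_def reflection_def inner_diff_left)
    then have eq: "l (reflection \<alpha> x) = l x - 2 * (\<alpha> \<bullet> \<xi>) / (\<alpha> \<bullet> \<alpha>) * (\<alpha> \<bullet> x)" by simp
    show ?thesis unfolding eq using nz by (simp add: field_simps)
  qed
  have "(\<xi> \<bullet> \<xi>) * K t g0 x + D * l x + (\<Sum>\<alpha>\<in>Rp. k \<alpha> * (\<alpha> \<bullet> \<xi>) *
    ((l x * K t g0 x - l (reflection \<alpha> x) * K t g0 (reflection \<alpha> x)) / (\<alpha> \<bullet> x))) =
    K t (\<lambda>y. (y \<bullet> \<xi>) * ((y \<bullet> \<xi>) * g0 y)) x / t"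
    using K_equation[OF t rapid_inner[OF rapid_g0] x D1] unfolding K1 .
  also have "(\<Sum>\<alpha>\<in>Rp. k \<alpha> * (\<alpha> \<bullet> \<xi>) *
    ((l x * K t g0 x - l (reflection \<alpha> x) * K t g0 (reflection \<alpha> x)) / (\<alpha> \<bullet> x))) =
    l x * S + (\<Sum>\<alpha>\<in>Rp. k \<alpha> * (2 * (\<alpha> \<bullet> \<xi>)\<^sup>2 / (\<alpha> \<bullet> \<alpha>)) * K t g0 (reflection \<alpha> x))"
    unfolding S_def sum_distrib_left sum.distrib[symmetric]
    by (intro sum.cong refl) (simp add: diff power2_eq_square distrib_left mult_ac)
  finally have "K t (\<lambda>y. (y \<bullet> \<xi>) * ((y \<bullet> \<xi>) * g0 y)) x / t =
    (\<xi> \<bullet> \<xi>) * K t g0 x + l x * (D + S) + (\<Sum>\<alpha>\<in>Rp. k \<alpha> * (2 * (\<alpha> \<bullet> \<xi>)\<^sup>2 / (\<alpha> \<bullet> \<alpha>)) * K t g0 (reflection \<alpha> x))"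
    by (simp add: distrib_left mult.commute)
  then show ?thesis
    unfolding DS using t by (simp add: l_def[symmetric] power2_eq_square field_simps)
qed

text \<open>The trace of the second-moment formula over an orthonormal basis: the dimension from the
  squared basis vectors, the square of the mean, and the Harnack constant times 2, the trace of
  \<open>2 * (\<alpha> \<bullet> b)\<^sup>2 / (\<alpha> \<bullet> \<alpha>)\<close> for each
  root.\<close>

definition moment_bound :: "real^'n \<Rightarrow> real" where
  "moment_bound x = t * real CARD('n) + (norm (x + t *\<^sub>R lam))\<^sup>2 + 2 * t * (2 * (norm x * norm lam) + gam)"

lemma K_norm2:
  "K t (\<lambda>y. (norm y)\<^sup>2 * g0 y) x = (\<Sum>b\<in>Basis. K t (\<lambda>y. (y \<bullet> b) * ((y \<bullet> b) * g0 y)) x)"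
proof -
  have "(norm y)\<^sup>2 = (\<Sum>b\<in>Basis. (y \<bullet> b) * (y \<bullet> b))" for y :: "real^'n"
    unfolding power2_norm_eq_inner by (rule euclidean_inner)
  then have "scaled_E t x y * ((norm y)\<^sup>2 * g0 y) = (\<Sum>b\<in>Basis. scaled_E t x y * ((y \<bullet> b) * ((y \<bullet> b) * g0 y)))" for y
    by (simp add: sum_distrib_left sum_distrib_right mult_ac)
  then show ?thesis
    unfolding K_def
    by (simp add: Bochner_Integration.integral_sum integrable_scaled_E t rapid_inner rapid_g0)
qed

lemma K_second_bound_generic:
  assumes x: "generic x"
  shows "K t (\<lambda>y. (norm y)\<^sup>2 * g0 y) x \<le> moment_bound x * K t g0 x"
proof -
  have a: "(\<Sum>b\<in>Basis. (x \<bullet> b + t * (lam \<bullet> b))\<^sup>2) = (norm (x + t *\<^sub>R lam))\<^sup>2"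
    unfolding power2_norm_eq_inner by (subst euclidean_inner) (simp add: inner_add_left power2_eq_square)
  have b: "(\<Sum>b\<in>Basis. 2 * (\<alpha> \<bullet> b)\<^sup>2 / (\<alpha> \<bullet> \<alpha>)) = 2" if "\<alpha> \<in> Rp" for \<alpha>
  proof -
    have "(\<Sum>b\<in>Basis. (\<alpha> \<bullet> b)\<^sup>2) = \<alpha> \<bullet> \<alpha>"
      by (subst (2) euclidean_inner) (simp add: power2_eq_square)
    then show ?thesis
      using pos_root_nz[OF that] by (simp flip: sum_distrib_left sum_divide_distrib)
  qed
  have "K t (\<lambda>y. (norm y)\<^sup>2 * g0 y) x = (\<Sum>b\<in>Basis. t * (b \<bullet> b) + (x \<bullet> b + t * (lam \<bullet> b))\<^sup>2) * K t g0 x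
    + t * (\<Sum>\<alpha>\<in>Rp. k \<alpha> * (\<Sum>b\<in>Basis. 2 * (\<alpha> \<bullet> b)\<^sup>2 / (\<alpha> \<bullet> \<alpha>)) * K t g0 (reflection \<alpha> x))"
    unfolding K_norm2 K_second_generic[OF x] sum.distrib
    by (simp only: sum_distrib_left[symmetric] sum_distrib_right[symmetric] sum.swap[of _ Rp Basis] sum.distrib)
  also have "(\<Sum>b\<in>(Basis::(real^'n) set). t * (b \<bullet> b) + (x \<bullet> b + t * (lam \<bullet> b))\<^sup>2) = t * real CARD('n) + (norm (x + t *\<^sub>R lam))\<^sup>2"
    by (simp add: sum.distrib a inner_same_Basis)
  also have "(\<Sum>\<alpha>\<in>Rp. k \<alpha> * (\<Sum>b\<in>Basis. 2 * (\<alpha> \<bullet> b)\<^sup>2 / (\<alpha> \<bullet> \<alpha>)) * K t g0 (reflection \<alpha> x)) =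
    2 * (\<Sum>\<alpha>\<in>Rp. k \<alpha> * K t g0 (reflection \<alpha> x))"
    unfolding sum_distrib_left[of 2 _ Rp] by (intro sum.cong refl) (simp add: b)
  also have "(\<Sum>\<alpha>\<in>Rp. k \<alpha> * K t g0 (reflection \<alpha> x)) \<le> (2 * (norm x * norm lam) + gam) * K t g0 x"
  proof -
    define c where "c = exp ((x \<bullet> x) / (2 * t)) / norm_const"
    have K: "K t g0 x = c * E x lam" by (simp add: K_g0 c_def)
    have "0 < rho x" using rho_nonneg[of x] rho_K[of x] by (cases "rho x = 0") auto
    then have "0 < K t g0 x" using rho_K[of x] by (metis zero_less_mult_pos zero_less_one)
    then have "0 < c" unfolding K using dunkl_E_pos[of x lam] by (simp add: zero_less_mult_iff)
    have "(\<Sum>\<alpha>\<in>Rp. k \<alpha> * K t g0 (reflection \<alpha> x)) = c * (\<Sum>\<alpha>\<in>Rp. k \<alpha> * E (reflection \<alpha> x) lam)"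
      unfolding sum_distrib_left
    proof (intro sum.cong refl)
      fix \<alpha> assume "\<alpha> \<in> Rp"
      then show "k \<alpha> * K t g0 (reflection \<alpha> x) = c * (k \<alpha> * E (reflection \<alpha> x) lam)"
        using norm_reflection[OF pos_root_nz, of \<alpha> x]
        by (simp add: K_g0 c_def power2_norm_eq_inner[symmetric])
    qed
    also have "\<dots> \<le> c * ((2 * (norm x * norm lam) + gam) * E x lam)"
      using \<open>0 < c\<close> by (intro mult_left_mono dunkl_E_harnack) auto
    finally show ?thesis by (simp add: K mult_ac)
  qed
  finally show ?thesis
    using t by (simp add: moment_bound_def algebra_simps)
qed

lemma norm_sq_exp: "\<bar>(norm y)\<^sup>2\<bar> \<le> 2 * exp (1 * norm (y::real^'n))"
proof -
  have "1 + norm y + (norm y)\<^sup>2 / 2 \<le> exp (norm y)"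
    by (rule exp_lower_Taylor_quadratic) simp
  then have "(norm y)\<^sup>2 \<le> 2 * exp (norm y)"
    using norm_ge_zero[of y] by linarith
  then show ?thesis by simp
qed

lemma K_second_bound: "K t (\<lambda>y. (norm y)\<^sup>2 * g0 y) x \<le> moment_bound x * K t g0 x"
proof -
  obtain X where X: "X \<longlonglongrightarrow> x" "\<And>n. generic (X n)" using generic_sequence[of x] by blast
  have r: "rapid (\<lambda>y. (norm y)\<^sup>2 * g0 y)"
    by (rule rapid_mult[OF rapid_g0 _ norm_sq_exp]) measurable
  have 1: "(\<lambda>n. K t (\<lambda>y. (norm y)\<^sup>2 * g0 y) (X n)) \<longlonglongrightarrow> K t (\<lambda>y. (norm y)\<^sup>2 * g0 y) x"
    by (rule K_continuous[OF t r X(1)])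
  have 2: "(\<lambda>n. moment_bound (X n) * K t g0 (X n)) \<longlonglongrightarrow> moment_bound x * K t g0 x"
    unfolding moment_bound_def by (intro tendsto_intros X K_continuous[OF t rapid_g0])
  show ?thesis
    by (rule LIMSEQ_le[OF 1 2]) (use K_second_bound_generic[OF X(2)] in blast)
qed

lemma transition_mean:
  "integrable (dunkl_transition Rp k lam t x) (\<lambda>y. y \<bullet> \<xi>)"
  "(\<integral>y. y \<bullet> \<xi> \<partial>dunkl_transition Rp k lam t x) = x \<bullet> \<xi> + t * (lam \<bullet> \<xi>)"
proof -
  have le: "\<bar>y \<bullet> \<xi>\<bar> \<le> norm \<xi> * exp (1 * norm y)" for y
  proof -
    have "\<bar>y \<bullet> \<xi>\<bar> \<le> norm \<xi> * norm y"
      using Cauchy_Schwarz_ineq2[of y \<xi>] by (simp add: mult.commute)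
    also have "\<dots> \<le> norm \<xi> * exp (1 * norm y)"
      by (intro mult_left_mono) (simp_all add: le_exp)
    finally show ?thesis .
  qed
  show "integrable (dunkl_transition Rp k lam t x) (\<lambda>y. y \<bullet> \<xi>)"
    by (rule transition_integral(1)[OF _ le]) measurable
  have "(\<integral>y. y \<bullet> \<xi> \<partial>dunkl_transition Rp k lam t x) = rho x * K t (\<lambda>y. (y \<bullet> \<xi>) * g0 y) x"
    by (rule transition_integral(2)[OF _ le]) measurable
  also have "\<dots> = (x \<bullet> \<xi> + t * (lam \<bullet> \<xi>)) * (rho x * K t g0 x)"
    unfolding K_first by simp
  finally show "(\<integral>y. y \<bullet> \<xi> \<partial>dunkl_transition Rp k lam t x) = x \<bullet> \<xi> + t * (lam \<bullet> \<xi>)"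
    by (simp add: rho_K)
qed

lemma transition_norm2:
  "integrable (dunkl_transition Rp k lam t x) (\<lambda>y. (norm y)\<^sup>2)"
  "(\<integral>y. (norm y)\<^sup>2 \<partial>dunkl_transition Rp k lam t x) \<le> moment_bound x"
proof -
  show "integrable (dunkl_transition Rp k lam t x) (\<lambda>y. (norm y)\<^sup>2)"
    by (rule transition_integral(1)[OF _ norm_sq_exp]) measurable
  have "(\<integral>y. (norm y)\<^sup>2 \<partial>dunkl_transition Rp k lam t x) = rho x * K t (\<lambda>y. (norm y)\<^sup>2 * g0 y) x"
    by (rule transition_integral(2)[OF _ norm_sq_exp]) measurable
  also have "\<dots> \<le> rho x * (moment_bound x * K t g0 x)"
    by (intro mult_left_mono K_second_bound rho_nonneg)
  also have "\<dots> = moment_bound x * (rho x * K t g0 x)" by simp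
  finally show "(\<integral>y. (norm y)\<^sup>2 \<partial>dunkl_transition Rp k lam t x) \<le> moment_bound x"
    by (simp add: rho_K)
qed

lemma moment_bound_le: "\<exists>A\<ge>0. \<forall>x. moment_bound x \<le> A * (1 + norm x)\<^sup>2"
proof (intro exI conjI allI)
  let ?L = "norm lam"
  let ?A = "t * real CARD('n) + (1 + t * ?L)\<^sup>2 + 4 * t * ?L + 2 * t * gam"
  show "0 \<le> ?A" using t gam_nonneg by simp
  fix x :: "real^'n"
  have 1: "1 \<le> (1 + norm x)\<^sup>2" by (simp add: one_le_power)
  have 2: "norm x \<le> (1 + norm x)\<^sup>2" by (simp add: power2_eq_square algebra_simps)
  have "norm (x + t *\<^sub>R lam) \<le> norm x + t * ?L"
    using norm_triangle_ineq[of x "t *\<^sub>R lam"] t by simp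
  also have "\<dots> \<le> (1 + t * ?L) * (1 + norm x)"
    using t by (simp add: algebra_simps)
  finally have 3: "(norm (x + t *\<^sub>R lam))\<^sup>2 \<le> (1 + t * ?L)\<^sup>2 * (1 + norm x)\<^sup>2"
    by (metis norm_ge_zero power_mono power_mult_distrib)
  have "t * real CARD('n) * 1 \<le> t * real CARD('n) * (1 + norm x)\<^sup>2"
    "4 * t * ?L * norm x \<le> 4 * t * ?L * (1 + norm x)\<^sup>2"
    "2 * t * gam * 1 \<le> 2 * t * gam * (1 + norm x)\<^sup>2"
    using t gam_nonneg 1 2 by (intro mult_left_mono; simp)+
  then show "moment_bound x \<le> ?A * (1 + norm x)\<^sup>2"
    using 3 unfolding moment_bound_def by (simp add: distrib_right distrib_left mult_ac)
qed

text \<open>With \<open>c = 1 + norm x\<close>, the inequality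
  \<open>norm y \<le> (norm y)\<^sup>2 / c + c\<close> turns a second moment of order
  \<open>c\<^sup>2\<close> into a first moment of order \<open>c\<close>.\<close>

lemma transition_norm:
  "\<exists>A\<ge>0. \<forall>x. (\<integral>\<^sup>+y. norm y \<partial>dunkl_transition Rp k lam t x) \<le> ennreal (A * (1 + norm x))"
proof -
  obtain A where A: "A \<ge> 0" "\<And>x. moment_bound x \<le> A * (1 + norm x)\<^sup>2" using moment_bound_le by blast
  have "(\<integral>\<^sup>+y. norm y \<partial>dunkl_transition Rp k lam t x) \<le> ennreal ((A + 1) * (1 + norm x))" for x
  proof -
    interpret prob_space "dunkl_transition Rp k lam t x" by (rule prob)
    let ?c = "1 + norm x"
    have c: "?c > 0" using norm_ge_zero[of x] by linarith
    have le: "norm y \<le> (norm y)\<^sup>2 / ?c + ?c" for y :: "real^'n"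
    proof -
      have "norm y * ?c \<le> (norm y)\<^sup>2 + ?c * ?c"
      proof -
        have "2 * (norm y * ?c) \<le> (norm y)\<^sup>2 + ?c * ?c"
          using sum_squares_bound[of "norm y" ?c] by (simp only: power2_eq_square mult.assoc)
        moreover have "0 \<le> norm y * ?c" using c by (intro mult_nonneg_nonneg) auto
        ultimately show ?thesis by linarith
      qed
      then show ?thesis using c by (simp add: field_simps)
    qed
    have int: "integrable (dunkl_transition Rp k lam t x) (\<lambda>y. (norm y)\<^sup>2 / ?c + ?c)"
      by (intro Bochner_Integration.integrable_add Bochner_Integration.integrable_divide transition_norm2 integrable_const)
    have "(\<integral>\<^sup>+y. norm y \<partial>dunkl_transition Rp k lam t x) \<le> (\<integral>\<^sup>+y. ennreal ((norm y)\<^sup>2 / ?c + ?c) \<partial>dunkl_transition Rp k lam t x)"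
      by (intro nn_integral_mono ennreal_leI le)
    also have "\<dots> = ennreal (\<integral>y. (norm y)\<^sup>2 / ?c + ?c \<partial>dunkl_transition Rp k lam t x)"
      using c by (intro nn_integral_eq_integral int AE_I2) simp
    also have "(\<integral>y. (norm y)\<^sup>2 / ?c + ?c \<partial>dunkl_transition Rp k lam t x) =
      (\<integral>y. (norm y)\<^sup>2 \<partial>dunkl_transition Rp k lam t x) / ?c + ?c"
      using prob_space by (subst Bochner_Integration.integral_add) (auto intro!: transition_norm2)
    also have "\<dots> \<le> A * ?c\<^sup>2 / ?c + ?c"
      using transition_norm2(2)[of x] A(2)[of x] c by (intro add_right_mono divide_right_mono) auto
    also have "\<dots> = (A + 1) * ?c" using c by (simp add: power2_eq_square field_simps)
    finally show ?thesis by (simp add: ennreal_leI)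
  qed
  then show ?thesis using A(1) by (intro exI[of _ "A + 1"]) auto
qed

end

section \<open>The martingale property\<close>

lemma space_canonical_filtration: "space (canonical_filtration M X s) = space M"
  unfolding canonical_filtration_def by (intro space_measure_of) auto

lemma sets_canonical_filtration:
  "sets (canonical_filtration M X s) =
    sigma_sets (space M) {X r -` A \<inter> space M | r A. 0 \<le> r \<and> r \<le> s \<and> A \<in> sets borel}"
  unfolding canonical_filtration_def by (intro sets_measure_of) auto

lemma subalgebra_canonical_filtration:
  assumes "\<And>t. 0 \<le> t \<Longrightarrow> X t \<in> borel_measurable M"
  shows "subalgebra M (canonical_filtration M X s)"
  unfolding subalgebra_def space_canonical_filtration sets_canonical_filtration
  using assms by (auto intro!: sets.sigma_sets_subset measurable_sets)

lemma canonical_filtration_mono: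
  assumes "s \<le> t"
  shows "sets (canonical_filtration M X s) \<subseteq> sets (canonical_filtration M X t)"
proof -
  have "{X r -` A \<inter> space M | r A. 0 \<le> r \<and> r \<le> s \<and> A \<in> sets borel}
    \<subseteq> {X r -` A \<inter> space M | r A. 0 \<le> r \<and> r \<le> t \<and> A \<in> sets borel}"
    using assms by (blast intro: order_trans)
  then show ?thesis
    unfolding sets_canonical_filtration by (rule sigma_sets_subseteq)
qed

lemma measurable_canonical_filtration:
  fixes X :: "real \<Rightarrow> 'w \<Rightarrow> 'a::topological_space"
  assumes "0 \<le> r" "r \<le> s"
  shows "X r \<in> borel_measurable (canonical_filtration M X s)"
proof (rule measurableI)
  fix A :: "'a set" assume "A \<in> sets borel"
  then show "X r -` A \<inter> space (canonical_filtration M X s) \<in> sets (canonical_filtration M X s)"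
    unfolding space_canonical_filtration sets_canonical_filtration
    using assms by (intro sigma_sets.Basic) blast
qed simp

section \<open>The Markov property for integrals of unbounded functions\<close>

locale feller =
  fixes \<kappa> :: "real \<Rightarrow> 'a::euclidean_space \<Rightarrow> 'a measure" and M :: "'w measure" and X :: "real \<Rightarrow> 'w \<Rightarrow> 'a"
  assumes feller: "feller_process \<kappa> M X"
begin

abbreviation "F \<equiv> canonical_filtration M X"

lemma prob_M: "prob_space M"
  and measurable_X: "t \<ge> 0 \<Longrightarrow> X t \<in> borel_measurable M"
  and measurable_\<kappa>: "t > 0 \<Longrightarrow> \<kappa> t \<in> borel \<rightarrow>\<^sub>M prob_algebra borel"
  and markov: "0 \<le> s \<Longrightarrow> s < t \<Longrightarrow> A \<in> sets borel \<Longrightarrow>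
    AE \<omega> in M. real_cond_exp M (F s) (\<lambda>\<omega>. indicator A (X t \<omega>)) \<omega> = measure (\<kappa> (t - s) (X s \<omega>)) A"
  using feller unfolding feller_process_def feller_semigroup_def by blast+

lemma subalg: "subalgebra M (F s)"
  by (intro subalgebra_canonical_filtration measurable_X)

lemma prob_\<kappa>: "t > 0 \<Longrightarrow> prob_space (\<kappa> t x)" and sets_\<kappa>: "t > 0 \<Longrightarrow> sets (\<kappa> t x) = sets borel"
  using measurable_space[OF measurable_\<kappa>, of t x] by (auto simp: space_prob_algebra)

text \<open>The Markov property is given only for indicators. Under \<open>M\<close> restricted to
  \<open>B\<close> it says that the law of \<open>X t\<close> is the law of \<open>X s\<close>
  followed by the kernel; equality of these measures gives all nonnegative integrands at
  once.\<close>

lemma markov_nn_integral: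
  fixes f :: "'a \<Rightarrow> ennreal"
  assumes s: "0 \<le> s" "s < t" and B: "B \<in> sets (F s)" and f: "f \<in> borel_measurable borel"
  shows "(\<integral>\<^sup>+\<omega>. indicator B \<omega> * f (X t \<omega>) \<partial>M) =
    (\<integral>\<^sup>+\<omega>. indicator B \<omega> * (\<integral>\<^sup>+y. f y \<partial>\<kappa> (t - s) (X s \<omega>)) \<partial>M)"
proof -
  interpret prob_space M by (rule prob_M)
  interpret finite_measure_subalgebra M "F s"
    by unfold_locales (rule subalg)
  have [measurable]: "X t \<in> borel_measurable M" "X s \<in> borel_measurable M" "B \<in> sets M"
    using s B subalg by (auto intro: measurable_X simp: subalgebra_def)
  have \<kappa>[measurable]: "\<kappa> (t - s) \<in> borel \<rightarrow>\<^sub>M subprob_algebra borel"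
    using s by (intro measurable_prob_algebraD measurable_\<kappa>) simp
  define MB where "MB = density M (indicator B)"
  have [measurable_cong, simp]: "sets MB = sets M" and [simp]: "space MB = space M"
    by (auto simp: MB_def)
  have ne: "space (distr MB borel (X s)) \<noteq> {}" by simp
  have eq: "distr MB borel (X t) = distr MB borel (X s) \<bind> \<kappa> (t - s)"
  proof (rule measure_eqI)
    show "sets (distr MB borel (X t)) = sets (distr MB borel (X s) \<bind> \<kappa> (t - s))"
      using s ne by (subst sets_bind[where N = borel]) (auto simp: sets_\<kappa>)
    fix A assume "A \<in> sets (distr MB borel (X t))"
    then have A[measurable]: "A \<in> sets borel" by simp
    have m[measurable]: "(\<lambda>x. measure (\<kappa> (t - s) x) A) \<in> borel_measurable borel"
      unfolding measure_def
      by (intro measurable_compose[OF measurable_compose[OF \<kappa> measurable_emeasure_subprob_algebra[OF A]]]) measurable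
    have p: "measure (\<kappa> (t - s) x) A \<le> 1" "emeasure (\<kappa> (t - s) x) A = ennreal (measure (\<kappa> (t - s) x) A)" for x
    proof -
      interpret K: prob_space "\<kappa> (t - s) x" using s by (intro prob_\<kappa>) simp
      show "measure (\<kappa> (t - s) x) A \<le> 1" by (rule K.prob_le_1)
      show "emeasure (\<kappa> (t - s) x) A = ennreal (measure (\<kappa> (t - s) x) A)" by (rule K.emeasure_eq_measure)
    qed
    have i1: "integrable M (\<lambda>\<omega>. indicator A (X t \<omega>) :: real)"
      by (intro integrable_const_bound[where B = 1]) (auto simp: indicator_def)
    have i1B: "integrable M (\<lambda>\<omega>. indicator B \<omega> * indicator A (X t \<omega>) :: real)"
      by (intro integrable_const_bound[where B = 1]) (auto simp: indicator_def)
    have i2B: "integrable M (\<lambda>\<omega>. indicator B \<omega> * measure (\<kappa> (t - s) (X s \<omega>)) A)"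
      by (intro integrable_const_bound[where B = 1]) (auto simp: indicator_def p)
    have "emeasure (distr MB borel (X t)) A = (\<integral>\<^sup>+\<omega>. indicator B \<omega> * indicator (X t -` A \<inter> space M) \<omega> \<partial>M)"
      by (subst emeasure_distr) (auto simp: MB_def emeasure_density)
    also have "\<dots> = (\<integral>\<^sup>+\<omega>. ennreal (indicator B \<omega> * indicator A (X t \<omega>)) \<partial>M)"
      by (intro nn_integral_cong) (auto simp: indicator_def)
    also have "\<dots> = ennreal (\<integral>\<omega>. indicator B \<omega> * indicator A (X t \<omega>) \<partial>M)"
      by (intro nn_integral_eq_integral i1B) auto
    also have "(\<integral>\<omega>. indicator B \<omega> * indicator A (X t \<omega>) \<partial>M) =
      (\<integral>\<omega>. indicator B \<omega> * real_cond_exp M (F s) (\<lambda>\<omega>. indicator A (X t \<omega>)) \<omega> \<partial>M)"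
      using real_cond_exp_intA[OF i1 B] by (simp add: set_lebesgue_integral_def)
    also have "\<dots> = (\<integral>\<omega>. indicator B \<omega> * measure (\<kappa> (t - s) (X s \<omega>)) A \<partial>M)"
    proof (rule integral_cong_AE)
      show "AE \<omega> in M. indicator B \<omega> * real_cond_exp M (F s) (\<lambda>\<omega>. indicator A (X t \<omega>)) \<omega> =
        indicator B \<omega> * measure (\<kappa> (t - s) (X s \<omega>)) A"
        using markov[OF s A] by eventually_elim simp
    qed measurable
    also have "ennreal \<dots> = (\<integral>\<^sup>+\<omega>. ennreal (indicator B \<omega> * measure (\<kappa> (t - s) (X s \<omega>)) A) \<partial>M)"
      by (intro nn_integral_eq_integral[symmetric] i2B) auto
    also have "\<dots> = (\<integral>\<^sup>+\<omega>. indicator B \<omega> * emeasure (\<kappa> (t - s) (X s \<omega>)) A \<partial>M)"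
      by (intro nn_integral_cong) (auto simp: indicator_def p)
    also have "\<dots> = (\<integral>\<^sup>+x. emeasure (\<kappa> (t - s) x) A \<partial>distr MB borel (X s))"
      unfolding MB_def
      by (subst nn_integral_distr) (auto simp: nn_integral_density measurable_compose[OF \<kappa> measurable_emeasure_subprob_algebra])
    also have "\<dots> = emeasure (distr MB borel (X s) \<bind> \<kappa> (t - s)) A"
      using ne by (subst emeasure_bind[where N = borel]) auto
    finally show "emeasure (distr MB borel (X t)) A = emeasure (distr MB borel (X s) \<bind> \<kappa> (t - s)) A" .
  qed
  have mk: "(\<lambda>x. \<integral>\<^sup>+y. f y \<partial>\<kappa> (t - s) x) \<in> borel_measurable borel"
    using measurable_compose[OF \<kappa> nn_integral_measurable_subprob_algebra[OF f]] .
  have "(\<integral>\<^sup>+\<omega>. indicator B \<omega> * f (X t \<omega>) \<partial>M) = (\<integral>\<^sup>+y. f y \<partial>distr MB borel (X t))"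
    unfolding MB_def using f by (subst nn_integral_distr) (auto simp: nn_integral_density)
  also have "\<dots> = (\<integral>\<^sup>+x. \<integral>\<^sup>+y. f y \<partial>\<kappa> (t - s) x \<partial>distr MB borel (X s))"
    unfolding eq using \<kappa> by (intro nn_integral_bind[OF f]) simp
  also have "\<dots> = (\<integral>\<^sup>+\<omega>. indicator B \<omega> * (\<integral>\<^sup>+y. f y \<partial>\<kappa> (t - s) (X s \<omega>)) \<partial>M)"
    unfolding MB_def using mk by (subst nn_integral_distr) (auto simp: nn_integral_density)
  finally show ?thesis .
qed

text \<open>Positive and negative parts are treated separately. Integrability of the kernel averages
  over \<open>B\<close> comes out of the nonnegative identity, so their difference can be
  formed.\<close>

lemma markov_integral:
  fixes f :: "'a \<Rightarrow> real"
  assumes s: "0 \<le> s" "s < t" and B: "B \<in> sets (F s)" and f: "f \<in> borel_measurable borel"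
    and int: "integrable M (\<lambda>\<omega>. f (X t \<omega>))" and int\<kappa>: "\<And>x. integrable (\<kappa> (t - s) x) f"
  shows "(\<integral>\<omega>. indicator B \<omega> * f (X t \<omega>) \<partial>M) =
    (\<integral>\<omega>. indicator B \<omega> * (\<integral>y. f y \<partial>\<kappa> (t - s) (X s \<omega>)) \<partial>M)"
proof -
  have [measurable]: "X t \<in> borel_measurable M" "X s \<in> borel_measurable M" "B \<in> sets M"
    using s B subalg by (auto intro: measurable_X simp: subalgebra_def)
  note f[measurable]
  have \<kappa>: "\<kappa> (t - s) \<in> borel \<rightarrow>\<^sub>M subprob_algebra borel"
    using s by (intro measurable_prob_algebraD measurable_\<kappa>) simp
  have pos: "integrable M (\<lambda>\<omega>. indicator B \<omega> * (\<integral>y. g y \<partial>\<kappa> (t - s) (X s \<omega>))) \<and>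
      (\<integral>\<omega>. indicator B \<omega> * g (X t \<omega>) \<partial>M) = (\<integral>\<omega>. indicator B \<omega> * (\<integral>y. g y \<partial>\<kappa> (t - s) (X s \<omega>)) \<partial>M)"
    if g[measurable]: "g \<in> borel_measurable borel" and nn: "\<And>y. 0 \<le> g y"
      and ig: "integrable M (\<lambda>\<omega>. g (X t \<omega>))" and ik: "\<And>x. integrable (\<kappa> (t - s) x) g" for g :: "'a \<Rightarrow> real"
  proof -
    have [measurable]: "(\<lambda>x. \<integral>y. g y \<partial>\<kappa> (t - s) x) \<in> borel_measurable borel"
      using measurable_compose[OF \<kappa> integral_measurable_subprob_algebra[OF g]] .
    have iB: "integrable M (\<lambda>\<omega>. indicator B \<omega> * g (X t \<omega>))"
      using integrable_mult_indicator[OF _ ig, of B] by simp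
    have "(\<integral>\<^sup>+\<omega>. ennreal (indicator B \<omega> * (\<integral>y. g y \<partial>\<kappa> (t - s) (X s \<omega>))) \<partial>M) =
      (\<integral>\<^sup>+\<omega>. indicator B \<omega> * (\<integral>\<^sup>+y. ennreal (g y) \<partial>\<kappa> (t - s) (X s \<omega>)) \<partial>M)"
      by (intro nn_integral_cong) (auto simp: indicator_def nn_integral_eq_integral ik nn)
    also have "\<dots> = (\<integral>\<^sup>+\<omega>. indicator B \<omega> * ennreal (g (X t \<omega>)) \<partial>M)"
      by (rule markov_nn_integral[OF s B, symmetric]) measurable
    also have "\<dots> = (\<integral>\<^sup>+\<omega>. ennreal (indicator B \<omega> * g (X t \<omega>)) \<partial>M)"
      by (intro nn_integral_cong) (auto simp: indicator_def)
    also have "\<dots> = ennreal (\<integral>\<omega>. indicator B \<omega> * g (X t \<omega>) \<partial>M)"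
      by (intro nn_integral_eq_integral iB) (auto simp: nn)
    finally have nn_eq: "(\<integral>\<^sup>+\<omega>. ennreal (indicator B \<omega> * (\<integral>y. g y \<partial>\<kappa> (t - s) (X s \<omega>))) \<partial>M) =
      ennreal (\<integral>\<omega>. indicator B \<omega> * g (X t \<omega>) \<partial>M)" .
    have nnI: "0 \<le> indicator B \<omega> * (\<integral>y. g y \<partial>\<kappa> (t - s) (X s \<omega>))" for \<omega>
      by (simp add: nn integral_nonneg_AE)
    have "integrable M (\<lambda>\<omega>. indicator B \<omega> * (\<integral>y. g y \<partial>\<kappa> (t - s) (X s \<omega>)))"
      using nn_eq nnI by (intro integrableI_nonneg) auto
    moreover from this have "(\<integral>\<omega>. indicator B \<omega> * (\<integral>y. g y \<partial>\<kappa> (t - s) (X s \<omega>)) \<partial>M) = (\<integral>\<omega>. indicator B \<omega> * g (X t \<omega>) \<partial>M)"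
      using nn_eq nnI nn by (subst (asm) nn_integral_eq_integral) (auto intro!: integral_nonneg_AE)
    ultimately show ?thesis by simp
  qed
  let ?p = "\<lambda>y. max 0 (f y)" and ?n = "\<lambda>y. max 0 (- f y)"
  have P: "integrable M (\<lambda>\<omega>. indicator B \<omega> * (\<integral>y. ?p y \<partial>\<kappa> (t - s) (X s \<omega>)))"
      "(\<integral>\<omega>. indicator B \<omega> * ?p (X t \<omega>) \<partial>M) = (\<integral>\<omega>. indicator B \<omega> * (\<integral>y. ?p y \<partial>\<kappa> (t - s) (X s \<omega>)) \<partial>M)"
    using pos[of ?p] int int\<kappa> by auto
  have N: "integrable M (\<lambda>\<omega>. indicator B \<omega> * (\<integral>y. ?n y \<partial>\<kappa> (t - s) (X s \<omega>)))"
      "(\<integral>\<omega>. indicator B \<omega> * ?n (X t \<omega>) \<partial>M) = (\<integral>\<omega>. indicator B \<omega> * (\<integral>y. ?n y \<partial>\<kappa> (t - s) (X s \<omega>)) \<partial>M)"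
    using pos[of ?n] int int\<kappa> by auto
  have split: "f y = ?p y - ?n y" for y by simp
  have iB: "integrable M (\<lambda>\<omega>. indicator B \<omega> * ?p (X t \<omega>))" "integrable M (\<lambda>\<omega>. indicator B \<omega> * ?n (X t \<omega>))"
    using integrable_mult_indicator[of B M "\<lambda>\<omega>. ?p (X t \<omega>)"] integrable_mult_indicator[of B M "\<lambda>\<omega>. ?n (X t \<omega>)"] int
    by auto
  have "(\<integral>\<omega>. indicator B \<omega> * f (X t \<omega>) \<partial>M) = (\<integral>\<omega>. indicator B \<omega> * ?p (X t \<omega>) - indicator B \<omega> * ?n (X t \<omega>) \<partial>M)"
    by (intro Bochner_Integration.integral_cong refl) (simp add: indicator_def max_def)
  also have "\<dots> = (\<integral>\<omega>. indicator B \<omega> * (\<integral>y. ?p y \<partial>\<kappa> (t - s) (X s \<omega>)) - indicator B \<omega> * (\<integral>y. ?n y \<partial>\<kappa> (t - s) (X s \<omega>)) \<partial>M)"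
    using iB P N by (simp add: Bochner_Integration.integral_diff)
  also have "\<dots> = (\<integral>\<omega>. indicator B \<omega> * (\<integral>y. f y \<partial>\<kappa> (t - s) (X s \<omega>)) \<partial>M)"
  proof (intro Bochner_Integration.integral_cong refl)
    fix \<omega>
    have "(\<integral>y. f y \<partial>\<kappa> (t - s) (X s \<omega>)) = (\<integral>y. ?p y - ?n y \<partial>\<kappa> (t - s) (X s \<omega>))"
      using split by simp
    also have "\<dots> = (\<integral>y. ?p y \<partial>\<kappa> (t - s) (X s \<omega>)) - (\<integral>y. ?n y \<partial>\<kappa> (t - s) (X s \<omega>))"
      using int\<kappa> by (intro Bochner_Integration.integral_diff) auto
    finally show "indicator B \<omega> * (\<integral>y. ?p y \<partial>\<kappa> (t - s) (X s \<omega>)) - indicator B \<omega> * (\<integral>y. ?n y \<partial>\<kappa> (t - s) (X s \<omega>)) =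
      indicator B \<omega> * (\<integral>y. f y \<partial>\<kappa> (t - s) (X s \<omega>))"
      by (simp add: right_diff_distrib)
  qed
  finally show ?thesis .
qed

text \<open>The Markov property from time 0 over the whole space; linear growth of the first
  absolute moment lets integrability of the starting value suffice.\<close>

lemma integrable_X:
  assumes X0: "integrable M (X 0)" and t: "t \<ge> 0"
    and bound: "\<And>t. t > 0 \<Longrightarrow> \<exists>A\<ge>0. \<forall>x. (\<integral>\<^sup>+y. norm y \<partial>\<kappa> t x) \<le> ennreal (A * (1 + norm x))"
  shows "integrable M (X t)"
proof (cases "t = 0")
  case False
  interpret prob_space M by (rule prob_M)
  have [measurable]: "X t \<in> borel_measurable M"
    using t by (rule measurable_X)
  obtain A where A: "A \<ge> 0" "\<And>x. (\<integral>\<^sup>+y. norm y \<partial>\<kappa> t x) \<le> ennreal (A * (1 + norm x))"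
    using bound[of t] False t by auto
  have "space M \<in> sets (F 0)"
    using sets.top[of "F 0"] by (simp add: space_canonical_filtration)
  then have "(\<integral>\<^sup>+\<omega>. indicator (space M) \<omega> * ennreal (norm (X t \<omega>)) \<partial>M) =
      (\<integral>\<^sup>+\<omega>. indicator (space M) \<omega> * (\<integral>\<^sup>+y. ennreal (norm y) \<partial>\<kappa> (t - 0) (X 0 \<omega>)) \<partial>M)"
    using False t by (intro markov_nn_integral) auto
  also have "\<dots> \<le> (\<integral>\<^sup>+\<omega>. ennreal (A * (1 + norm (X 0 \<omega>))) \<partial>M)"
    using A(2) by (intro nn_integral_mono) (auto simp: indicator_def)
  also have "\<dots> = ennreal (\<integral>\<omega>. A * (1 + norm (X 0 \<omega>)) \<partial>M)"
    using A(1) X0 by (intro nn_integral_eq_integral) auto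
  also have "\<dots> < \<infinity>" by simp
  finally have "(\<integral>\<^sup>+\<omega>. indicator (space M) \<omega> * ennreal (norm (X t \<omega>)) \<partial>M) < \<infinity>" .
  also have "(\<integral>\<^sup>+\<omega>. indicator (space M) \<omega> * ennreal (norm (X t \<omega>)) \<partial>M) = (\<integral>\<^sup>+\<omega>. ennreal (norm (X t \<omega>)) \<partial>M)"
    by (intro nn_integral_cong) simp
  finally show ?thesis by (intro integrableI_bounded) auto
qed (use X0 in simp)

lemma martingale_component:
  assumes X0: "integrable M (X 0)"
    and bound: "\<And>t. t > 0 \<Longrightarrow> \<exists>A\<ge>0. \<forall>x. (\<integral>\<^sup>+y. norm y \<partial>\<kappa> t x) \<le> ennreal (A * (1 + norm x))"
    and mean: "\<And>t x. t > 0 \<Longrightarrow> integrable (\<kappa> t x) (\<lambda>y. y \<bullet> b)"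
      "\<And>t x. t > 0 \<Longrightarrow> (\<integral>y. y \<bullet> b \<partial>\<kappa> t x) = x \<bullet> b + t * c"
  shows "real_martingale M F (\<lambda>t \<omega>. X t \<omega> \<bullet> b - t * c)"
  unfolding real_martingale_def
proof (intro conjI allI impI)
  interpret prob_space M by (rule prob_M)
  have int: "integrable M (\<lambda>\<omega>. X t \<omega> \<bullet> b)" if "t \<ge> 0" for t
    using integrable_X[OF X0 that bound] by (rule integrable_inner_left)
  show sub: "subalgebra M (F t)" for t by (rule subalg)
  show "sets (F s) \<subseteq> sets (F t)" if "s \<le> t" for s t
    using that by (rule canonical_filtration_mono)
  show meas: "(\<lambda>\<omega>. X t \<omega> \<bullet> b - t * c) \<in> borel_measurable (F t)" if "0 \<le> t" for t
  proof -
    have [measurable]: "X t \<in> borel_measurable (F t)"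
      using that by (intro measurable_canonical_filtration) auto
    show ?thesis by measurable
  qed
  show intY: "integrable M (\<lambda>\<omega>. X t \<omega> \<bullet> b - t * c)" if "0 \<le> t" for t
    using int[OF that] by auto
  show "AE \<omega> in M. real_cond_exp M (F s) (\<lambda>\<omega>. X t \<omega> \<bullet> b - t * c) \<omega> = X s \<omega> \<bullet> b - s * c"
    if s: "0 \<le> s" "s \<le> t" for s t
  proof -
    interpret finite_measure_subalgebra M "F s"
      by unfold_locales (rule subalg)
    show ?thesis
    proof (rule real_cond_exp_charact)
      fix B assume B: "B \<in> sets (F s)"
      then have BM[measurable]: "B \<in> sets M" using subalg by (auto simp: subalgebra_def)
      show "(\<integral>\<omega>\<in>B. (X t \<omega> \<bullet> b - t * c) \<partial>M) = (\<integral>\<omega>\<in>B. (X s \<omega> \<bullet> b - s * c) \<partial>M)"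
      \<comment> \<open>The kernels describe the process for positive time differences only, so
        equal times are separated.\<close>
      proof (cases "s = t")
        case False
        then have st: "s < t" using s by simp
        have iB: "integrable M (\<lambda>\<omega>. indicator B \<omega> * (X r \<omega> \<bullet> b))" if "r \<ge> 0" for r
          using integrable_mult_indicator[OF BM int[OF that]] by simp
        have ind: "integrable M (indicat_real B)"
          by (simp add: less_top[symmetric])
        have "(\<integral>\<omega>. indicator B \<omega> * (X t \<omega> \<bullet> b) \<partial>M) =
          (\<integral>\<omega>. indicator B \<omega> * (\<integral>y. y \<bullet> b \<partial>\<kappa> (t - s) (X s \<omega>)) \<partial>M)"
          using st s by (intro markov_integral B int mean) auto
        also have "\<dots> = (\<integral>\<omega>. indicator B \<omega> * (X s \<omega> \<bullet> b) + indicator B \<omega> * ((t - s) * c) \<partial>M)"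
          using st by (simp add: mean distrib_left)
        also have "\<dots> = (\<integral>\<omega>. indicator B \<omega> * (X s \<omega> \<bullet> b) \<partial>M) + measure M B * ((t - s) * c)"
          using iB[OF s(1)] ind by (subst Bochner_Integration.integral_add) auto
        finally have "(\<integral>\<omega>. indicator B \<omega> * (X t \<omega> \<bullet> b) \<partial>M) - measure M B * (t * c) =
          (\<integral>\<omega>. indicator B \<omega> * (X s \<omega> \<bullet> b) \<partial>M) - measure M B * (s * c)"
          by (simp add: algebra_simps)
        moreover have "(\<integral>\<omega>\<in>B. (X r \<omega> \<bullet> b - r * c) \<partial>M) =
          (\<integral>\<omega>. indicator B \<omega> * (X r \<omega> \<bullet> b) \<partial>M) - measure M B * (r * c)" if "r \<ge> 0" for r
        proof -
          have "(\<integral>\<omega>\<in>B. (X r \<omega> \<bullet> b - r * c) \<partial>M) =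
            (\<integral>\<omega>. indicator B \<omega> * (X r \<omega> \<bullet> b) - indicator B \<omega> * (r * c) \<partial>M)"
            by (simp add: set_lebesgue_integral_def right_diff_distrib)
          then show ?thesis
            using iB[OF that] ind by (subst (asm) Bochner_Integration.integral_diff) auto
        qed
        ultimately show ?thesis using s by simp
      qed simp
    qed (use s intY meas in auto)
  qed
qed

end

theorem theorem5p1:
  fixes R Rp :: "(real^'n) set" and k :: "real^'n \<Rightarrow> real" and lam :: "real^'n"
    and M :: "'w measure" and X :: "real \<Rightarrow> 'w \<Rightarrow> real^'n"
  assumes "root_system R"
    and "positive_subsystem R Rp"
    and "multiplicity_function R k"
    and "dunkl_process Rp k lam M X"
    and "integrable (distr M borel (X 0)) norm"
  shows "vector_martingale M (canonical_filtration M X) (\<lambda>t \<omega>. X t \<omega> - t *\<^sub>R lam) \<and>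
    (distr M borel (X 0) = return borel 0 \<longrightarrow>
      (\<forall>t\<ge>0. integrable M (X t) \<and> (\<integral>\<omega>. X t \<omega> \<partial>M) = t *\<^sub>R lam))"
proof -
  interpret feller "dunkl_transition Rp k lam" M X
    using assms(4) by unfold_locales (simp add: dunkl_process_def)
  interpret prob_space M by (rule prob_M)
  \<comment> \<open>Total mass one at every positive time is taken from the Feller property, which
    makes the moment computation available for each \<open>t\<close>.\<close>
  have dm: "dunkl_markov R Rp k lam t" if "t > 0" for t
    by (intro dunkl_markov.intro dunkl.intro dunkl_markov_axioms.intro assms that prob_\<kappa>)
  note bound = dunkl_markov.transition_norm[OF dm]
  note mean = dunkl_markov.transition_mean[OF dm]
  have m0: "X 0 \<in> borel_measurable M" by (rule measurable_X) simp
  have X0: "integrable M (X 0)"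
    using assms(5) m0 by (simp add: integrable_distr_eq integrable_norm_iff)
  have mart: "real_martingale M F (\<lambda>t \<omega>. X t \<omega> \<bullet> axis i 1 - t * (lam \<bullet> axis i 1))" for i
    by (rule martingale_component[OF X0 bound mean])
  then have vm: "vector_martingale M F (\<lambda>t \<omega>. X t \<omega> - t *\<^sub>R lam)"
    by (simp add: vector_martingale_def inner_axis)
  have "integrable M (X t) \<and> (\<integral>\<omega>. X t \<omega> \<partial>M) = t *\<^sub>R lam"
    if d: "distr M borel (X 0) = return borel 0" and t: "t \<ge> 0" for t
  proof
    show int: "integrable M (X t)" by (rule integrable_X[OF X0 t bound])
    have "(\<integral>\<omega>. X t \<omega> $ i \<partial>M) = t * lam $ i" for i
    proof -
      interpret finite_measure_subalgebra M "F 0"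
        by unfold_locales (rule subalg)
      have iY: "integrable M (\<lambda>\<omega>. X t \<omega> \<bullet> axis i 1 - t * (lam \<bullet> axis i 1))"
        and ce: "AE \<omega> in M. real_cond_exp M (F 0) (\<lambda>\<omega>. X t \<omega> \<bullet> axis i 1 - t * (lam \<bullet> axis i 1)) \<omega> =
          X 0 \<omega> \<bullet> axis i 1 - 0 * (lam \<bullet> axis i 1)"
        using mart[of i] t unfolding real_martingale_def by auto
      \<comment> \<open>A martingale has constant expectation: integrating its conditional
        expectation given time 0 leaves the mean of the starting law, which is 0.\<close>
      have "(\<integral>\<omega>. X t \<omega> \<bullet> axis i 1 - t * (lam \<bullet> axis i 1) \<partial>M) =
        (\<integral>\<omega>. real_cond_exp M (F 0) (\<lambda>\<omega>. X t \<omega> \<bullet> axis i 1 - t * (lam \<bullet> axis i 1)) \<omega> \<partial>M)"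
        by (rule real_cond_exp_int(2)[OF iY, symmetric])
      also have "\<dots> = (\<integral>\<omega>. X 0 \<omega> \<bullet> axis i 1 \<partial>M)"
        using ce m0 by (intro integral_cong_AE) auto
      also have "\<dots> = (\<integral>x. x \<bullet> axis i 1 \<partial>distr M borel (X 0))"
        using m0 by (subst integral_distr) auto
      also have "\<dots> = 0"
        unfolding d by (subst integral_return) auto
      finally have "(\<integral>\<omega>. X t \<omega> \<bullet> axis i 1 - t * (lam \<bullet> axis i 1) \<partial>M) = 0" .
      moreover have "(\<integral>\<omega>. X t \<omega> \<bullet> axis i 1 - t * (lam \<bullet> axis i 1) \<partial>M) =
        (\<integral>\<omega>. X t \<omega> \<bullet> axis i 1 \<partial>M) - t * (lam \<bullet> axis i 1)"
        using integrable_inner_left[OF int] prob_space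
        by (subst Bochner_Integration.integral_diff) auto
      ultimately show ?thesis by (simp add: inner_axis)
    qed
    moreover have "(\<integral>\<omega>. X t \<omega> \<partial>M) $ i = (\<integral>\<omega>. X t \<omega> $ i \<partial>M)" for i
      using integral_inner_left[of "axis i 1" M "X t"] int by (simp add: inner_axis)
    ultimately show "(\<integral>\<omega>. X t \<omega> \<partial>M) = t *\<^sub>R lam"
      by (simp add: vec_eq_iff)
  qed
  with vm show ?thesis by blast
qed

end
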